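(* Consider the online adaptive method, using either spectral problem 1 or spectral problem 2 for the initial basis, and let $\Omega_1,\dots,\Omega_J$ be the non-overlapping regions chosen at enrichment level $m$. Then $$ \|v_{\text{snap}} - v_{\text{ms}}^{m+1}\|_{\mathcal{L}^2(D; \kappa^{-1})}^2 \leq \left( 1 - \frac{\sum_{j=1}^J \|R_{\Omega_j}\|_{\widehat{V}_{\Omega_j}^*}^2}{C_{\text{err}} \sum_{i=1}^{N_e} \|R_{i}\|_{(V_{\text{snap}}^{(i)})^*}^2 (\lambda_{l_i + 1}^{(i)})^{-1}} \right) \|v_{\text{snap}} - v_{\text{ms}}^m\|_{\mathcal{L}^2(D; \kappa^{-1})}^2$$ (the denominator being nonzero), where the residuals $R_{\Omega_j}$ and $R_i$ are those of the solution $(v_{\text{ms}}^m,p_{\text{ms}}^m)$ at level $m$ and $l_i$ is the initial number of eigenfunctions used on $\omega_i$.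
   Context: Problem and meshes. $D\subset\mathbb{R}^d$ is a domain with outward unit normal $n$; $\kappa>0$ is a permeability field; the flow problem is $\kappa^{-1}v+\nabla p=0$, $\mathrm{div}(v)=f$ in $D$, $v\cdot n=g$ on $\partial D$. $\mathcal{T}^H$ is a partition of $D$ into finite elements (coarse blocks) of size $H$, refined to a fine partition $\mathcal{T}^h$ of size $h$ conforming across coarse faces. $\mathcal{E}^H=\{E_1,\dots,E_{N_e}\}$ is the set of all coarse faces, $\omega_i$ is the union of the coarse blocks having $E_i$ as a face (two blocks for a face interior to $D$), $n_i$ is a fixed unit normal on $E_i$, and $N_{\mathcal{T}}$ is the maximum number of faces of a coarse block. $Q$ is the space of functions constant on each coarse block. $\|v\|_{\mathcal{L}^2(\Omega;\kappa^{-1})}^2=\int_\Omega\kappa^{-1}|v|^2$ and $\|v\|_{H(\text{div};\Omega;\kappa^{-1})}^2=\int_\Omega\kappa^{-1}|v|^2+\int_\Omega\mathrm{div}(v)^2$. Snapshot space. Write $E_i=\bigcup_{j=1}^{J_i}e_j$ with $e_j$ the fine faces contained in $E_i$. For each $j$, $v_j^{(i)}$ is the (fine-grid mixed finite element) solution, computed separately on each coarse block $K\subseteq\omega_i$, of $\kappa^{-1}v_j^{(i)}+\nabla p_j^{(i)}=0$, $\mathrm{div}(v_j^{(i)})=\alpha_j^{(i)}$, with zero normal component on $\partial\omega_i$ (apart from $E_i$ itself) and $v_j^{(i)}\cdot n_i$ equal to $1$ on $e_j$ and $0$ on $E_i\setminus e_j$; $\alpha_j^{(i)}$ is constant on each coarse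 block and satisfies the compatibility condition $\int_K\alpha_j^{(i)}=\int_{\partial K}v_j^{(i)}\cdot n_{\partial K}$ ($n_{\partial K}$ the outward unit normal of $K$). These functions are extended by zero outside $\omega_i$. $V_{\text{snap}}^{(i)}=\mathrm{span}\{v_j^{(i)}\}_{j=1}^{J_i}$, $V_{\text{snap}}=\bigoplus_{E_i\in\mathcal{E}^H}V_{\text{snap}}^{(i)}$. Spectral problems. On each $\omega_i$ find $\lambda\in\mathbb{R}$, $v\in V_{\text{snap}}^{(i)}$ with $a_i(v,w)=\lambda s_i(v,w)$ for all $w\in V_{\text{snap}}^{(i)}$. Spectral problem 1: $a_i(v,w)=\int_{E_i}\kappa^{-1}(v\cdot n_i)(w\cdot n_i)$, $s_i(v,w)=\frac1H\left(\int_{\omega_i}\kappa^{-1}v\cdot w+\int_{\omega_i}\mathrm{div}(v)\,\mathrm{div}(w)\right)$. Spectral problem 2: $a_i(v,w)=\int_{\omega_i}\kappa^{-1}\tilde v\cdot\tilde w$, $s_i(v,w)=\int_{\omega_i}\kappa^{-1}v\cdot w$, where $\tilde v\in\bigoplus_{\omega_j\cap\omega_i\neq\emptyset}V_{\text{snap}}^{(j)}$ satisfies $\tilde v\cdot n_i=v\cdot n_i$ on $E_i$ and has minimal $\mathcal{L}^2(\omega_i;\kappa^{-1})$-norm among functions of that space with this normal component on $E_i$. Eigenvalues are ordered $\lambda_1^{(i)}\le\dots\le\lambda_{J_i}^{(i)}$ with eigenfunctions $\phi_j^{(i)}$. Convention: if $l_i=J_i$ then $(\lambda_{l_i+1}^{(i)})^{-1}=0$.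 Discrete solutions. For a subspace $V\subseteq V_{\text{snap}}$ let $V^0=\{v\in V:v\cdot n=0\text{ on }\partial D\}$; the solution in $V\times Q$ is a pair $(v_V,p_V)$ with $v_V\cdot n=g_H$ on $\partial D$, $\int_D\kappa^{-1}v_V\cdot w-\int_D\mathrm{div}(w)p_V=0$ for all $w\in V^0$, $\int_D\mathrm{div}(v_V)q=\int_Dfq$ for all $q\in Q$. Here $g_H$, constant on each fine face of $\partial D$, satisfies $\int_{E_i}(g_H-g)\phi\cdot n=0$ for all $\phi$ in the snapshot basis $\{v_j^{(i)}\}_j$ and all $E_i\subseteq\partial D$. $(v_{\text{snap}},p_{\text{snap}})$ is the solution for $V=V_{\text{snap}}$ and $(v_{\text{ms}}^m,p_{\text{ms}}^m)$ the solution for $V=V_{\text{ms}}^m$; these are assumed to exist. Residuals. For a region $\Omega\subseteq D$, $V_\Omega=\bigoplus_{\omega_i\subseteq\Omega}V_{\text{snap}}^{(i)}$, the sum being over neighborhoods $\omega_i\subseteq\Omega$ that are unions of two coarse blocks (interior faces), and $\widehat V_\Omega$ is the divergence-free subspace of $V_\Omega$. At level $m$, $R_\Omega(v)=\int_\Omega\kappa^{-1}v_{\text{ms}}^m\cdot v-\int_\Omega\mathrm{div}(v)p_{\text{ms}}^m$, so $R_\Omega(v)=\int_\Omega\kappa^{-1}v_{\text{ms}}^m\cdot v$ on $\widehat V_\Omega$, and $\|R_\Omega\|_{\widehat V_\Omega^*}=\sup_{0\neq v\in\widehat V_\Omega}R_\Omega(v)/\|v\|_{\mathcal{L}^2(\Omega;\kappa^{-1})}$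 (on divergence-free functions the $\mathcal{L}^2$ and $H(\text{div})$ norms above coincide; the supremum is $0$ if $\widehat V_\Omega=\{0\}$). $R_i(v)=\int_{\omega_i}\kappa^{-1}v_{\text{ms}}^m\cdot v-\int_{\omega_i}\mathrm{div}(v)p_{\text{ms}}^m$ for $v\in V_{\text{snap}}^{(i)}$, and $\|R_i\|_{(V_{\text{snap}}^{(i)})^*}=\sup_{0\ne v\in V_{\text{snap}}^{(i)}}|R_i(v)|/\|v\|_{V_{\text{snap}}^{(i)}}$. If spectral problem 1 is used, $\|\cdot\|_{V_{\text{snap}}^{(i)}}=\|\cdot\|_{H(\text{div};\omega_i;\kappa^{-1})}$ and $C_{\text{err}}=\frac{C_VH}{h}$, with $C_V$ a constant depending on the polynomial order of the fine grid basis functions in $V_{\text{snap}}$; if spectral problem 2 is used, $\|\cdot\|_{V_{\text{snap}}^{(i)}}=\|\cdot\|_{\mathcal{L}^2(\omega_i;\kappa^{-1})}$ and $C_{\text{err}}=N_{\mathcal{T}}$. In both cases $C_{\text{err}}$ is the constant in the a-posteriori bound $\|v_{\text{snap}}-v_{\text{ms}}^m\|_{\mathcal{L}^2(D;\kappa^{-1})}^2\le C_{\text{err}}\sum_{i=1}^{N_e}\|R_i\|_{(V_{\text{snap}}^{(i)})^*}^2(\lambda_{l_i+1}^{(i)})^{-1}$. Online adaptive method. Choose initial numbers $l_i$; $V_{\text{ms}}^0$ is spanned by the first $l_i$ eigenfunctions $\phi_1^{(i)},\dots,\phi_{l_i}^{(i)}$ on every $\omega_i$, and if for some $\omega_i$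 these are all divergence free, an additional non-divergence-free function of $V_{\text{snap}}^{(i)}$ is included. At level $m=0,1,\dots$: (1) compute $(v_{\text{ms}}^m,p_{\text{ms}}^m)$; (2) pick non-overlapping regions $\Omega_1,\dots,\Omega_J\subseteq D$, each a union of coarse neighborhoods; (3) for each $j$ let $\phi_j\in\widehat V_{\Omega_j}$ be the Riesz representative: $R_{\Omega_j}(v)=\int_{\Omega_j}\kappa^{-1}\phi_j\cdot v$ for all $v\in\widehat V_{\Omega_j}$; set $V_{\text{ms}}^{m+1}=V_{\text{ms}}^m+\mathrm{span}\{\phi_1,\dots,\phi_J\}$. *)

theory Defs
  imports "HOL-Analysis.Analysis" "HOL-Library.Function_Algebras"
begin

text \<open>Functions form a real vector space pointwise, so that \<open>span\<close>, \<open>subspace\<close> and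
  \<open>independent\<close> apply to spaces of (piecewise) fields.\<close>

instantiation "fun" :: (type, real_vector) real_vector
begin

definition scaleR_fun :: "real \<Rightarrow> ('a \<Rightarrow> 'b) \<Rightarrow> 'a \<Rightarrow> 'b" where
  "scaleR_fun c f = (\<lambda>x. c *\<^sub>R f x)"

instance
  by standard (simp_all add: scaleR_fun_def fun_eq_iff scaleR_add_right scaleR_add_left)

end


section \<open>Meshes\<close>

definition mesh_faces :: "'a::euclidean_space set set \<Rightarrow> 'a set set" where
  "mesh_faces T = {F. \<exists>K\<in>T. F facet_of K}"

definition mesh_size :: "'a::euclidean_space set set \<Rightarrow> real" where
  "mesh_size T = Max (diameter ` T)"

text \<open>Cells are closed. The condition \<open>interior (\<Union>T) = D\<close> says that \<open>D\<close> lies on one side of its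
  boundary (no slits), as needed for an outward normal. A face either lies on the boundary of the domain and belongs to one cell, or
  is interior and is shared by exactly two cells (no hanging nodes).\<close>

definition is_mesh :: "'a::euclidean_space set \<Rightarrow> 'a set set \<Rightarrow> bool" where
  "is_mesh D T \<longleftrightarrow>
     finite T \<and> \<Union>T = closure D \<and> interior (\<Union>T) = D \<and>
     (\<forall>K\<in>T. polytope K \<and> interior K \<noteq> {}) \<and>
     (\<forall>K\<in>T. \<forall>K'\<in>T. K \<noteq> K' \<longrightarrow> interior K \<inter> interior K' = {}) \<and>
     (\<forall>F\<in>mesh_faces T.
        F \<subseteq> frontier D \<and> card {K\<in>T. F facet_of K} = 1 \<or>
        rel_interior F \<subseteq> D \<and> card {K\<in>T. F facet_of K} = 2)"

definition refines :: "'a::euclidean_space set set \<Rightarrow> 'a set set \<Rightarrow> bool" where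
  "refines T' T \<longleftrightarrow>
     (\<forall>\<tau>\<in>T'. \<exists>K\<in>T. \<tau> \<subseteq> K) \<and>
     (\<forall>E\<in>mesh_faces T. \<Union>{e\<in>mesh_faces T'. e \<subseteq> E} = E)"

definition unit_normal :: "'a::euclidean_space set \<Rightarrow> 'a \<Rightarrow> bool" where
  "unit_normal F n \<longleftrightarrow> norm n = 1 \<and> (\<forall>x\<in>F. \<forall>y\<in>F. n \<bullet> x = n \<bullet> y)"

text \<open>For a facet \<open>F\<close> of a full-dimensional convex \<open>K\<close> this vector is unique.\<close>

definition outer_normal :: "'a::euclidean_space set \<Rightarrow> 'a set \<Rightarrow> 'a" where
  "outer_normal K F = (SOME n. norm n = 1 \<and> (\<forall>x\<in>F. \<forall>y\<in>K. n \<bullet> y \<le> n \<bullet> x))"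

text \<open>Surface integral over a flat face \<open>e\<close> of codimension one: \<open>\<phi>\<close>, extended constantly in the
  normal direction, is integrated over the prism of height one with base \<open>e\<close>. By Fubini this is
  the integral with respect to \<open>(d - 1)\<close>-dimensional Lebesgue measure on \<open>e\<close> (counting measure if
  \<open>d = 1\<close>), and it does not depend on the choice of the normal and of the base point.\<close>

definition prism :: "'a::euclidean_space set \<Rightarrow> 'a \<Rightarrow> 'a set" where
  "prism e n = {y + t *\<^sub>R n | y t. y \<in> e \<and> 0 \<le> t \<and> t \<le> 1}"

definition normal_ext :: "'a::euclidean_space set \<Rightarrow> 'a \<Rightarrow> ('a \<Rightarrow> real) \<Rightarrow> 'a \<Rightarrow> real" where
  "normal_ext e n \<phi> x = \<phi> (x - (n \<bullet> (x - (SOME a. a \<in> e))) *\<^sub>R n)"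

definition surf_integrable :: "'a::euclidean_space set \<Rightarrow> ('a \<Rightarrow> real) \<Rightarrow> bool" where
  "surf_integrable e \<phi> \<longleftrightarrow>
     (let n = (SOME n. unit_normal e n) in set_integrable lebesgue (prism e n) (normal_ext e n \<phi>))"

definition surf_integral :: "'a::euclidean_space set \<Rightarrow> ('a \<Rightarrow> real) \<Rightarrow> real" where
  "surf_integral e \<phi> =
     (let n = (SOME n. unit_normal e n)
      in set_lebesgue_integral lebesgue (prism e n) (normal_ext e n \<phi>))"


section \<open>Problem data and piecewise fields\<close>

text \<open>A piecewise field is given by one branch for every fine cell, so that one-sided traces on faces
  make sense and a finite element field that vanishes almost everywhere is zero.\<close>

type_synonym 'a vfield = "'a set \<Rightarrow> 'a \<Rightarrow> 'a"
type_synonym 'a sfield = "'a set \<Rightarrow> 'a \<Rightarrow> real"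

text \<open>\<open>Vloc \<tau>\<close> and \<open>Qloc \<tau>\<close> are the velocity and pressure shape functions of the fine-grid mixed
  finite element on the cell \<open>\<tau>\<close>; \<open>fnormal E\<close> is the fixed unit normal of the coarse face \<open>E\<close>;
  \<open>snap E e\<close> is the snapshot function on the neighborhood of \<open>E\<close> belonging to the fine face
  \<open>e \<subseteq> E\<close>.\<close>

record 'a gmsfem =
  Dom :: "'a set"
  perm :: "'a \<Rightarrow> real"
  src :: "'a \<Rightarrow> real"
  flux :: "'a \<Rightarrow> real"
  coarse_mesh :: "'a set set"
  fine_mesh :: "'a set set"
  Vloc :: "'a set \<Rightarrow> ('a \<Rightarrow> 'a) set"
  Qloc :: "'a set \<Rightarrow> ('a \<Rightarrow> real) set"
  fnormal :: "'a set \<Rightarrow> 'a"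
  snap :: "'a set \<Rightarrow> 'a set \<Rightarrow> 'a vfield"

definition coarse_faces :: "'a::euclidean_space gmsfem \<Rightarrow> 'a set set" where
  "coarse_faces M = mesh_faces (coarse_mesh M)"

definition fine_faces_in :: "'a::euclidean_space gmsfem \<Rightarrow> 'a set \<Rightarrow> 'a set set" where
  "fine_faces_in M A = {e \<in> mesh_faces (fine_mesh M). e \<subseteq> A}"

definition nbhd_blocks :: "'a::euclidean_space gmsfem \<Rightarrow> 'a set \<Rightarrow> 'a set set" where
  "nbhd_blocks M E = {K \<in> coarse_mesh M. E facet_of K}"

definition nbhd :: "'a::euclidean_space gmsfem \<Rightarrow> 'a set \<Rightarrow> 'a set" where
  "nbhd M E = \<Union>(nbhd_blocks M E)"

definition max_faces :: "'a::euclidean_space gmsfem \<Rightarrow> nat" where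
  "max_faces M = Max ((\<lambda>K. card {F. F facet_of K}) ` coarse_mesh M)"

definition cells :: "'a::euclidean_space gmsfem \<Rightarrow> 'a set \<Rightarrow> 'a set set" where
  "cells M A = {\<tau> \<in> fine_mesh M. \<tau> \<subseteq> A}"

text \<open>Integral of a piecewise function over a region \<open>A\<close> that is a union of fine cells. The integral
  over the domain \<open>D\<close> is taken over \<open>closure D\<close>, which is the union of all cells.\<close>

definition integ :: "'a::euclidean_space gmsfem \<Rightarrow> 'a set \<Rightarrow> 'a sfield \<Rightarrow> real" where
  "integ M A F = (\<Sum>\<tau>\<in>cells M A. set_lebesgue_integral lebesgue \<tau> (F \<tau>))"

definition divergence :: "('a::euclidean_space \<Rightarrow> 'a) \<Rightarrow> 'a \<Rightarrow> real" where
  "divergence u x = (\<Sum>b\<in>Basis. frechet_derivative u (at x) b \<bullet> b)"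

definition Div :: "'a::euclidean_space vfield \<Rightarrow> 'a sfield" where
  "Div v = (\<lambda>\<tau>. divergence (v \<tau>))"

definition div_free :: "'a::euclidean_space gmsfem \<Rightarrow> 'a vfield \<Rightarrow> bool" where
  "div_free M v \<longleftrightarrow> (\<forall>\<tau>\<in>fine_mesh M. \<forall>x\<in>\<tau>. Div v \<tau> x = 0)"

definition kprod :: "'a::euclidean_space gmsfem \<Rightarrow> 'a set \<Rightarrow> 'a vfield \<Rightarrow> 'a vfield \<Rightarrow> real" where
  "kprod M A v w = integ M A (\<lambda>\<tau> x. inverse (perm M x) * (v \<tau> x \<bullet> w \<tau> x))"

definition sprod :: "'a::euclidean_space gmsfem \<Rightarrow> 'a set \<Rightarrow> 'a sfield \<Rightarrow> 'a sfield \<Rightarrow> real" where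
  "sprod M A p q = integ M A (\<lambda>\<tau> x. p \<tau> x * q \<tau> x)"

definition L2_norm :: "'a::euclidean_space gmsfem \<Rightarrow> 'a set \<Rightarrow> 'a vfield \<Rightarrow> real" where
  "L2_norm M A v = sqrt (kprod M A v v)"

definition Hdiv_norm :: "'a::euclidean_space gmsfem \<Rightarrow> 'a set \<Rightarrow> 'a vfield \<Rightarrow> real" where
  "Hdiv_norm M A v = sqrt (kprod M A v v + sprod M A (Div v) (Div v))"

text \<open>Normal component on a fine face \<open>e\<close>, taken from one adjacent cell; for the fields in the
  snapshot space the normal components from both sides agree.\<close>

definition adj_cell :: "'a::euclidean_space gmsfem \<Rightarrow> 'a set \<Rightarrow> 'a set" where
  "adj_cell M e = (SOME \<tau>. \<tau> \<in> fine_mesh M \<and> e facet_of \<tau>)"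

definition ncomp :: "'a::euclidean_space gmsfem \<Rightarrow> 'a vfield \<Rightarrow> 'a \<Rightarrow> 'a sfield" where
  "ncomp M v n e x = v (adj_cell M e) x \<bullet> n"

definition bd_faces :: "'a::euclidean_space gmsfem \<Rightarrow> 'a set set" where
  "bd_faces M = fine_faces_in M (frontier (Dom M))"

definition bd_normal :: "'a::euclidean_space gmsfem \<Rightarrow> 'a set \<Rightarrow> 'a" where
  "bd_normal M e = outer_normal (adj_cell M e) e"


section \<open>Fine-grid mixed finite elements and snapshots\<close>

definition fine_mfem :: "'a::euclidean_space gmsfem \<Rightarrow> bool" where
  "fine_mfem M \<longleftrightarrow> (\<forall>\<tau>\<in>fine_mesh M.
     (\<exists>B. finite B \<and> Vloc M \<tau> = span B) \<and> (\<exists>B. finite B \<and> Qloc M \<tau> = span B) \<and>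
     (\<forall>u\<in>Vloc M \<tau>. polynomial_function u \<and> divergence u \<in> Qloc M \<tau>) \<and>
     (\<forall>q\<in>Qloc M \<tau>. polynomial_function q) \<and>
     (\<forall>c. (\<lambda>x. c) \<in> Qloc M \<tau>))"

text \<open>The fine-grid spaces on a coarse block \<open>K\<close>; the values of a field outside of \<open>K\<close> are irrelevant.
  Velocities have continuous normal components on the fine faces inside \<open>K\<close>.\<close>

definition Vfine :: "'a::euclidean_space gmsfem \<Rightarrow> 'a set \<Rightarrow> 'a vfield set" where
  "Vfine M K = {v. (\<forall>\<tau>\<in>cells M K. v \<tau> \<in> Vloc M \<tau>) \<and>
     (\<forall>\<tau>\<in>cells M K. \<forall>\<tau>'\<in>cells M K. \<forall>e. \<tau> \<noteq> \<tau>' \<and> e facet_of \<tau> \<and> e facet_of \<tau>' \<longrightarrow>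
        (\<forall>x\<in>e. v \<tau> x \<bullet> outer_normal \<tau> e = v \<tau>' x \<bullet> outer_normal \<tau> e))}"

definition Qfine :: "'a::euclidean_space gmsfem \<Rightarrow> 'a set \<Rightarrow> 'a sfield set" where
  "Qfine M K = {q. \<forall>\<tau>\<in>cells M K. q \<tau> \<in> Qloc M \<tau>}"

definition block_bd :: "'a::euclidean_space gmsfem \<Rightarrow> 'a set \<Rightarrow> ('a set \<times> 'a set) set" where
  "block_bd M K = {(\<tau>, e). \<tau> \<in> cells M K \<and> e facet_of \<tau> \<and> e \<subseteq> frontier K}"

text \<open>\<open>v\<close> solves the local problem on the block \<open>K\<close> for the coarse face \<open>E\<close> and the fine face
  \<open>e\<^sub>0 \<subseteq> E\<close>.\<close>

definition local_snapshot ::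
  "'a::euclidean_space gmsfem \<Rightarrow> 'a set \<Rightarrow> 'a set \<Rightarrow> 'a set \<Rightarrow> 'a vfield \<Rightarrow> bool" where
  "local_snapshot M E e\<^sub>0 K v \<longleftrightarrow>
     v \<in> Vfine M K \<and>
     (\<forall>(\<tau>, e) \<in> block_bd M K. \<forall>x\<in>e.
        if e \<subseteq> E then v \<tau> x \<bullet> fnormal M E = (if e = e\<^sub>0 then 1 else 0)
        else v \<tau> x \<bullet> outer_normal \<tau> e = 0) \<and>
     (\<exists>p\<in>Qfine M K. \<exists>\<alpha>::real.
        \<alpha> * measure lebesgue K
          = (\<Sum>(\<tau>, e) \<in> block_bd M K. surf_integral e (\<lambda>x. v \<tau> x \<bullet> outer_normal \<tau> e)) \<and>
        (\<forall>w\<in>Vfine M K.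
           (\<forall>(\<tau>, e) \<in> block_bd M K. \<forall>x\<in>e. w \<tau> x \<bullet> outer_normal \<tau> e = 0) \<longrightarrow>
           kprod M K v w - sprod M K (Div w) p = 0) \<and>
        (\<forall>q\<in>Qfine M K. sprod M K (Div v) q = sprod M K (\<lambda>\<tau> x. \<alpha>) q))"

definition is_snapshot ::
  "'a::euclidean_space gmsfem \<Rightarrow> 'a set \<Rightarrow> 'a set \<Rightarrow> 'a vfield \<Rightarrow> bool" where
  "is_snapshot M E e\<^sub>0 v \<longleftrightarrow>
     (\<forall>K\<in>nbhd_blocks M E. local_snapshot M E e\<^sub>0 K v) \<and>
     (\<forall>\<tau>. \<tau> \<notin> cells M (nbhd M E) \<longrightarrow> v \<tau> = (\<lambda>x. 0))"

definition mixed_gmsfem :: "'a::euclidean_space gmsfem \<Rightarrow> bool" where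
  "mixed_gmsfem M \<longleftrightarrow>
     open (Dom M) \<and> connected (Dom M) \<and> Dom M \<noteq> {} \<and>
     is_mesh (Dom M) (coarse_mesh M) \<and> is_mesh (Dom M) (fine_mesh M) \<and> refines (fine_mesh M) (coarse_mesh M) \<and>
     (\<forall>x\<in>closure (Dom M). perm M x > 0) \<and>
     set_integrable lebesgue (closure (Dom M)) (\<lambda>x. inverse (perm M x)) \<and>
     set_integrable lebesgue (closure (Dom M)) (src M) \<and>
     (\<forall>e\<in>bd_faces M. surf_integrable e (flux M)) \<and>
     fine_mfem M \<and>
     (\<forall>E\<in>coarse_faces M. unit_normal E (fnormal M E)) \<and>
     (\<forall>E\<in>coarse_faces M. \<forall>e\<in>fine_faces_in M E. is_snapshot M E e (snap M E e))"

definition Vsnap_loc :: "'a::euclidean_space gmsfem \<Rightarrow> 'a set \<Rightarrow> 'a vfield set" where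
  "Vsnap_loc M E = span (snap M E ` fine_faces_in M E)"

definition Vsnap_sum :: "'a::euclidean_space gmsfem \<Rightarrow> 'a set set \<Rightarrow> 'a vfield set" where
  "Vsnap_sum M \<E> = span (\<Union>E\<in>\<E>. Vsnap_loc M E)"

definition Vsnap :: "'a::euclidean_space gmsfem \<Rightarrow> 'a vfield set" where
  "Vsnap M = Vsnap_sum M (coarse_faces M)"


section \<open>Spectral problems\<close>

datatype spectral_problem = SP1 | SP2

definition is_min_ext :: "'a::euclidean_space gmsfem \<Rightarrow> 'a set \<Rightarrow> 'a vfield \<Rightarrow> 'a vfield \<Rightarrow> bool" where
  "is_min_ext M E v u \<longleftrightarrow>
     (let X = {z \<in> Vsnap_sum M {E' \<in> coarse_faces M. nbhd M E' \<inter> nbhd M E \<noteq> {}}.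
                 \<forall>e\<in>fine_faces_in M E. \<forall>x\<in>e.
                   ncomp M z (fnormal M E) e x = ncomp M v (fnormal M E) e x}
      in u \<in> X \<and> (\<forall>z\<in>X. L2_norm M (nbhd M E) u \<le> L2_norm M (nbhd M E) z))"

text \<open>Two minimal extensions of the same \<open>v\<close> agree on \<open>nbhd M E\<close>.\<close>

definition min_ext :: "'a::euclidean_space gmsfem \<Rightarrow> 'a set \<Rightarrow> 'a vfield \<Rightarrow> 'a vfield" where
  "min_ext M E v = (SOME u. is_min_ext M E v u)"

fun a_form :: "spectral_problem \<Rightarrow> 'a::euclidean_space gmsfem \<Rightarrow> 'a set \<Rightarrow> 'a vfield \<Rightarrow> 'a vfield \<Rightarrow> real"
where
  "a_form SP1 M E v w = (\<Sum>e\<in>fine_faces_in M E. surf_integral e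
     (\<lambda>x. inverse (perm M x) * (ncomp M v (fnormal M E) e x * ncomp M w (fnormal M E) e x)))"
| "a_form SP2 M E v w = kprod M (nbhd M E) (min_ext M E v) (min_ext M E w)"

fun s_form :: "spectral_problem \<Rightarrow> 'a::euclidean_space gmsfem \<Rightarrow> 'a set \<Rightarrow> 'a vfield \<Rightarrow> 'a vfield \<Rightarrow> real"
where
  "s_form SP1 M E v w = 1 / mesh_size (coarse_mesh M) *
     (kprod M (nbhd M E) v w + sprod M (nbhd M E) (Div v) (Div w))"
| "s_form SP2 M E v w = kprod M (nbhd M E) v w"

fun snap_norm :: "spectral_problem \<Rightarrow> 'a::euclidean_space gmsfem \<Rightarrow> 'a set \<Rightarrow> 'a vfield \<Rightarrow> real" where
  "snap_norm SP1 M E v = Hdiv_norm M (nbhd M E) v"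
| "snap_norm SP2 M E v = L2_norm M (nbhd M E) v"

definition num_snap :: "'a::euclidean_space gmsfem \<Rightarrow> 'a set \<Rightarrow> nat" where
  "num_snap M E = card (fine_faces_in M E)"

text \<open>A complete system of eigenpairs, numbered from \<open>1\<close>, eigenvalues counted with multiplicity.\<close>

definition eigensystem ::
  "spectral_problem \<Rightarrow> 'a::euclidean_space gmsfem \<Rightarrow> 'a set \<Rightarrow> (nat \<Rightarrow> real) \<Rightarrow> (nat \<Rightarrow> 'a vfield) \<Rightarrow> bool"
where
  "eigensystem sp M E lam \<phi> \<longleftrightarrow>
     (\<forall>j\<in>{1..num_snap M E}. \<phi> j \<in> Vsnap_loc M E \<and>
        (\<forall>w\<in>Vsnap_loc M E. a_form sp M E (\<phi> j) w = lam j * s_form sp M E (\<phi> j) w)) \<and>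
     inj_on \<phi> {1..num_snap M E} \<and> independent (\<phi> ` {1..num_snap M E}) \<and>
     mono_on {1..num_snap M E} lam"

definition inv_next_eigval ::
  "'a::euclidean_space gmsfem \<Rightarrow> 'a set \<Rightarrow> (nat \<Rightarrow> real) \<Rightarrow> nat \<Rightarrow> real" where
  "inv_next_eigval M E lam l = (if l = num_snap M E then 0 else inverse (lam (l + 1)))"


section \<open>Discrete solutions\<close>

definition Q_space :: "'a::euclidean_space gmsfem \<Rightarrow> 'a sfield set" where
  "Q_space M = {q. \<forall>K\<in>coarse_mesh M. \<exists>c. \<forall>\<tau>\<in>cells M K. q \<tau> = (\<lambda>x. c)}"

definition zero_flux :: "'a::euclidean_space gmsfem \<Rightarrow> 'a vfield set \<Rightarrow> 'a vfield set" where
  "zero_flux M V = {v \<in> V. \<forall>e\<in>bd_faces M. \<forall>x\<in>e. ncomp M v (bd_normal M e) e x = 0}"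

definition boundary_flux :: "'a::euclidean_space gmsfem \<Rightarrow> ('a set \<Rightarrow> real) \<Rightarrow> bool" where
  "boundary_flux M gH \<longleftrightarrow>
     (\<forall>E\<in>coarse_faces M. E \<subseteq> frontier (Dom M) \<longrightarrow>
        (\<forall>e'\<in>fine_faces_in M E.
           (\<Sum>e\<in>fine_faces_in M E. surf_integral e
              (\<lambda>x. (gH e - flux M x) * ncomp M (snap M E e') (bd_normal M e) e x)) = 0))"

definition mixed_solution ::
  "'a::euclidean_space gmsfem \<Rightarrow> ('a set \<Rightarrow> real) \<Rightarrow> 'a vfield set \<Rightarrow> 'a vfield \<Rightarrow> 'a sfield \<Rightarrow> bool"
where
  "mixed_solution M gH V v p \<longleftrightarrow>
     v \<in> V \<and> p \<in> Q_space M \<and>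
     (\<forall>e\<in>bd_faces M. \<forall>x\<in>e. ncomp M v (bd_normal M e) e x = gH e) \<and>
     (\<forall>w\<in>zero_flux M V.
        kprod M (closure (Dom M)) v w - sprod M (closure (Dom M)) (Div w) p = 0) \<and>
     (\<forall>q\<in>Q_space M.
        sprod M (closure (Dom M)) (Div v) q = sprod M (closure (Dom M)) (\<lambda>\<tau>. src M) q)"


section \<open>Residuals and the online adaptive method\<close>

definition V_region :: "'a::euclidean_space gmsfem \<Rightarrow> 'a set \<Rightarrow> 'a vfield set" where
  "V_region M A = Vsnap_sum M {E \<in> coarse_faces M. card (nbhd_blocks M E) = 2 \<and> nbhd M E \<subseteq> A}"

definition Vhat_region :: "'a::euclidean_space gmsfem \<Rightarrow> 'a set \<Rightarrow> 'a vfield set" where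
  "Vhat_region M A = {v \<in> V_region M A. div_free M v}"

definition residual ::
  "'a::euclidean_space gmsfem \<Rightarrow> 'a vfield \<Rightarrow> 'a sfield \<Rightarrow> 'a set \<Rightarrow> 'a vfield \<Rightarrow> real" where
  "residual M u p A v = kprod M A u v - sprod M A (Div v) p"

definition region_res_norm ::
  "'a::euclidean_space gmsfem \<Rightarrow> 'a vfield \<Rightarrow> 'a sfield \<Rightarrow> 'a set \<Rightarrow> real" where
  "region_res_norm M u p A =
     (if Vhat_region M A = {0} then 0
      else SUP v\<in>Vhat_region M A - {0}. residual M u p A v / L2_norm M A v)"

definition nbhd_res_norm ::
  "spectral_problem \<Rightarrow> 'a::euclidean_space gmsfem \<Rightarrow> 'a vfield \<Rightarrow> 'a sfield \<Rightarrow> 'a set \<Rightarrow> real" where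
  "nbhd_res_norm sp M u p E =
     (SUP v\<in>Vsnap_loc M E - {0}. \<bar>residual M u p (nbhd M E) v\<bar> / snap_norm sp M E v)"

definition offline_space ::
  "'a::euclidean_space gmsfem \<Rightarrow> ('a set \<Rightarrow> nat) \<Rightarrow> ('a set \<Rightarrow> nat \<Rightarrow> 'a vfield) \<Rightarrow> 'a vfield set \<Rightarrow> bool"
where
  "offline_space M l \<phi> V \<longleftrightarrow>
     (\<forall>E\<in>coarse_faces M. l E \<le> num_snap M E) \<and>
     (\<exists>\<psi>. (\<forall>E\<in>coarse_faces M. \<psi> E \<in> Vsnap_loc M E \<and> \<not> div_free M (\<psi> E)) \<and>
        V = span (\<Union>E\<in>coarse_faces M. \<phi> E ` {1..l E} \<union>
                    (if \<forall>j\<in>{1..l E}. div_free M (\<phi> E j) then {\<psi> E} else {})))"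

definition admissible_regions :: "'a::euclidean_space gmsfem \<Rightarrow> nat \<Rightarrow> (nat \<Rightarrow> 'a set) \<Rightarrow> bool" where
  "admissible_regions M J \<Omega> \<longleftrightarrow>
     (\<forall>j\<in>{1..J}. \<exists>\<E>\<subseteq>coarse_faces M. \<Omega> j = \<Union>(nbhd M ` \<E>)) \<and>
     (\<forall>j\<in>{1..J}. \<forall>k\<in>{1..J}. j \<noteq> k \<longrightarrow> interior (\<Omega> j) \<inter> interior (\<Omega> k) = {})"

definition enrichment ::
  "'a::euclidean_space gmsfem \<Rightarrow> 'a vfield \<Rightarrow> 'a sfield \<Rightarrow> nat \<Rightarrow> (nat \<Rightarrow> 'a set) \<Rightarrow>
    'a vfield set \<Rightarrow> 'a vfield set \<Rightarrow> bool" where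
  "enrichment M u p J \<Omega> V V' \<longleftrightarrow>
     (\<exists>\<phi>. (\<forall>j\<in>{1..J}. \<phi> j \<in> Vhat_region M (\<Omega> j) \<and>
               (\<forall>v\<in>Vhat_region M (\<Omega> j). residual M u p (\<Omega> j) v = kprod M (\<Omega> j) (\<phi> j) v)) \<and>
          V' = span (V \<union> \<phi> ` {1..J}))"

text \<open>A run of the method: at level \<open>m\<close> the multiscale space is \<open>V m\<close>, the discrete solution is
  \<open>(u m, p m)\<close>, and the chosen regions are \<open>\<Omega> m j\<close> for \<open>1 \<le> j \<le> J m\<close>.\<close>

definition online_run ::
  "'a::euclidean_space gmsfem \<Rightarrow> ('a set \<Rightarrow> real) \<Rightarrow> ('a set \<Rightarrow> nat) \<Rightarrow> ('a set \<Rightarrow> nat \<Rightarrow> 'a vfield) \<Rightarrow>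
    (nat \<Rightarrow> 'a vfield set) \<Rightarrow> (nat \<Rightarrow> 'a vfield) \<Rightarrow> (nat \<Rightarrow> 'a sfield) \<Rightarrow>
    (nat \<Rightarrow> nat) \<Rightarrow> (nat \<Rightarrow> nat \<Rightarrow> 'a set) \<Rightarrow> bool" where
  "online_run M gH l \<phi> V u p J \<Omega> \<longleftrightarrow>
     offline_space M l \<phi> (V 0) \<and>
     (\<forall>m. mixed_solution M gH (V m) (u m) (p m) \<and>
          admissible_regions M (J m) (\<Omega> m) \<and>
          enrichment M (u m) (p m) (J m) (\<Omega> m) (V m) (V (Suc m)))"

definition error_indicator ::
  "spectral_problem \<Rightarrow> 'a::euclidean_space gmsfem \<Rightarrow> ('a set \<Rightarrow> nat \<Rightarrow> real) \<Rightarrow> ('a set \<Rightarrow> nat) \<Rightarrow>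
    'a vfield \<Rightarrow> 'a sfield \<Rightarrow> real" where
  "error_indicator sp M lam l u p =
     (\<Sum>E\<in>coarse_faces M. (nbhd_res_norm sp M u p E)\<^sup>2 * inv_next_eigval M E (lam E) (l E))"

text \<open>The constant \<open>C\<^sub>V\<close> only matters for the first spectral problem.\<close>

fun C_err :: "spectral_problem \<Rightarrow> 'a::euclidean_space gmsfem \<Rightarrow> real \<Rightarrow> real" where
  "C_err SP1 M C\<^sub>V = C\<^sub>V * mesh_size (coarse_mesh M) / mesh_size (fine_mesh M)"
| "C_err SP2 M C\<^sub>V = real (max_faces M)"

end

theory Submission
  imports Defs
begin

text \<open>Write \<open>e\<close> and \<open>e'\<close> for the errors of two consecutive levels. The argument has two halves.

  Orthogonality. Errors are differences of discrete solutions, so they have no flux through the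
  boundary of the domain and their divergence is orthogonal to the piecewise constants. Snapshots
  have constant divergence on every coarse block (\<open>snap_Div_const\<close>), so errors are divergence
  free (\<open>mixed_solution_error\<close>). On divergence-free fields without boundary flux the pressure drops out
  of the discrete equations, and \<open>e'\<close> is the error of best approximation in the energy norm. The
  Riesz representatives \<open>\<phi>\<^sub>j\<close> of the regional residuals are such fields (\<open>V_region_zero_flux\<close>), they
  have disjoint supports, and the energy product of \<open>e\<close> and \<open>\<phi>\<^sub>j\<close> is \<open>-\<parallel>\<phi>\<^sub>j\<parallel>\<^sup>2\<close>. Comparing \<open>e'\<close> with
  \<open>e + \<Sum>\<phi>\<^sub>j\<close> gives \<open>\<parallel>e'\<parallel>\<^sup>2 \<le> \<parallel>e\<parallel>\<^sup>2 - \<Sum>\<parallel>\<phi>\<^sub>j\<parallel>\<^sup>2\<close> (\<open>enrichment_step\<close>), and \<open>\<parallel>\<phi>\<^sub>j\<parallel>\<close> is at least the dual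
  norm of the residual (\<open>region_res_norm_le\<close>). An a posteriori bound \<open>\<parallel>e\<parallel>\<^sup>2 \<le> T\<close> by the weighted sum
  \<open>T\<close> of residuals turns the absolute decrease into the asserted relative one.

  A posteriori bound. It is assumed for the first spectral problem and proved here for the second
  one (\<open>a_posteriori_SP2\<close>). Testing with \<open>e\<close> gives \<open>\<parallel>e\<parallel>\<^sup>2 = - \<Sum> R\<^sub>i(e\<^sub>i)\<close>, where \<open>e\<^sub>i\<close> is the part of \<open>e\<close> in
  the snapshot space of the \<open>i\<close>-th coarse face. On boundary faces \<open>e\<^sub>i = 0\<close>. On interior faces
  \<open>R\<^sub>i\<close> vanishes on the eigenfunctions in the multiscale space, so \<open>e\<^sub>i\<close> may be replaced by its remainder beyond the first \<open>l\<^sub>i\<close> eigenfunctions,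
  whose energy is at most \<open>1/\<lambda>\<close> (with the next eigenvalue \<open>\<lambda>\<close>) times that of the minimal extension
  of \<open>e\<^sub>i\<close> (\<open>spectral_truncation\<close>). As \<open>e\<close> itself competes in the minimal extension
  (\<open>a_form_SP2_le\<close>), this is at most the energy of \<open>e\<close> on the neighborhood. A cell belongs to no more
  neighborhoods than its block has faces (\<open>nbhd_overlap\<close>), and the Cauchy-Schwarz inequality
  concludes.

  Everything rests on the fact that the normal components on fine faces are coordinates dual to the
  snapshots (\<open>trace_snap\<close>). Since a normal component is read off from one adjacent fine cell,
  this needs that every fine cell adjacent to a fine face inside a coarse face lies in the
  neighborhood of that coarse face (\<open>adjacent_cell_in_nbhd\<close>), which is proved from the mesh axioms by
  a convexity argument.\<close>

section \<open>Positive semidefinite forms on a subspace\<close>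

text \<open>The energy form is only additive where the integrands are integrable, so bilinearity is
  required on a subspace \<open>V\<close> and not on the whole type.\<close>

locale psd_form =
  fixes V :: "'b::real_vector set" and B :: "'b \<Rightarrow> 'b \<Rightarrow> real"
  assumes V: "subspace V"
    and commute: "\<lbrakk>x \<in> V; y \<in> V\<rbrakk> \<Longrightarrow> B x y = B y x"
    and add_left: "\<lbrakk>x \<in> V; y \<in> V; z \<in> V\<rbrakk> \<Longrightarrow> B (x + y) z = B x z + B y z"
    and scale_left: "\<lbrakk>x \<in> V; z \<in> V\<rbrakk> \<Longrightarrow> B (c *\<^sub>R x) z = c * B x z"
    and nonneg: "x \<in> V \<Longrightarrow> 0 \<le> B x x"
begin

lemma mem [intro]:
  "0 \<in> V" "\<lbrakk>x \<in> V; y \<in> V\<rbrakk> \<Longrightarrow> x + y \<in> V" "\<lbrakk>x \<in> V; y \<in> V\<rbrakk> \<Longrightarrow> x - y \<in> V"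
  "x \<in> V \<Longrightarrow> c *\<^sub>R x \<in> V" "(\<And>i. i \<in> I \<Longrightarrow> f i \<in> V) \<Longrightarrow> sum f I \<in> V"
  using V by (auto intro: subspace_0 subspace_add subspace_diff subspace_scale subspace_sum)

lemma span_mem: "S \<subseteq> V \<Longrightarrow> x \<in> span S \<Longrightarrow> x \<in> V"
  using V span_minimal by blast

lemma add_right: "\<lbrakk>x \<in> V; y \<in> V; z \<in> V\<rbrakk> \<Longrightarrow> B z (x + y) = B z x + B z y"
  by (simp add: commute[of z] add_left mem)

lemma scale_right: "\<lbrakk>x \<in> V; z \<in> V\<rbrakk> \<Longrightarrow> B z (c *\<^sub>R x) = c * B z x"
  by (simp add: commute[of z] scale_left mem)

lemma zero_left: "z \<in> V \<Longrightarrow> B 0 z = 0"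
  using scale_left[of 0 z 0] by auto

lemma zero_right: "z \<in> V \<Longrightarrow> B z 0 = 0"
  using scale_right[of 0 z 0] by auto

lemma diff_left: "\<lbrakk>x \<in> V; y \<in> V; z \<in> V\<rbrakk> \<Longrightarrow> B (x - y) z = B x z - B y z"
  using add_left[of "x - y" y z] by (simp add: mem)

lemma sum_left: "(\<And>i. i \<in> I \<Longrightarrow> f i \<in> V) \<Longrightarrow> z \<in> V \<Longrightarrow> B (sum f I) z = (\<Sum>i\<in>I. B (f i) z)"
  by (induction I rule: infinite_finite_induct) (auto simp: zero_left add_left mem)

lemma sum_right: "(\<And>i. i \<in> I \<Longrightarrow> f i \<in> V) \<Longrightarrow> z \<in> V \<Longrightarrow> B z (sum f I) = (\<Sum>i\<in>I. B z (f i))"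
  by (induction I rule: infinite_finite_induct) (auto simp: zero_right add_right mem)

lemma square_add:
  assumes "x \<in> V" "y \<in> V" shows "B (x + y) (x + y) = B x x + 2 * B x y + B y y"
  using assms by (simp add: add_left add_right mem commute[of y x])

lemma null_left:
  assumes "x \<in> V" "y \<in> V" "B x x = 0" shows "B x y = 0"
proof (rule ccontr)
  assume n: "B x y \<noteq> 0"
  have "0 \<le> B (t *\<^sub>R x + y) (t *\<^sub>R x + y)" for t
    using assms by (intro nonneg) auto
  moreover have "B (t *\<^sub>R x + y) (t *\<^sub>R x + y) = 2 * t * B x y + B y y" for t
    using assms by (simp add: square_add mem scale_left scale_right)
  \<comment> \<open>this value of \<open>t\<close> makes the square equal to \<open>-1\<close>\<close>
  ultimately have "0 \<le> 2 * ((- B y y - 1) / (2 * B x y)) * B x y + B y y" by metis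
  then have "0 \<le> (- (2 * B y y) - 2) / 2 + B y y" using n by simp
  then show False by (simp add: field_simps)
qed

lemma Cauchy_Schwarz:
  assumes "x \<in> V" "y \<in> V" shows "(B x y)\<^sup>2 \<le> B x x * B y y"
proof (cases "B y y = 0")
  case True
  then show ?thesis using null_left[of y x] assms commute[of x y] by simp
next
  case False
  then have pos: "B y y > 0" using nonneg[OF assms(2)] by simp
  define t where "t = - B x y / B y y"
  have "0 \<le> B (x + t *\<^sub>R y) (x + t *\<^sub>R y)" using assms by (intro nonneg) auto
  also have "\<dots> = B x x + 2 * (t * B x y) + t * (t * B y y)"
    using assms by (simp add: square_add mem scale_left scale_right)
  also have "\<dots> = B x x - (B x y)\<^sup>2 / B y y"
    using False by (simp add: t_def power2_eq_square field_simps)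
  finally show ?thesis using pos by (simp add: field_simps)
qed

lemma abs_le_sqrt:
  assumes "x \<in> V" "y \<in> V" shows "\<bar>B x y\<bar> \<le> sqrt (B x x) * sqrt (B y y)"
  using real_sqrt_le_mono[OF Cauchy_Schwarz[OF assms]] by (simp add: real_sqrt_mult)

text \<open>Orthogonal projection onto a finite-dimensional space. The form may be degenerate, so the
  projection exists but need not be unique.\<close>

lemma projection:
  assumes "finite S" "S \<subseteq> V" "x \<in> V"
  shows "\<exists>w\<in>span S. \<forall>z\<in>span S. B (x - w) z = 0"
  using assms
proof (induction S arbitrary: x rule: finite_induct)
  case empty
  then show ?case by (auto simp: zero_right)
next
  case (insert b S)
  then have SV: "S \<subseteq> V" and bV: "b \<in> V" by auto
  obtain pb where pb: "pb \<in> span S" "\<And>z. z \<in> span S \<Longrightarrow> B (b - pb) z = 0"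
    using insert.IH[of b] SV bV by auto
  obtain px where px: "px \<in> span S" "\<And>z. z \<in> span S \<Longrightarrow> B (x - px) z = 0"
    using insert.IH[of x] SV insert.prems by auto
  \<comment> \<open>the part of the new generator orthogonal to the old ones\<close>
  define b' where "b' = b - pb"
  have V': "px \<in> V" "pb \<in> V" "b' \<in> V" using px pb SV bV span_mem by (auto simp: b'_def)
  have split: "\<exists>k s. z = k *\<^sub>R b' + s \<and> s \<in> span S" if z: "z \<in> span (insert b S)" for z
  proof -
    obtain k where "z - k *\<^sub>R b \<in> span S" using z by (auto simp: span_insert)
    then have "(z - k *\<^sub>R b) + k *\<^sub>R pb \<in> span S" using pb by (intro span_add span_scale)
    then show ?thesis
      by (intro exI[of _ k] exI[of _ "(z - k *\<^sub>R b) + k *\<^sub>R pb"]) (simp add: b'_def algebra_simps)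
  qed
  have b'in: "b' \<in> span (insert b S)"
    unfolding b'_def using pb span_mono[of S "insert b S"] by (intro span_diff) (auto intro: span_base)
  define t where "t = B (x - px) b' / B b' b'"
  define w where "w = px + t *\<^sub>R b'"
  have wV: "w \<in> V" using V' by (auto simp: w_def)
  have 1: "B (x - w) b' = 0"
  proof (cases "B b' b' = 0")
    case True
    then show ?thesis using null_left[of b' "x - w"] commute[of b' "x - w"] V' wV insert.prems by auto
  next
    case False
    have xw: "x - w = (x - px) - t *\<^sub>R b'" by (simp add: w_def)
    have "B (x - w) b' = B (x - px) b' - t * B b' b'"
      unfolding xw using V' insert.prems by (simp add: diff_left[of "x - px"] mem scale_left)
    then show ?thesis using False by (simp add: t_def)
  qed
  have 2: "B (x - w) s = 0" if s: "s \<in> span S" for s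
  proof -
    have sV: "s \<in> V" using s SV span_mem by blast
    have xw: "x - w = (x - px) - t *\<^sub>R b'" by (simp add: w_def)
    have "B (x - w) s = B (x - px) s - t * B b' s"
      unfolding xw using V' sV insert.prems by (simp add: diff_left[of "x - px"] mem scale_left)
    then show ?thesis using px(2)[OF s] pb(2)[OF s] by (simp add: b'_def)
  qed
  have "B (x - w) z = 0" if z: "z \<in> span (insert b S)" for z
  proof -
    obtain k s where ks: "z = k *\<^sub>R b' + s" "s \<in> span S" using split[OF z] by blast
    have "s \<in> V" using ks SV span_mem by blast
    then show ?thesis using 1 2[OF ks(2)] V' wV insert.prems
      by (simp add: ks(1) add_right mem scale_right)
  qed
  moreover have "w \<in> span (insert b S)"
    unfolding w_def using px(1) b'in span_mono[of S "insert b S"]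
    by (intro span_add span_scale) auto
  ultimately show ?case by blast
qed

text \<open>On a finite-dimensional space where the form is definite, all linear functionals are bounded;
  this makes the suprema in the dual norms of residuals meaningful.\<close>

lemma bounded_functional:
  assumes "finite S" "S \<subseteq> V"
    and def: "\<And>x. x \<in> span S \<Longrightarrow> B x x = 0 \<Longrightarrow> x = 0"
    and f_add: "\<And>x y. \<lbrakk>x \<in> V; y \<in> V\<rbrakk> \<Longrightarrow> f (x + y) = f x + f y"
    and f_scale: "\<And>c x. x \<in> V \<Longrightarrow> f (c *\<^sub>R x) = c * (f x :: real)"
  shows "\<exists>C. \<forall>x\<in>span S. \<bar>f x\<bar> \<le> C * sqrt (B x x)"
  using assms(1-3)
proof (induction S rule: finite_induct)
  case empty
  have "f 0 = 0" using f_scale[of 0 0] by auto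
  then show ?case by (auto intro: exI[of _ 0])
next
  case (insert b S)
  then have SV: "S \<subseteq> V" and bV: "b \<in> V" by auto
  have sub: "span S \<subseteq> span (insert b S)" by (rule span_mono) auto
  obtain C where C: "\<And>x. x \<in> span S \<Longrightarrow> \<bar>f x\<bar> \<le> C * sqrt (B x x)"
    using insert.IH SV insert.prems sub by blast
  obtain pb where pb: "pb \<in> span S" "\<And>z. z \<in> span S \<Longrightarrow> B (b - pb) z = 0"
    using projection[OF insert.hyps(1) SV bV] by auto
  define b' where "b' = b - pb"
  have V': "pb \<in> V" "b' \<in> V" using pb SV bV span_mem by (auto simp: b'_def)
  have b'in: "b' \<in> span (insert b S)"
    unfolding b'_def using pb sub by (intro span_diff) (auto intro: span_base)
  have nb: "b' = 0 \<or> B b' b' > 0" using insert.prems(2)[OF b'in] nonneg[OF V'(2)] by linarith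
  have f0: "f 0 = 0" using f_scale[of 0 0] by auto
  have "\<bar>f x\<bar> \<le> (\<bar>f b'\<bar> / sqrt (B b' b') + \<bar>C\<bar>) * sqrt (B x x)" if x: "x \<in> span (insert b S)" for x
  proof -
    obtain k where "x - k *\<^sub>R b \<in> span S" using x by (auto simp: span_insert)
    then have s: "(x - k *\<^sub>R b) + k *\<^sub>R pb \<in> span S" using pb by (intro span_add span_scale)
    define z where "z = (x - k *\<^sub>R b) + k *\<^sub>R pb"
    have zS: "z \<in> span S" and zV: "z \<in> V" using s SV span_mem by (auto simp: z_def)
    have xe: "x = k *\<^sub>R b' + z" by (simp add: z_def b'_def algebra_simps)
    have orth: "B b' z = 0" using pb(2)[OF zS] by (simp add: b'_def)
    have Bx: "B x x = k\<^sup>2 * B b' b' + B z z"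
      unfolding xe using V' zV orth
      by (simp add: square_add mem scale_left scale_right power2_eq_square)
    have le1: "\<bar>k\<bar> * sqrt (B b' b') \<le> sqrt (B x x)"
      unfolding Bx using nonneg[OF zV] nonneg[OF V'(2)]
      by (intro real_le_rsqrt) (simp add: power_mult_distrib)
    have le2: "sqrt (B z z) \<le> sqrt (B x x)"
      unfolding Bx using nonneg[OF zV] nonneg[OF V'(2)] by simp
    have "\<bar>f x\<bar> \<le> \<bar>k\<bar> * \<bar>f b'\<bar> + \<bar>f z\<bar>"
      unfolding xe using V' zV by (simp add: f_add mem f_scale) (metis abs_mult abs_triangle_ineq)
    also have "\<bar>k\<bar> * \<bar>f b'\<bar> \<le> \<bar>f b'\<bar> / sqrt (B b' b') * sqrt (B x x)"
    proof (cases "b' = 0")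
      case True
      then show ?thesis by (simp add: f0)
    next
      case False
      then have p: "sqrt (B b' b') > 0" using nb by simp
      have "\<bar>k\<bar> * \<bar>f b'\<bar> = \<bar>f b'\<bar> / sqrt (B b' b') * (\<bar>k\<bar> * sqrt (B b' b'))" using p by simp
      also have "\<dots> \<le> \<bar>f b'\<bar> / sqrt (B b' b') * sqrt (B x x)"
        using le1 p by (intro mult_left_mono) auto
      finally show ?thesis .
    qed
    also have "\<bar>f z\<bar> \<le> \<bar>C\<bar> * sqrt (B x x)"
    proof -
      have "C * sqrt (B z z) \<le> \<bar>C\<bar> * sqrt (B x x)"
        using le2 nonneg[OF zV] by (intro mult_mono) auto
      then show ?thesis using C[OF zS] by linarith
    qed
    finally show ?thesis by (simp add: algebra_simps)
  qed
  then show ?case by blast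
qed

end

lemma psd_form_subset:
  assumes "psd_form V B" "subspace W" "W \<subseteq> V" shows "psd_form W B"
proof -
  interpret psd_form V B by fact
  show ?thesis using assms
    by unfold_locales (auto simp: subset_iff commute add_left scale_left nonneg)
qed


section \<open>Spectral gap of a generalized eigenvalue problem\<close>

lemma span_image_sum:
  assumes "finite I" "x \<in> span (f ` I)"
  shows "\<exists>d. x = (\<Sum>i\<in>I. d i *\<^sub>R f i)"
  using assms(2)
proof (induction rule: span_induct_alt)
  case base
  then show ?case by (intro exI[of _ "\<lambda>_. 0"]) simp
next
  case (step c y z)
  then obtain i d where "i \<in> I" "y = f i" "z = (\<Sum>i\<in>I. d i *\<^sub>R f i)" by auto
  then show ?case
    by (intro exI[of _ "\<lambda>j. (if j = i then c else 0) + d j"])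
      (simp add: scaleR_add_left sum.distrib if_distrib[of "\<lambda>t. t *\<^sub>R _"] assms(1) sum.delta cong: if_cong)
qed

lemma independent_card_span:
  fixes S :: "'b::real_vector set"
  assumes "independent S" "S \<subseteq> span T" "finite T" "card T \<le> card S"
  shows "span S = span T"
proof -
  have "x \<in> span S" if x: "x \<in> span T" for x
  proof (rule ccontr)
    assume nx: "x \<notin> span S"
    then have "independent (insert x S)" by (intro independent_insertI assms(1))
    moreover have "insert x S \<subseteq> span T" using x assms(2) by auto
    ultimately have "finite (insert x S) \<and> card (insert x S) \<le> card T"
      by (rule independent_span_bound[OF assms(3)])
    moreover have "x \<notin> S" using nx span_base by blast
    ultimately show False using assms(4) by auto
  qed
  then show ?thesis using span_minimal[OF assms(2)] by auto
qed

text \<open>Eigenvectors of one multiple eigenvalue need not be orthogonal. Orthogonalizing the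
  eigenvectors one after the other keeps the eigenvalues, because an eigenvector is already
  orthogonal to those of other eigenvalues.\<close>

lemma orthogonal_eigenvectors:
  fixes \<phi> :: "nat \<Rightarrow> 'b::real_vector"
  assumes s: "psd_form W s" and a: "psd_form W a"
    and \<phi>W: "\<And>j. j \<in> {1..n} \<Longrightarrow> \<phi> j \<in> W"
    and eig: "\<And>j w. j \<in> {1..n} \<Longrightarrow> w \<in> W \<Longrightarrow> a (\<phi> j) w = lam j * s (\<phi> j) w"
    and def: "\<And>x. x \<in> W \<Longrightarrow> s x x = 0 \<Longrightarrow> x = 0"
  shows "\<exists>\<psi>. (\<forall>k\<le>n. span (\<psi> ` {1..k}) = span (\<phi> ` {1..k})) \<and>
    (\<forall>i\<in>{1..n}. \<forall>j\<in>{1..n}. i \<noteq> j \<longrightarrow> s (\<psi> i) (\<psi> j) = 0) \<and>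
    (\<forall>j\<in>{1..n}. \<psi> j \<in> W \<and> (\<forall>w\<in>W. a (\<psi> j) w = lam j * s (\<psi> j) w))"
proof -
  interpret s: psd_form W s by fact
  interpret a: psd_form W a by fact
  have "\<forall>j\<in>{1..n}. \<exists>w\<in>span (\<phi> ` {1..<j}). \<forall>z\<in>span (\<phi> ` {1..<j}). s (\<phi> j - w) z = 0"
  proof
    fix j assume j: "j \<in> {1..n}"
    show "\<exists>w\<in>span (\<phi> ` {1..<j}). \<forall>z\<in>span (\<phi> ` {1..<j}). s (\<phi> j - w) z = 0"
      by (rule s.projection) (use j \<phi>W in auto)
  qed
  then obtain w where w: "\<And>j. j \<in> {1..n} \<Longrightarrow> w j \<in> span (\<phi> ` {1..<j})"
    and w0: "\<And>j z. j \<in> {1..n} \<Longrightarrow> z \<in> span (\<phi> ` {1..<j}) \<Longrightarrow> s (\<phi> j - w j) z = 0"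
    by metis
  define \<psi> where "\<psi> j = \<phi> j - w j" for j
  have spW: "span (\<phi> ` {1..<j}) \<subseteq> W" if "j \<in> {1..n}" for j
    by (rule span_minimal) (use that \<phi>W s.V in auto)
  have wW: "w j \<in> W" if "j \<in> {1..n}" for j
    using w[OF that] spW[OF that] by (rule subsetD[rotated])
  have \<psi>W: "\<psi> j \<in> W" if "j \<in> {1..n}" for j
    unfolding \<psi>_def using \<phi>W[OF that] wW[OF that] by (rule s.mem)
  have sp: "span (\<psi> ` {1..k}) = span (\<phi> ` {1..k})" if "k \<le> n" for k
    using that
  proof (induction k)
    case (Suc k)
    then have IH: "span (\<psi> ` {1..k}) = span (\<phi> ` {1..k})" by simp
    have ins: "{1..Suc k} = insert (Suc k) {1..k}" "{1..<Suc k} = {1..k}" by auto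
    have wk: "w (Suc k) \<in> span (\<phi> ` {1..k})" using w[of "Suc k"] Suc.prems ins by auto
    have "\<phi> (Suc k) = \<psi> (Suc k) + w (Suc k)" by (simp add: \<psi>_def)
    moreover have "w (Suc k) \<in> span (\<psi> ` {1..Suc k})"
      using wk IH span_mono[OF image_mono, of "{1..k}" "{1..Suc k}" \<psi>] by auto
    ultimately have "\<phi> (Suc k) \<in> span (\<psi> ` {1..Suc k})"
      by (metis span_add span_base imageI ins(1) insertI1)
    moreover have "\<phi> ` {1..k} \<subseteq> span (\<psi> ` {1..Suc k})"
      using IH span_superset[of "\<phi> ` {1..k}"] span_mono[OF image_mono, of "{1..k}" "{1..Suc k}" \<psi>] by auto
    ultimately have A: "span (\<phi> ` {1..Suc k}) \<subseteq> span (\<psi> ` {1..Suc k})"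
      by (intro span_minimal) (simp_all only: ins(1) image_insert insert_subset subspace_span)
    have "w (Suc k) \<in> span (\<phi> ` {1..Suc k})"
      using wk span_mono[OF image_mono, of "{1..k}" "{1..Suc k}" \<phi>] by auto
    moreover have "\<phi> (Suc k) \<in> span (\<phi> ` {1..Suc k})" by (intro span_base) auto
    ultimately have "\<psi> (Suc k) \<in> span (\<phi> ` {1..Suc k})"
      unfolding \<psi>_def by (intro span_diff)
    moreover have "\<psi> ` {1..k} \<subseteq> span (\<phi> ` {1..Suc k})"
      using IH span_superset[of "\<psi> ` {1..k}"] span_mono[OF image_mono, of "{1..k}" "{1..Suc k}" \<phi>] by auto
    ultimately have "span (\<psi> ` {1..Suc k}) \<subseteq> span (\<phi> ` {1..Suc k})"
      by (intro span_minimal) (simp_all only: ins(1) image_insert insert_subset subspace_span)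
    with A show ?case by blast
  qed simp
  have lt: "{1..<j} = {1..j-1}" for j :: nat by auto
  have orth: "s (\<psi> j) (\<psi> i) = 0" if "i \<in> {1..n}" "j \<in> {1..n}" "i < j" for i j
  proof -
    have "\<psi> i \<in> span (\<psi> ` {1..j-1})" using that by (intro span_base) auto
    then have "\<psi> i \<in> span (\<phi> ` {1..<j})" using sp[of "j-1"] that lt by auto
    then show ?thesis using w0[of j] that by (simp add: \<psi>_def)
  qed
  then have orth': "s (\<psi> i) (\<psi> j) = 0" if "i \<in> {1..n}" "j \<in> {1..n}" "i \<noteq> j" for i j
    using that s.commute[of "\<psi> i" "\<psi> j"] \<psi>W by (cases "i < j") auto
  have eig': "\<forall>z\<in>W. a (\<psi> j) z = lam j * s (\<psi> j) z" if "j \<in> {1..n}" for j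
    using that
  proof (induction j rule: less_induct)
    case (less j)
    have "w j \<in> span (\<psi> ` {1..<j})" using w[OF less.prems] sp[of "j-1"] less.prems lt by auto
    then obtain c where c: "w j = (\<Sum>k\<in>{1..<j}. c k *\<^sub>R \<psi> k)"
      using span_image_sum[of "{1..<j}"] by blast
    have kin: "k \<in> {1..n}" "k < j" if "k \<in> {1..<j}" for k using that less.prems by auto
    have ck: "lam k = lam j \<or> c k *\<^sub>R \<psi> k = 0" if k: "k \<in> {1..<j}" for k
    proof (cases "lam k = lam j")
      case False
      note kn = kin[OF k]
      have "\<psi> k \<in> span (\<psi> ` {1..<j})" using k by (intro span_base) auto
      then have "\<psi> k \<in> span (\<phi> ` {1..<j})" using sp[of "j-1"] less.prems lt by auto
      then have "s (\<phi> j - w j) (\<psi> k) = 0" using w0[OF less.prems] by simp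
      then have "s (\<phi> j) (\<psi> k) = s (w j) (\<psi> k)"
        using s.diff_left[OF \<phi>W[OF less.prems] wW[OF less.prems] \<psi>W[OF kn(1)]] by simp
      also have "\<dots> = (\<Sum>i\<in>{1..<j}. c i * s (\<psi> i) (\<psi> k))"
        unfolding c using kin \<psi>W kn by (subst s.sum_left) (auto simp: s.scale_left)
      also have "\<dots> = (\<Sum>i\<in>{1..<j}. if i = k then c k * s (\<psi> k) (\<psi> k) else 0)"
        using orth' kin kn by (intro sum.cong) auto
      also have "\<dots> = c k * s (\<psi> k) (\<psi> k)" using k by simp
      finally have 1: "s (\<phi> j) (\<psi> k) = c k * s (\<psi> k) (\<psi> k)" .
      have "lam j * s (\<phi> j) (\<psi> k) = a (\<phi> j) (\<psi> k)" by (rule eig[OF less.prems \<psi>W[OF kn(1)], symmetric])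
      also have "\<dots> = a (\<psi> k) (\<phi> j)" by (rule a.commute[OF \<phi>W[OF less.prems] \<psi>W[OF kn(1)]])
      also have "\<dots> = lam k * s (\<psi> k) (\<phi> j)" using less.IH[OF kn(2,1)] \<phi>W[OF less.prems] by blast
      also have "\<dots> = lam k * s (\<phi> j) (\<psi> k)" using s.commute[OF \<phi>W[OF less.prems] \<psi>W[OF kn(1)]] by simp
      finally have "s (\<phi> j) (\<psi> k) = 0" using False by auto
      then have "c k = 0 \<or> s (\<psi> k) (\<psi> k) = 0" using 1 by simp
      then show ?thesis using def[OF \<psi>W[OF kn(1)]] by auto
    qed simp
    show ?case
    proof
      fix z assume z: "z \<in> W"
      have "a (w j) z = (\<Sum>k\<in>{1..<j}. a (c k *\<^sub>R \<psi> k) z)"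
        unfolding c using kin \<psi>W z by (subst a.sum_left) auto
      also have "\<dots> = (\<Sum>k\<in>{1..<j}. lam j * s (c k *\<^sub>R \<psi> k) z)"
      proof (intro sum.cong refl)
        fix k assume k: "k \<in> {1..<j}"
        show "a (c k *\<^sub>R \<psi> k) z = lam j * s (c k *\<^sub>R \<psi> k) z"
          using ck[OF k]
        proof
          assume "lam k = lam j"
          then show ?thesis using less.IH[of k] kin[OF k] \<psi>W z
            by (simp add: a.scale_left s.scale_left)
        next
          assume "c k *\<^sub>R \<psi> k = 0"
          then show ?thesis by (simp add: a.zero_left s.zero_left z del: scaleR_eq_0_iff)
        qed
      qed
      also have "\<dots> = lam j * s (w j) z"
        unfolding c using kin \<psi>W z by (subst s.sum_left) (auto simp: sum_distrib_left)
      finally show "a (\<psi> j) z = lam j * s (\<psi> j) z"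
        unfolding \<psi>_def using eig[OF less.prems z]
        by (simp add: a.diff_left[OF \<phi>W[OF less.prems] wW[OF less.prems] z]
            s.diff_left[OF \<phi>W[OF less.prems] wW[OF less.prems] z] algebra_simps)
    qed
  qed
  show ?thesis
  proof (intro exI[of _ \<psi>] conjI ballI allI impI)
    show "span (\<psi> ` {1..k}) = span (\<phi> ` {1..k})" if "k \<le> n" for k by (rule sp[OF that])
    show "s (\<psi> i) (\<psi> j) = 0" if "i \<in> {1..n}" "j \<in> {1..n}" "i \<noteq> j" for i j by (rule orth'[OF that])
    show "\<psi> j \<in> W" if "j \<in> {1..n}" for j by (rule \<psi>W[OF that])
    show "a (\<psi> j) w = lam j * s (\<psi> j) w" if "j \<in> {1..n}" "w \<in> W" for j w
      using eig'[OF that(1)] that(2) by (rule bspec)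
  qed
qed

text \<open>Truncating the expansion in eigenvectors after the first \<open>l\<close> of them leaves an error
  controlled by the reciprocal of the next eigenvalue.\<close>

lemma spectral_truncation:
  fixes \<phi> :: "nat \<Rightarrow> 'b::real_vector"
  assumes s: "psd_form W s" and a: "psd_form W a"
    and \<phi>W: "span (\<phi> ` {1..n}) = W"
    and ind: "\<And>j. j \<in> {1..n} \<Longrightarrow> \<phi> j \<noteq> 0"
    and eig: "\<And>j w. j \<in> {1..n} \<Longrightarrow> w \<in> W \<Longrightarrow> a (\<phi> j) w = lam j * s (\<phi> j) w"
    and mono: "mono_on {1..n} lam"
    and s_def: "\<And>x. x \<in> W \<Longrightarrow> s x x = 0 \<Longrightarrow> x = 0"
    and a_def: "\<And>x. x \<in> W \<Longrightarrow> a x x = 0 \<Longrightarrow> x = 0"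
    and x: "x \<in> W" and l: "l \<le> n"
  shows "\<exists>w\<in>span (\<phi> ` {1..l}).
           s (x - w) (x - w) \<le> (if l = n then 0 else inverse (lam (l + 1))) * a x x
           \<and> 0 \<le> (if l = n then 0 else inverse (lam (l + 1)))"
proof -
  interpret s: psd_form W s by fact
  interpret a: psd_form W a by fact
  have \<phi>in: "\<phi> j \<in> W" if "j \<in> {1..n}" for j
    using that \<phi>W span_superset[of "\<phi> ` {1..n}"] by auto
  have lam_pos: "0 < lam j" if j: "j \<in> {1..n}" for j
  proof -
    have "a (\<phi> j) (\<phi> j) \<noteq> 0" "s (\<phi> j) (\<phi> j) \<noteq> 0" using a_def s_def \<phi>in ind j by blast+
    then have "a (\<phi> j) (\<phi> j) > 0" "s (\<phi> j) (\<phi> j) > 0"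
      using a.nonneg[OF \<phi>in[OF j]] s.nonneg[OF \<phi>in[OF j]] by auto
    then show ?thesis using eig[OF j \<phi>in[OF j]] by (simp add: zero_less_mult_iff)
  qed
  have "\<exists>\<psi>. (\<forall>k\<le>n. span (\<psi> ` {1..k}) = span (\<phi> ` {1..k})) \<and>
    (\<forall>i\<in>{1..n}. \<forall>j\<in>{1..n}. i \<noteq> j \<longrightarrow> s (\<psi> i) (\<psi> j) = 0) \<and>
    (\<forall>j\<in>{1..n}. \<psi> j \<in> W \<and> (\<forall>w\<in>W. a (\<psi> j) w = lam j * s (\<psi> j) w))"
    by (rule orthogonal_eigenvectors[OF s a \<phi>in eig s_def])
  then obtain \<psi> where \<psi>: "\<And>k. k \<le> n \<Longrightarrow> span (\<psi> ` {1..k}) = span (\<phi> ` {1..k})"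
    and orth: "\<And>i j. i \<in> {1..n} \<Longrightarrow> j \<in> {1..n} \<Longrightarrow> i \<noteq> j \<Longrightarrow> s (\<psi> i) (\<psi> j) = 0"
    and eig': "\<And>j w. j \<in> {1..n} \<Longrightarrow> w \<in> W \<Longrightarrow> a (\<psi> j) w = lam j * s (\<psi> j) w"
    and \<psi>W: "\<And>j. j \<in> {1..n} \<Longrightarrow> \<psi> j \<in> W"
    by metis
  obtain d where d: "x = (\<Sum>j\<in>{1..n}. d j *\<^sub>R \<psi> j)"
    using span_image_sum[of "{1..n}" x \<psi>] x \<phi>W \<psi>[of n] by auto
  have pars: "s (\<Sum>j\<in>I. d j *\<^sub>R \<psi> j) (\<Sum>j\<in>I. d j *\<^sub>R \<psi> j) = (\<Sum>j\<in>I. (d j)\<^sup>2 * s (\<psi> j) (\<psi> j))"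
    and s_col: "j \<in> I \<Longrightarrow> s (\<psi> j) (\<Sum>j\<in>I. d j *\<^sub>R \<psi> j) = d j * s (\<psi> j) (\<psi> j)"
    if I: "I \<subseteq> {1..n}" for I j
  proof -
    have finI: "finite I" using I finite_subset by blast
    have col: "s (\<psi> j) (\<Sum>j\<in>I. d j *\<^sub>R \<psi> j) = d j * s (\<psi> j) (\<psi> j)" if j: "j \<in> I" for j
    proof -
      have "s (\<psi> j) (\<Sum>j\<in>I. d j *\<^sub>R \<psi> j) = (\<Sum>i\<in>I. d i * s (\<psi> j) (\<psi> i))"
        using I j \<psi>W by (subst s.sum_right) (auto simp: s.scale_right subset_iff)
      also have "\<dots> = (\<Sum>i\<in>I. if i = j then d j * s (\<psi> j) (\<psi> j) else 0)"
        using orth I j by (intro sum.cong) (auto simp: subset_iff)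
      finally show ?thesis using j finI by simp
    qed
    then show "j \<in> I \<Longrightarrow> s (\<psi> j) (\<Sum>j\<in>I. d j *\<^sub>R \<psi> j) = d j * s (\<psi> j) (\<psi> j)" by simp
    have "s (\<Sum>j\<in>I. d j *\<^sub>R \<psi> j) (\<Sum>j\<in>I. d j *\<^sub>R \<psi> j) = (\<Sum>i\<in>I. d i * s (\<psi> i) (\<Sum>j\<in>I. d j *\<^sub>R \<psi> j))"
      using I \<psi>W by (subst s.sum_left) (auto simp: s.scale_left subset_iff s.mem intro!: sum.cong)
    also have "\<dots> = (\<Sum>j\<in>I. (d j)\<^sup>2 * s (\<psi> j) (\<psi> j))"
      using col by (intro sum.cong) (auto simp: power2_eq_square)
    finally show "s (\<Sum>j\<in>I. d j *\<^sub>R \<psi> j) (\<Sum>j\<in>I. d j *\<^sub>R \<psi> j) = (\<Sum>j\<in>I. (d j)\<^sup>2 * s (\<psi> j) (\<psi> j))" .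
  qed
  have "a x x = (\<Sum>j\<in>{1..n}. d j * a (\<psi> j) x)"
    using x \<psi>W unfolding d by (subst a.sum_left) (auto simp: a.scale_left intro!: a.mem)
  also have "\<dots> = (\<Sum>j\<in>{1..n}. d j * (lam j * s (\<psi> j) x))" using eig' x by simp
  also have "\<dots> = (\<Sum>j\<in>{1..n}. lam j * ((d j)\<^sup>2 * s (\<psi> j) (\<psi> j)))"
    using s_col[of "{1..n}"] unfolding d by (intro sum.cong) (auto simp: power2_eq_square)
  finally have ax: "a x x = (\<Sum>j\<in>{1..n}. lam j * ((d j)\<^sup>2 * s (\<psi> j) (\<psi> j)))" .
  define w where "w = (\<Sum>j\<in>{1..l}. d j *\<^sub>R \<psi> j)"
  have w: "w \<in> span (\<phi> ` {1..l})"
    unfolding w_def \<psi>[OF l, symmetric] by (intro span_sum span_scale span_base) auto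
  have "{1..n} = {1..l} \<union> {l+1..n}" using l by auto
  then have "x = w + (\<Sum>j\<in>{l+1..n}. d j *\<^sub>R \<psi> j)"
    unfolding d w_def by (subst sum.union_disjoint[symmetric]) auto
  then have xw: "x - w = (\<Sum>j\<in>{l+1..n}. d j *\<^sub>R \<psi> j)" by simp
  have sxw: "s (x - w) (x - w) = (\<Sum>j\<in>{l+1..n}. (d j)\<^sup>2 * s (\<psi> j) (\<psi> j))"
    unfolding xw by (rule pars) auto
  show ?thesis
  proof (cases "l = n")
    case True
    then show ?thesis using w sxw by (intro bexI[of _ w]) auto
  next
    case False
    then have l1: "l + 1 \<in> {1..n}" using l by auto
    have nn: "0 \<le> (d j)\<^sup>2 * s (\<psi> j) (\<psi> j)" if "j \<in> {1..n}" for j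
      using s.nonneg \<psi>W that by simp
    have "lam (l + 1) * s (x - w) (x - w) = (\<Sum>j\<in>{l+1..n}. lam (l + 1) * ((d j)\<^sup>2 * s (\<psi> j) (\<psi> j)))"
      by (simp add: sxw sum_distrib_left)
    also have "\<dots> \<le> (\<Sum>j\<in>{l+1..n}. lam j * ((d j)\<^sup>2 * s (\<psi> j) (\<psi> j)))"
      using nn l1 mono_onD[OF mono l1] by (intro sum_mono mult_right_mono) auto
    also have "\<dots> \<le> a x x"
      unfolding ax
    proof (intro sum_mono2)
      show "0 \<le> lam j * ((d j)\<^sup>2 * s (\<psi> j) (\<psi> j))" if "j \<in> {1..n} - {l+1..n}" for j
        using that less_imp_le[OF lam_pos[of j]] nn[of j] by (meson DiffD1 mult_nonneg_nonneg)
    qed auto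
    finally show ?thesis using w False lam_pos[OF l1]
      by (intro bexI[of _ w]) (auto simp: field_simps)
  qed
qed

section \<open>Convex bodies meeting along a facet\<close>

lemma affine_hull_eq_hyperplane:
  fixes e :: "'a::euclidean_space set"
  assumes "n \<noteq> 0" "aff_dim e = int DIM('a) - 1" "e \<subseteq> {x. n \<bullet> x = b}"
  shows "affine hull e = {x. n \<bullet> x = b}"
proof -
  have "affine hull e = affine hull {x. n \<bullet> x = b}"
    using assms aff_dim_eq_full_gen[of e "{x. n \<bullet> x = b}"] aff_dim_hyperplane[of n b] by simp
  also have "\<dots> = {x. n \<bullet> x = b}" by (rule hull_same) (rule affine_hyperplane)
  finally show ?thesis .
qed

text \<open>Near a relative interior point of a flat piece of its boundary, a convex body contains a
  half ball.\<close>

lemma convex_contains_half_ball: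
  fixes K :: "'a::euclidean_space set"
  assumes K: "convex K" "e \<subseteq> K" and dim: "aff_dim e = int DIM('a) - 1"
    and n: "n \<noteq> 0" "e \<subseteq> {x. n \<bullet> x = b}" and x: "x \<in> rel_interior e"
    and y: "y \<in> K" "n \<bullet> y < b"
  shows "\<exists>\<epsilon>>0. \<forall>z\<in>ball x \<epsilon>. n \<bullet> z \<le> b \<longrightarrow> z \<in> K"
proof -
  obtain r where r: "r > 0" "ball x r \<inter> {x. n \<bullet> x = b} \<subseteq> e"
    using x affine_hull_eq_hyperplane[OF n(1) dim n(2)] mem_rel_interior_ball[of x e] by auto
  have xb: "n \<bullet> x = b" using x n(2) rel_interior_subset by blast
  \<comment> \<open>\<open>g z\<close> is where the line from \<open>y\<close> through \<open>z\<close> meets the hyperplane, so \<open>z\<close> is between \<open>y\<close> and \<open>g z\<close>\<close>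
  define t where "t z = (b - n \<bullet> z) / (b - n \<bullet> y)" for z
  define g where "g z = (1 / (1 - t z)) *\<^sub>R (z - t z *\<^sub>R y)" for z
  have tx: "t x = 0" by (simp add: t_def xb)
  have ct: "isCont t x" unfolding t_def using y by (intro continuous_intros) auto
  have cg: "isCont g x" unfolding g_def using ct tx by (intro continuous_intros) auto
  have "g x = x" by (simp add: g_def tx)
  then have "\<forall>\<^sub>F z in at x. dist (g z) x < r"
    using tendstoD[OF cg[unfolded isCont_def] r(1)] by simp
  moreover have "\<forall>\<^sub>F z in at x. t z < 1"
    using order_tendstoD(2)[OF ct[unfolded isCont_def], of 1] tx by simp
  ultimately have "\<forall>\<^sub>F z in at x. dist (g z) x < r \<and> t z < 1" by (rule eventually_conj)
  then obtain \<epsilon> where \<epsilon>: "\<epsilon> > 0" "\<And>z. z \<noteq> x \<Longrightarrow> dist z x < \<epsilon> \<Longrightarrow> dist (g z) x < r \<and> t z < 1"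
    unfolding eventually_at by auto
  have "z \<in> K" if z: "z \<in> ball x \<epsilon>" "n \<bullet> z \<le> b" for z
  proof (cases "z = x")
    case True
    then show ?thesis using x K rel_interior_subset by blast
  next
    case False
    then have gz: "dist (g z) x < r" and tz: "t z < 1" using \<epsilon>(2)[of z] z by (auto simp: dist_commute)
    have t0: "0 \<le> t z" using z y by (simp add: t_def)
    have "b - n \<bullet> z = t z * (b - n \<bullet> y)" using y by (simp add: t_def)
    then have "n \<bullet> (z - t z *\<^sub>R y) = (1 - t z) * b" by (simp add: inner_diff_right algebra_simps)
    then have "n \<bullet> g z = b" using tz by (simp add: g_def)
    then have "g z \<in> e" using r gz by (auto simp: dist_commute)
    then have "(1 - t z) *\<^sub>R g z + t z *\<^sub>R y \<in> K"
      using K y t0 tz by (intro convexD) auto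
    moreover have "(1 - t z) *\<^sub>R g z + t z *\<^sub>R y = z" using tz by (simp add: g_def)
    ultimately show ?thesis by simp
  qed
  then show ?thesis using \<epsilon>(1) by blast
qed

text \<open>Two bodies with disjoint interiors sharing a piece of a hyperplane lie on opposite sides of
  it, hence together they cover a neighborhood of each relative interior point of that piece.\<close>

lemma convex_bodies_cover_neighborhood:
  fixes K K' :: "'a::euclidean_space set"
  assumes K: "convex K" "interior K \<noteq> {}" "e \<subseteq> K" and K': "convex K'" "interior K' \<noteq> {}" "e \<subseteq> K'"
    and disj: "interior K \<inter> interior K' = {}"
    and dim: "aff_dim e = int DIM('a) - 1" and n: "n \<noteq> 0" "e \<subseteq> {x. n \<bullet> x = b}"
    and x: "x \<in> rel_interior e"
  shows "x \<in> interior (K \<union> K')"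
proof -
  have off: "\<exists>y\<in>L. n \<bullet> y \<noteq> b" if "interior L \<noteq> {}" for L
  proof (rule ccontr)
    assume "\<not> ?thesis"
    then have "interior L \<subseteq> interior {x. n \<bullet> x = b}" by (intro interior_mono) auto
    then show False using that n(1) by (simp add: interior_hyperplane)
  qed
  have xb: "n \<bullet> x = b" using x n(2) rel_interior_subset by blast
  have same: False
    if c: "c \<noteq> 0" "c = n \<or> c = - n" and y: "y \<in> K" "c \<bullet> y < c \<bullet> x"
      and y': "y' \<in> K'" "c \<bullet> y' < c \<bullet> x" for c y y'
  proof -
    have ce: "e \<subseteq> {z. c \<bullet> z = c \<bullet> x}" using n(2) c xb by auto
    obtain r where r: "r > 0" "\<And>z. z \<in> ball x r \<Longrightarrow> c \<bullet> z \<le> c \<bullet> x \<Longrightarrow> z \<in> K"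
      using convex_contains_half_ball[OF K(1,3) dim c(1) ce x y] by blast
    obtain r' where r': "r' > 0" "\<And>z. z \<in> ball x r' \<Longrightarrow> c \<bullet> z \<le> c \<bullet> x \<Longrightarrow> z \<in> K'"
      using convex_contains_half_ball[OF K'(1,3) dim c(1) ce x y'] by blast
    define U where "U = ball x (min r r') \<inter> {z. c \<bullet> z < c \<bullet> x}"
    have "open U" by (simp add: U_def open_Int open_halfspace_lt)
    moreover have "U \<subseteq> K" "U \<subseteq> K'" using r r' by (auto simp: U_def)
    ultimately have "U \<subseteq> interior K \<inter> interior K'" by (simp add: interior_maximal)
    moreover have "U \<noteq> {}"
    proof -
      define k where "k = min r r' / (2 * norm c)"
      have k: "k > 0" using r r' c by (simp add: k_def)
      have "dist x (x - k *\<^sub>R c) = min r r' / 2" using r(1) r'(1) c by (simp add: dist_norm k_def)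
      then have "x - k *\<^sub>R c \<in> U"
        using r(1) r'(1) k c by (auto simp: U_def inner_diff_right)
      then show ?thesis by blast
    qed
    ultimately show False using disj by blast
  qed
  have nn: "n \<noteq> 0" "- n \<noteq> 0" using n by auto
  obtain y y' where y: "y \<in> K" "n \<bullet> y \<noteq> b" and y': "y' \<in> K'" "n \<bullet> y' \<noteq> b"
    using off K(2) K'(2) by metis
  have opp: "(n \<bullet> y < b) \<noteq> (n \<bullet> y' < b)"
    using same[of n y y'] same[of "- n" y y'] nn y y' xb
    by (cases "n \<bullet> y < b"; cases "n \<bullet> y' < b") auto
  have cover: "x \<in> interior (L \<union> L')"
    if L: "convex L" "e \<subseteq> L" "z \<in> L" "n \<bullet> z < b" and L': "convex L'" "e \<subseteq> L'" "z' \<in> L'" "b < n \<bullet> z'"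
    for L L' z z'
  proof -
    have ne: "e \<subseteq> {x. (- n) \<bullet> x = - b}" using n(2) by auto
    obtain r where r: "r > 0" "\<And>z. z \<in> ball x r \<Longrightarrow> n \<bullet> z \<le> b \<Longrightarrow> z \<in> L"
      using convex_contains_half_ball[OF L(1,2) dim n x L(3,4)] by blast
    obtain r' where r': "r' > 0" "\<And>z. z \<in> ball x r' \<Longrightarrow> (- n) \<bullet> z \<le> - b \<Longrightarrow> z \<in> L'"
      using convex_contains_half_ball[OF L'(1,2) dim nn(2) ne x L'(3)] L'(4) by auto
    have "ball x (min r r') \<subseteq> L \<union> L'"
    proof
      fix w assume "w \<in> ball x (min r r')"
      then show "w \<in> L \<union> L'" using r(2)[of w] r'(2)[of w] by (cases "n \<bullet> w \<le> b") auto
    qed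
    then show ?thesis using r(1) r'(1) by (auto simp: mem_interior intro!: exI[of _ "min r r'"])
  qed
  show ?thesis
  proof (cases "n \<bullet> y < b")
    case True
    then show ?thesis using cover[OF K(1,3) y(1) _ K'(1,3) y'(1)] opp y' by auto
  next
    case False
    then show ?thesis using cover[OF K'(1,3) y'(1) _ K(1,3) y(1)] opp y by (auto simp: Un_commute)
  qed
qed

lemma facet_of_body:
  fixes K :: "'a::euclidean_space set"
  assumes "polytope K" "interior K \<noteq> {}" "e facet_of K"
  shows "aff_dim e = int DIM('a) - 1" "convex e" "e \<subseteq> K" "e \<noteq> {}" "rel_interior e \<noteq> {}" "e face_of K"
    and "\<exists>n. norm n = 1 \<and> (\<forall>x\<in>e. \<forall>y\<in>K. n \<bullet> y \<le> n \<bullet> x)"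
    and "e \<inter> interior K = {}"
proof -
  show f: "e face_of K" and ne: "e \<noteq> {}" and dim: "aff_dim e = int DIM('a) - 1"
    using assms aff_dim_nonempty_interior[OF assms(2)] by (auto simp: facet_of_def)
  show conv: "convex e" using face_of_imp_convex[OF f] .
  show "e \<subseteq> K" using face_of_imp_subset[OF f] .
  show "rel_interior e \<noteq> {}" using conv ne rel_interior_eq_empty by blast
  have "e \<noteq> K" using dim aff_dim_nonempty_interior[OF assms(2)] by auto
  then show "e \<inter> interior K = {}"
    using face_of_disjoint_interior[OF f] by simp
  obtain a b where ab: "a \<noteq> 0" "K \<subseteq> {x. a \<bullet> x \<le> b}" "e = K \<inter> {x. a \<bullet> x = b}"
    using facet_of_polyhedron[OF polytope_imp_polyhedron[OF assms(1)] assms(3)] by blast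
  show "\<exists>n. norm n = 1 \<and> (\<forall>x\<in>e. \<forall>y\<in>K. n \<bullet> y \<le> n \<bullet> x)"
    using ab by (intro exI[of _ "(1 / norm a) *\<^sub>R a"]) (auto intro!: divide_right_mono)
qed

lemma outer_normal_unit_normal:
  assumes "polytope K" "interior K \<noteq> {}" "e facet_of K"
  shows "unit_normal e (outer_normal K e)"
proof -
  have *: "norm (outer_normal K e) = 1 \<and> (\<forall>x\<in>e. \<forall>y\<in>K. outer_normal K e \<bullet> y \<le> outer_normal K e \<bullet> x)"
    unfolding outer_normal_def by (rule someI_ex) (rule facet_of_body(7)[OF assms])
  then show ?thesis
    using facet_of_body(3)[OF assms] unfolding unit_normal_def by (meson order_antisym subsetD)
qed

lemma unit_normal_unique:
  fixes e :: "'a::euclidean_space set"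
  assumes dim: "aff_dim e = int DIM('a) - 1" and n: "unit_normal e n" and n': "unit_normal e n'"
  shows "n' = n \<or> n' = - n"
proof -
  have "e \<noteq> {}" using dim DIM_positive[where 'a='a] by force
  then obtain x where x: "x \<in> e" by blast
  have N: "n \<bullet> n = 1" "n' \<bullet> n' = 1" "n \<noteq> 0" "n' \<noteq> 0" using n n' by (auto simp: unit_normal_def dot_square_norm)
  have "e \<subseteq> {z. n \<bullet> z = n \<bullet> x}" "e \<subseteq> {z. n' \<bullet> z = n' \<bullet> x}"
    using n n' x unfolding unit_normal_def by blast+
  then have "affine hull e = {z. n \<bullet> z = n \<bullet> x}" "affine hull e = {z. n' \<bullet> z = n' \<bullet> x}"
    using affine_hull_eq_hyperplane[OF _ dim] N by blast+
  then have iff: "n \<bullet> z = n \<bullet> x \<longleftrightarrow> n' \<bullet> z = n' \<bullet> x" for z by auto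
  define c where "c = n' \<bullet> n"
  define v where "v = n' - c *\<^sub>R n"
  have nv: "n \<bullet> v = 0" by (simp add: v_def c_def inner_diff_right N inner_commute)
  then have n'v: "n' \<bullet> v = 0" using iff[of "x + v"] by (simp add: inner_add_right)
  have "v \<bullet> v = 0" using nv n'v by (simp add: v_def inner_diff_left)
  then have eq: "n' = c *\<^sub>R n" by (simp add: v_def)
  have "norm n = 1" "norm n' = 1" using n n' unfolding unit_normal_def by blast+
  then have "\<bar>c\<bar> = 1" using arg_cong[OF eq, of norm] by simp
  then have "c = 1 \<or> c = - 1" by linarith
  then show ?thesis using eq by auto
qed

lemma unit_normal_subset: "unit_normal E n \<Longrightarrow> e \<subseteq> E \<Longrightarrow> unit_normal e n"
  unfolding unit_normal_def by blast

lemma facets_eq_of_common_piece: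
  fixes K :: "'a::euclidean_space set"
  assumes "polytope K" "interior K \<noteq> {}" "E facet_of K" "E' facet_of K"
    and e: "e \<subseteq> E" "e \<subseteq> E'" "aff_dim e = int DIM('a) - 1" "rel_interior e \<noteq> {}"
  shows "E = E'"
proof -
  have "rel_interior e \<subseteq> rel_interior F" if "F facet_of K" "e \<subseteq> F" for F
    using that facet_of_body(1)[OF assms(1,2) that(1)] e(3) aff_dim_eq_full_gen[OF that(2)]
    by (intro subset_rel_interior) auto
  then show ?thesis
    using face_of_eq[OF facet_of_body(6)[OF assms(1,2,3)] facet_of_body(6)[OF assms(1,2,4)]] assms by blast
qed

section \<open>Meshes\<close>

lemma is_meshD:
  assumes "is_mesh D T"
  shows "finite T" "\<Union>T = closure D" "interior (\<Union>T) = D"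
    and "K \<in> T \<Longrightarrow> polytope K" "K \<in> T \<Longrightarrow> interior K \<noteq> {}"
    and "\<lbrakk>K \<in> T; K' \<in> T; K \<noteq> K'\<rbrakk> \<Longrightarrow> interior K \<inter> interior K' = {}"
    and "F \<in> mesh_faces T \<Longrightarrow> F \<subseteq> frontier D \<and> card {K\<in>T. F facet_of K} = 1 \<or>
           rel_interior F \<subseteq> D \<and> card {K\<in>T. F facet_of K} = 2"
proof -
  have 1: "finite T" "\<Union>T = closure D" "interior (\<Union>T) = D"
    and 2: "\<forall>K\<in>T. polytope K \<and> interior K \<noteq> {}"
    and 3: "\<forall>K\<in>T. \<forall>K'\<in>T. K \<noteq> K' \<longrightarrow> interior K \<inter> interior K' = {}"
    and 4: "\<forall>F\<in>mesh_faces T. F \<subseteq> frontier D \<and> card {K\<in>T. F facet_of K} = 1 \<or>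
           rel_interior F \<subseteq> D \<and> card {K\<in>T. F facet_of K} = 2"
    by (insert assms, unfold is_mesh_def, elim conjE, assumption)+
  show "finite T" "\<Union>T = closure D" "interior (\<Union>T) = D" by (fact 1)+
  show "polytope K" "interior K \<noteq> {}" if "K \<in> T" using bspec[OF 2 that] by blast+
  show "interior K \<inter> interior K' = {}" if "K \<in> T" "K' \<in> T" "K \<noteq> K'"
    using bspec[OF bspec[OF 3 that(1)] that(2)] that(3) by (rule mp)
  show "F \<subseteq> frontier D \<and> card {K\<in>T. F facet_of K} = 1 \<or>
           rel_interior F \<subseteq> D \<and> card {K\<in>T. F facet_of K} = 2" if "F \<in> mesh_faces T"
    using 4 that by (rule bspec)
qed

lemma mesh_cell:
  assumes "is_mesh D T" "K \<in> T"
  shows "polytope K" "interior K \<noteq> {}" "convex K" "closed K" "compact K" "K \<subseteq> closure (interior K)"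
    "K \<subseteq> closure D" "interior K \<subseteq> D"
proof -
  show p: "polytope K" and i: "interior K \<noteq> {}" using is_meshD(4,5)[OF assms] by auto
  show c: "convex K" "closed K" "compact K"
    using p polytope_imp_convex polytope_imp_closed polytope_imp_compact by auto
  show "K \<subseteq> closure (interior K)" using convex_closure_interior[OF c(1) i] closure_subset by auto
  show "K \<subseteq> closure D" using is_meshD(2)[OF assms(1)] assms(2) by blast
  have "interior K \<subseteq> interior (\<Union>T)" using assms(2) by (intro interior_mono) auto
  then show "interior K \<subseteq> D" by (simp only: is_meshD(3)[OF assms(1)])
qed

lemma mesh_disjoint:
  assumes "is_mesh D T" "K \<in> T" "K' \<in> T" "K \<noteq> K'"
  shows "K \<inter> interior K' = {}"
proof -
  have "interior K \<inter> interior K' = {}" by (rule is_meshD(6)[OF assms])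
  then have "closure (interior K) \<inter> interior K' = {}"
    by (simp add: open_Int_closure_eq_empty Int_commute)
  then show ?thesis using mesh_cell(6)[OF assms(1,2)] by blast
qed

text \<open>If a set with nonempty interior lies in a cell and is covered by a family of cells, then the cell
  belongs to the family.\<close>

lemma mesh_cell_in_subfamily:
  assumes "is_mesh D T" "K \<in> T" "S \<subseteq> T" "A \<subseteq> K" "interior A \<noteq> {}" "A \<subseteq> \<Union>S"
  shows "K \<in> S"
proof (rule ccontr)
  assume K: "K \<notin> S"
  obtain x where x: "x \<in> interior A" using assms(5) by blast
  then obtain L where L: "L \<in> S" "x \<in> L" using assms(6) interior_subset by blast
  have "x \<in> interior K" using x interior_mono[OF assms(4)] by blast
  then show False using mesh_disjoint[OF assms(1) _ assms(2), of L] L K assms(3) by blast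
qed

lemma finite_mesh_faces:
  assumes "is_mesh D T" shows "finite (mesh_faces T)"
proof -
  have "mesh_faces T = (\<Union>K\<in>T. {F. F facet_of K})" by (auto simp: mesh_faces_def)
  moreover have "finite T" by (rule is_meshD(1)[OF assms])
  ultimately show ?thesis using finite_polytope_facets mesh_cell(1)[OF assms] by auto
qed


section \<open>Incidences between fine faces and coarse blocks\<close>

text \<open>The standing assumptions on meshes, coefficients, finite elements and snapshots.\<close>

locale gmsfem =
  fixes M :: "'a::euclidean_space gmsfem"
  assumes mixed: "mixed_gmsfem M"
begin

lemma meshes: "is_mesh (Dom M) (coarse_mesh M)" "is_mesh (Dom M) (fine_mesh M)"
  and open_Dom: "open (Dom M)"
  by (insert mixed, unfold mixed_gmsfem_def, elim conjE, assumption)+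

lemmas coarse_cell = mesh_cell[OF meshes(1)]
lemmas fine_cell = mesh_cell[OF meshes(2)]

lemma finite_fine_mesh: "finite (fine_mesh M)" and finite_coarse_mesh: "finite (coarse_mesh M)"
  using is_meshD(1) meshes by blast+

lemma finite_cells [simp]: "finite (cells M A)"
  by (simp add: cells_def finite_fine_mesh)

lemma finite_coarse_faces [simp]: "finite (coarse_faces M)"
  by (simp add: coarse_faces_def finite_mesh_faces[OF meshes(1)])

lemma finite_fine_faces_in [simp]: "finite (fine_faces_in M A)"
  by (simp add: fine_faces_in_def finite_mesh_faces[OF meshes(2)])

lemma cells_Dom: "cells M (closure (Dom M)) = fine_mesh M"
  using fine_cell(7) by (auto simp: cells_def)

lemma block_ex:
  assumes "\<tau> \<in> fine_mesh M" obtains K where "K \<in> coarse_mesh M" "\<tau> \<subseteq> K"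
proof -
  have "refines (fine_mesh M) (coarse_mesh M)" using mixed by (simp only: mixed_gmsfem_def)
  then show ?thesis using assms that unfolding refines_def by blast
qed

lemma block_unique:
  assumes "\<tau> \<in> fine_mesh M" "K \<in> coarse_mesh M" "\<tau> \<subseteq> K" "K' \<in> coarse_mesh M" "\<tau> \<subseteq> K'"
  shows "K = K'"
  using mesh_cell_in_subfamily[OF meshes(1) assms(2), of "{K'}" \<tau>] assms fine_cell(2)[OF assms(1)]
  by auto

lemma nbhd_blocksD: "K \<in> nbhd_blocks M E \<Longrightarrow> K \<in> coarse_mesh M \<and> E facet_of K"
  by (simp add: nbhd_blocks_def)

lemma cells_nbhd: "\<tau> \<in> cells M (nbhd M E) \<longleftrightarrow> (\<exists>K\<in>nbhd_blocks M E. \<tau> \<in> cells M K)"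
proof
  assume t: "\<tau> \<in> cells M (nbhd M E)"
  then have tf: "\<tau> \<in> fine_mesh M" by (simp add: cells_def)
  obtain K where K: "K \<in> coarse_mesh M" "\<tau> \<subseteq> K" using block_ex[OF tf] by blast
  have "K \<in> nbhd_blocks M E"
    using mesh_cell_in_subfamily[OF meshes(1) K(1) _ K(2) fine_cell(2)[OF tf], of "nbhd_blocks M E"] t
    by (auto simp: nbhd_blocks_def cells_def nbhd_def)
  then show "\<exists>K\<in>nbhd_blocks M E. \<tau> \<in> cells M K" using K tf by (auto simp: cells_def)
qed (auto simp: cells_def nbhd_def)

lemma nbhd_blocks_nonempty: "E \<in> coarse_faces M \<Longrightarrow> nbhd_blocks M E \<noteq> {}"
  by (auto simp: coarse_faces_def mesh_faces_def nbhd_blocks_def)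

lemma coarse_face_cases:
  assumes "E \<in> coarse_faces M"
  shows "E \<subseteq> frontier (Dom M) \<and> card (nbhd_blocks M E) = 1 \<or>
         rel_interior E \<subseteq> Dom M \<and> card (nbhd_blocks M E) = 2"
  using is_meshD(7)[OF meshes(1)] assms by (simp only: coarse_faces_def nbhd_blocks_def)

lemma frontier_Dom: "x \<in> frontier (Dom M) \<Longrightarrow> x \<notin> Dom M"
  using open_Dom by (simp add: frontier_def interior_open)

lemma coarse_facet:
  assumes "E \<in> coarse_faces M"
  shows "aff_dim E = int DIM('a) - 1" "rel_interior E \<noteq> {}"
proof -
  obtain K where "K \<in> coarse_mesh M" "E facet_of K"
    using assms by (auto simp: coarse_faces_def mesh_faces_def)
  then show "aff_dim E = int DIM('a) - 1" "rel_interior E \<noteq> {}"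
    using facet_of_body(1,5)[OF coarse_cell(1,2)] by blast+
qed

lemma fine_facet:
  assumes "e \<in> fine_faces_in M A"
  shows "aff_dim e = int DIM('a) - 1" "rel_interior e \<noteq> {}" "e \<noteq> {}" "e \<subseteq> A"
    "adj_cell M e \<in> fine_mesh M" "e facet_of adj_cell M e"
proof -
  have ex: "\<exists>\<tau>. \<tau> \<in> fine_mesh M \<and> e facet_of \<tau>" and eA: "e \<subseteq> A"
    using assms by (auto simp: fine_faces_in_def mesh_faces_def)
  have adj: "adj_cell M e \<in> fine_mesh M \<and> e facet_of adj_cell M e"
    unfolding adj_cell_def using ex by (rule someI_ex)
  then show "adj_cell M e \<in> fine_mesh M" "e facet_of adj_cell M e" "e \<subseteq> A" using eA by auto
  show "aff_dim e = int DIM('a) - 1" "rel_interior e \<noteq> {}" "e \<noteq> {}"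
    using facet_of_body(1,5,4)[OF fine_cell(1,2)] adj by blast+
qed

lemma rel_interior_fine_face:
  assumes "E \<in> coarse_faces M" "e \<in> fine_faces_in M E"
  shows "rel_interior e \<subseteq> rel_interior E"
  using aff_dim_eq_full_gen[OF fine_facet(4)[OF assms(2)]] fine_facet(1,4)[OF assms(2)]
    coarse_facet(1)[OF assms(1)]
  by (intro subset_rel_interior) auto

lemma fnormal_unit: "E \<in> coarse_faces M \<Longrightarrow> unit_normal E (fnormal M E)"
  using mixed by (simp add: mixed_gmsfem_def)

lemma coarse_blocks_cover:
  assumes "K \<in> coarse_mesh M" "K' \<in> coarse_mesh M" "K \<noteq> K'" "E \<in> coarse_faces M"
    and "e \<subseteq> E" "e \<subseteq> K" "e \<subseteq> K'" "aff_dim e = int DIM('a) - 1" "x \<in> rel_interior e"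
  shows "x \<in> interior (K \<union> K')"
proof -
  have n: "norm (fnormal M E) = 1" "\<forall>x\<in>e. \<forall>y\<in>e. fnormal M E \<bullet> x = fnormal M E \<bullet> y"
    using fnormal_unit[OF assms(4)] assms(5) unfolding unit_normal_def by blast+
  have xe: "x \<in> e" using assms(9) rel_interior_subset by blast
  show ?thesis
  proof (rule convex_bodies_cover_neighborhood)
    show "fnormal M E \<noteq> 0" using n by auto
    show "e \<subseteq> {z. fnormal M E \<bullet> z = fnormal M E \<bullet> x}" using n xe by blast
    show "interior K \<inter> interior K' = {}" 
      using mesh_disjoint[OF meshes(1) assms(1,2,3)] interior_subset by blast
  qed (use assms coarse_cell in auto)
qed

text \<open>If the coarse block of an adjacent fine cell did not have the coarse face as a facet, it would
  overlap the blocks that do: the two blocks of an interior face cover a neighborhood of a point of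
  the face, and the block of a boundary face would cover one together with the stray block, putting
  a boundary point into the interior of the domain.\<close>

lemma adjacent_cell_in_nbhd:
  assumes E: "E \<in> coarse_faces M" and e: "e \<in> fine_faces_in M E"
    and \<tau>: "\<tau> \<in> fine_mesh M" "e facet_of \<tau>"
  shows "\<exists>K\<in>nbhd_blocks M E. \<tau> \<in> cells M K"
proof -
  obtain K' where K': "K' \<in> coarse_mesh M" "\<tau> \<subseteq> K'" using block_ex[OF \<tau>(1)] by blast
  obtain x where x: "x \<in> rel_interior e" using fine_facet(2)[OF e] by blast
  have xE: "x \<in> rel_interior E" "x \<in> E" "x \<in> e"
    using x rel_interior_fine_face[OF E e] rel_interior_subset by blast+
  have e\<tau>: "e \<subseteq> \<tau>" using facet_of_body(3)[OF fine_cell(1,2)] \<tau> by blast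
  have eK: "e \<subseteq> K" if "K \<in> nbhd_blocks M E" for K
    using that nbhd_blocksD fine_facet(4)[OF e] facet_of_imp_subset by blast
  have "K' \<in> nbhd_blocks M E"
  proof (rule ccontr)
    assume out: "K' \<notin> nbhd_blocks M E"
    from coarse_face_cases[OF E] show False
    proof (elim disjE conjE)
      assume fr: "E \<subseteq> frontier (Dom M)"
      obtain K where K: "K \<in> nbhd_blocks M E" using nbhd_blocks_nonempty[OF E] by blast
      have "K \<in> coarse_mesh M" "e \<subseteq> K" "K \<noteq> K'" "e \<subseteq> K'"
        using eK[OF K] nbhd_blocksD[OF K] K out e\<tau> K'(2) by blast+
      then have "x \<in> interior (K \<union> K')"
        using K'(1) E fine_facet(1,4)[OF e] x by (intro coarse_blocks_cover)
      also have "\<dots> \<subseteq> interior (\<Union>(coarse_mesh M))"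
        using K K' nbhd_blocksD by (intro interior_mono) blast
      finally show False using is_meshD(3)[OF meshes(1)] frontier_Dom fr xE by blast
    next
      assume "card (nbhd_blocks M E) = 2"
      then obtain K1 K2 where K12: "nbhd_blocks M E = {K1, K2}" "K1 \<noteq> K2" by (auto simp: card_2_iff)
      have "K1 \<in> coarse_mesh M" "K2 \<in> coarse_mesh M" "e \<subseteq> K1" "e \<subseteq> K2"
        using eK[of K1] eK[of K2] nbhd_blocksD[of K1 E] nbhd_blocksD[of K2 E] K12(1) by blast+
      then have "x \<in> interior (K1 \<union> K2)"
        using K12(2) E fine_facet(1,4)[OF e] x by (intro coarse_blocks_cover)
      moreover have "x \<in> closure (interior K')"
        using xE e\<tau> K' coarse_cell(6) by blast
      ultimately have "interior K' \<inter> interior (K1 \<union> K2) \<noteq> {}"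
        by (metis Int_commute disjoint_iff open_Int_closure_eq_empty open_interior)
      then obtain z where "z \<in> interior K'" "z \<in> K1 \<union> K2" using interior_subset by blast
      then show False
        using mesh_disjoint[OF meshes(1) _ K'(1)] K12 out nbhd_blocksD by blast
    qed
  qed
  then show ?thesis using K' \<tau> by (auto simp: cells_def)
qed

lemma face_disjoint_interior:
  assumes "K \<in> coarse_mesh M" "E facet_of K" "e \<subseteq> E"
  shows "e \<subseteq> frontier K"
  using facet_of_body(3,8)[OF coarse_cell(1,2)[OF assms(1)] assms(2)] assms(3) coarse_cell(4)[OF assms(1)]
  by (auto simp: frontier_def)

lemma snap_is_snapshot: "E \<in> coarse_faces M \<Longrightarrow> e \<in> fine_faces_in M E \<Longrightarrow> is_snapshot M E e (snap M E e)"
  using mixed by (simp add: mixed_gmsfem_def)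

lemma snap_outside:
  assumes "E \<in> coarse_faces M" "e \<in> fine_faces_in M E" "\<tau> \<notin> cells M (nbhd M E)"
  shows "snap M E e \<tau> = 0"
  using snap_is_snapshot[OF assms(1,2)] assms(3) by (simp add: is_snapshot_def zero_fun_def)

lemma snapshot_trace:
  assumes "local_snapshot M E e\<^sub>0 K v" "(\<tau>, e) \<in> block_bd M K" "x \<in> e"
  shows "if e \<subseteq> E then v \<tau> x \<bullet> fnormal M E = (if e = e\<^sub>0 then 1 else 0)
         else v \<tau> x \<bullet> outer_normal \<tau> e = 0"
proof -
  have "\<forall>(\<tau>, e) \<in> block_bd M K. \<forall>x\<in>e.
        if e \<subseteq> E then v \<tau> x \<bullet> fnormal M E = (if e = e\<^sub>0 then 1 else 0)
        else v \<tau> x \<bullet> outer_normal \<tau> e = 0"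
    by (insert assms(1), unfold local_snapshot_def, elim conjE, assumption)
  from bspec[OF this assms(2), unfolded prod.case] assms(3) show ?thesis by (rule bspec)
qed

text \<open>The fixed normal of a coarse face and the outer normals of the cells along it agree up to sign.\<close>

lemma normal_component_sign:
  assumes "E \<in> coarse_faces M" "e \<in> fine_faces_in M E" "\<tau> \<in> fine_mesh M" "e facet_of \<tau>"
  shows "fnormal M E = outer_normal \<tau> e \<or> fnormal M E = - outer_normal \<tau> e"
  by (rule unit_normal_unique[OF fine_facet(1)[OF assms(2)]])
    (rule outer_normal_unit_normal[OF fine_cell(1,2)[OF assms(3)] assms(4)],
      rule unit_normal_subset[OF fnormal_unit[OF assms(1)] fine_facet(4)[OF assms(2)]])

text \<open>The normal components on the fine faces are dual to the snapshots. On a fine face inside another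
  coarse face a snapshot either vanishes, as its support is elsewhere, or satisfies the boundary
  condition of zero normal component.\<close>

lemma trace_snap:
  assumes E: "E \<in> coarse_faces M" and e: "e \<in> fine_faces_in M E"
    and E': "E' \<in> coarse_faces M" and e': "e' \<in> fine_faces_in M E'" and x: "x \<in> e"
  shows "ncomp M (snap M E' e') (fnormal M E) e x = (if E' = E \<and> e' = e then 1 else 0)"
proof -
  define \<tau> where "\<tau> = adj_cell M e"
  have \<tau>: "\<tau> \<in> fine_mesh M" "e facet_of \<tau>" using fine_facet[OF e] by (auto simp: \<tau>_def)
  obtain K where K: "K \<in> nbhd_blocks M E" "\<tau> \<in> cells M K" using adjacent_cell_in_nbhd[OF E e \<tau>] by blast
  have KE: "K \<in> coarse_mesh M" "E facet_of K" using K nbhd_blocksD by auto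
  have bd: "(\<tau>, e) \<in> block_bd M K"
    using K \<tau> face_disjoint_interior[OF KE fine_facet(4)[OF e]] by (simp add: block_bd_def)
  show ?thesis
  proof (cases "K \<in> nbhd_blocks M E'")
    case True
    then have loc: "local_snapshot M E' e' K (snap M E' e')"
      using snap_is_snapshot[OF E' e'] by (simp add: is_snapshot_def)
    then have tr: "if e \<subseteq> E' then snap M E' e' \<tau> x \<bullet> fnormal M E' = (if e = e' then 1 else 0)
        else snap M E' e' \<tau> x \<bullet> outer_normal \<tau> e = 0"
      using snapshot_trace[OF _ bd x] by blast
    show ?thesis
    proof (cases "e \<subseteq> E'")
      case True
      have "E' = E"
        using facets_eq_of_common_piece[OF coarse_cell(1,2)[OF KE(1)] _ KE(2) True fine_facet(4,1,2)[OF e]]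
          \<open>K \<in> nbhd_blocks M E'\<close> nbhd_blocksD by blast
      then show ?thesis using tr True by (auto simp: ncomp_def \<tau>_def)
    next
      case False
      then have "E' \<noteq> E" using fine_facet(4)[OF e] by blast
      then show ?thesis
        using tr False normal_component_sign[OF E e \<tau>] by (auto simp: ncomp_def \<tau>_def)
    qed
  next
    case False
    then have "E' \<noteq> E" using K by blast
    moreover have "\<tau> \<notin> cells M (nbhd M E')"
    proof
      assume "\<tau> \<in> cells M (nbhd M E')"
      then obtain L where L: "L \<in> nbhd_blocks M E'" "\<tau> \<in> cells M L" using cells_nbhd by blast
      then have "L = K" using block_unique[OF \<tau>(1), of L K] K(2) KE(1) nbhd_blocksD by (auto simp: cells_def)
      then show False using L False by simp
    qed
    ultimately show ?thesis using snap_outside[OF E' e'] by (simp add: ncomp_def \<tau>_def)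
  qed
qed

lemma fine_face_boundary:
  assumes "E \<in> coarse_faces M" "E \<subseteq> frontier (Dom M)" "e \<in> fine_faces_in M E"
  shows "e \<in> bd_faces M"
  using assms by (auto simp: bd_faces_def fine_faces_in_def)

text \<open>Snapshots of interior faces do not contribute to the flux through the boundary of the domain.\<close>

lemma snap_interior_zero_flux:
  assumes E: "E \<in> coarse_faces M" "card (nbhd_blocks M E) = 2" and e': "e' \<in> fine_faces_in M E"
    and e: "e \<in> bd_faces M" and x: "x \<in> e"
  shows "ncomp M (snap M E e') (bd_normal M e) e x = 0"
proof -
  have ef: "e \<in> fine_faces_in M (frontier (Dom M))" using e by (simp add: bd_faces_def)
  define \<tau> where "\<tau> = adj_cell M e"
  have \<tau>: "\<tau> \<in> fine_mesh M" "e facet_of \<tau>" using fine_facet[OF ef] by (auto simp: \<tau>_def)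
  show ?thesis
  proof (cases "\<tau> \<in> cells M (nbhd M E)")
    case False
    then show ?thesis using snap_outside[OF E(1) e'] by (simp add: ncomp_def \<tau>_def)
  next
    case True
    then obtain K where K: "K \<in> nbhd_blocks M E" "\<tau> \<in> cells M K" using cells_nbhd by blast
    have "e \<subseteq> \<tau>" "\<tau> \<subseteq> K"
      using facet_of_imp_subset[OF \<tau>(2)] K by (auto simp: cells_def)
    moreover have "e \<inter> interior K = {}"
      using fine_facet(4)[OF ef] frontier_Dom coarse_cell(8) K nbhd_blocksD by blast
    ultimately have "e \<subseteq> frontier K"
      using coarse_cell(4) K nbhd_blocksD by (auto simp: frontier_def)
    then have bd: "(\<tau>, e) \<in> block_bd M K" using K \<tau> by (simp add: block_bd_def)
    have "\<not> e \<subseteq> E"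
    proof
      assume "e \<subseteq> E"
      then have "e \<in> fine_faces_in M E" using ef by (auto simp: fine_faces_in_def)
      then have "rel_interior e \<subseteq> rel_interior E" by (rule rel_interior_fine_face[OF E(1)])
      moreover have "rel_interior E \<subseteq> Dom M" using coarse_face_cases[OF E(1)] E(2) by auto
      ultimately show False
        using fine_facet(2,4)[OF ef] frontier_Dom rel_interior_subset[of e] by blast
    qed
    moreover have "local_snapshot M E e' K (snap M E e')"
      using snap_is_snapshot[OF E(1) e'] K by (simp add: is_snapshot_def)
    ultimately have "snap M E e' \<tau> x \<bullet> outer_normal \<tau> e = 0"
      using snapshot_trace[OF _ bd x] by simp
    then show ?thesis by (simp add: ncomp_def \<tau>_def bd_normal_def)
  qed
qed

end

section \<open>Integrals of polynomial fields\<close>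

lemma zero_on_body_of_AE:
  fixes g :: "'a::euclidean_space \<Rightarrow> 'b::real_normed_vector"
  assumes "S \<subseteq> closure (interior S)" "continuous_on UNIV g"
    and ae: "AE x in lebesgue. x \<in> S \<longrightarrow> g x = 0" and x: "x \<in> S"
  shows "g x = 0"
proof -
  obtain N where N: "N \<in> null_sets lebesgue" "{x. \<not> (x \<in> S \<longrightarrow> g x = 0)} \<subseteq> N"
    using ae unfolding eventually_ae_filter by auto
  have cl: "closed {x. g x = 0}"
    using continuous_closed_preimage_constant[OF assms(2) closed_UNIV, of 0] by simp
  define U where "U = interior S \<inter> - {x. g x = 0}"
  have "open U" using cl by (simp add: U_def open_Int open_Compl)
  moreover have "U \<subseteq> N" using N(2) interior_subset by (auto simp: U_def)
  then have "negligible U"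
    using N(1) negligible_subset negligible_iff_null_sets by blast
  ultimately have "U = {}" using open_not_negligible by blast
  then have "interior S \<subseteq> {x. g x = 0}" by (auto simp: U_def)
  then have "closure (interior S) \<subseteq> {x. g x = 0}" using cl by (rule closure_minimal)
  then show ?thesis using assms(1) x by blast
qed

lemma AE_zero_of_set_integral:
  fixes f :: "'a::euclidean_space \<Rightarrow> real"
  assumes "set_integrable lebesgue S f" "\<And>x. x \<in> S \<Longrightarrow> 0 \<le> f x"
    and "(LINT x:S|lebesgue. f x) = 0"
  shows "AE x in lebesgue. x \<in> S \<longrightarrow> f x = 0"
proof -
  have "AE x in lebesgue. indicator S x *\<^sub>R f x = 0"
    using assms integral_nonneg_eq_0_iff_AE[of lebesgue "\<lambda>x. indicator S x *\<^sub>R f x"]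
    by (auto simp: set_integrable_def set_lebesgue_integral_def indicator_def)
  then show ?thesis by (rule AE_mp) (auto simp: indicator_def)
qed

lemma set_integrable_continuous_mult:
  fixes f g :: "'a::euclidean_space \<Rightarrow> real"
  assumes "compact S" "continuous_on S f" "set_integrable lebesgue S g"
  shows "set_integrable lebesgue S (\<lambda>x. f x * g x)"
proof -
  have S: "S \<in> sets lebesgue" using assms(1) lmeasurable_compact fmeasurableD by blast
  show ?thesis
    by (rule absolutely_integrable_bounded_measurable_product[OF bilinear_times])
      (use assms S continuous_imp_measurable_on_sets_lebesgue compact_continuous_image
          compact_imp_bounded in blast)+
qed

lemma set_integrable_continuous:
  fixes f :: "'a::euclidean_space \<Rightarrow> real"
  assumes "compact S" "continuous_on S f"
  shows "set_integrable lebesgue S f"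
  using set_integrable_continuous_mult[OF assms, of "\<lambda>_. 1"] lmeasurable_compact[OF assms(1)]
  by simp

text \<open>Fields with polynomial branches; this space contains the snapshot space, and the energy form
  is bilinear on it.\<close>

definition poly_fields :: "'a::euclidean_space vfield set" where
  "poly_fields = {v. \<forall>\<tau>. polynomial_function (v \<tau>)}"

lemma subspace_poly_fields: "subspace poly_fields"
  unfolding subspace_def poly_fields_def
  by (auto simp: plus_fun_def zero_fun_def scaleR_fun_def)

lemma divergence_add:
  assumes "polynomial_function u" "polynomial_function v"
  shows "divergence (\<lambda>x. u x + v x) x = divergence u x + divergence v x"
proof -
  have "(u has_derivative frechet_derivative u (at x)) (at x)"
    "(v has_derivative frechet_derivative v (at x)) (at x)"
    using assms differentiable_at_polynomial_function frechet_derivative_works by blast+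
  from frechet_derivative_at[OF has_derivative_add[OF this]]
  have "frechet_derivative (\<lambda>x. u x + v x) (at x) =
      (\<lambda>h. frechet_derivative u (at x) h + frechet_derivative v (at x) h)" by simp
  then show ?thesis by (simp add: divergence_def inner_add_left sum.distrib)
qed

lemma divergence_scaleR:
  assumes "polynomial_function u"
  shows "divergence (\<lambda>x. c *\<^sub>R u x) x = c * divergence u x"
proof -
  have "(u has_derivative frechet_derivative u (at x)) (at x)"
    using assms differentiable_at_polynomial_function frechet_derivative_works by blast
  from frechet_derivative_at[OF has_derivative_scaleR_right[OF this]]
  have "frechet_derivative (\<lambda>x. c *\<^sub>R u x) (at x) = (\<lambda>h. c *\<^sub>R frechet_derivative u (at x) h)"
    by simp
  then show ?thesis by (simp add: divergence_def sum_distrib_left)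
qed

lemma Div_add: "v \<in> poly_fields \<Longrightarrow> w \<in> poly_fields \<Longrightarrow> Div (v + w) \<tau> x = Div v \<tau> x + Div w \<tau> x"
  by (simp add: Div_def plus_fun_def poly_fields_def divergence_add)

lemma Div_scaleR: "v \<in> poly_fields \<Longrightarrow> Div (c *\<^sub>R v) \<tau> x = c * Div v \<tau> x"
  by (simp add: Div_def scaleR_fun_def poly_fields_def divergence_scaleR)

lemma Div_zero: "v \<tau> = 0 \<Longrightarrow> Div v \<tau> x = 0"
  by (simp add: Div_def divergence_def zero_fun_def)

lemma Vsnap_sum_eq: "Vsnap_sum M \<E> = span (\<Union>E\<in>\<E>. snap M E ` fine_faces_in M E)"
proof
  show "Vsnap_sum M \<E> \<subseteq> span (\<Union>E\<in>\<E>. snap M E ` fine_faces_in M E)"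
    unfolding Vsnap_sum_def Vsnap_loc_def
    by (intro span_minimal UN_least span_mono subspace_span) auto
  show "span (\<Union>E\<in>\<E>. snap M E ` fine_faces_in M E) \<subseteq> Vsnap_sum M \<E>"
    unfolding Vsnap_sum_def Vsnap_loc_def by (intro span_mono UN_mono span_superset) auto
qed

lemma subspace_Vsnap [simp]: "subspace (Vsnap M)"
  and subspace_Vsnap_sum [simp]: "subspace (Vsnap_sum M \<E>)"
  and subspace_Vsnap_loc [simp]: "subspace (Vsnap_loc M E)"
  by (simp_all add: Vsnap_def Vsnap_sum_def Vsnap_loc_def)

lemma Vsnap_sum_mono: "\<E> \<subseteq> \<E>' \<Longrightarrow> Vsnap_sum M \<E> \<subseteq> Vsnap_sum M \<E>'"
  unfolding Vsnap_sum_def by (intro span_mono UN_mono) auto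

lemma Vsnap_loc_subset_sum: "E \<in> \<E> \<Longrightarrow> Vsnap_loc M E \<subseteq> Vsnap_sum M \<E>"
  unfolding Vsnap_sum_def by (rule order.trans[OF _ span_superset]) auto

lemma snap_in_loc: "e \<in> fine_faces_in M E \<Longrightarrow> snap M E e \<in> Vsnap_loc M E"
  unfolding Vsnap_loc_def by (intro span_base) auto

context gmsfem
begin

lemma fine_elements: assumes "\<tau> \<in> fine_mesh M"
  shows "\<exists>B. Qloc M \<tau> = span B" "u \<in> Vloc M \<tau> \<Longrightarrow> polynomial_function u"
    "u \<in> Vloc M \<tau> \<Longrightarrow> divergence u \<in> Qloc M \<tau>"
    "q \<in> Qloc M \<tau> \<Longrightarrow> polynomial_function q" "(\<lambda>x. c) \<in> Qloc M \<tau>"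
proof -
  have "fine_mfem M" by (insert mixed, unfold mixed_gmsfem_def, elim conjE, assumption)
  note * = bspec[OF this[unfolded fine_mfem_def] assms]
  show "\<exists>B. Qloc M \<tau> = span B" using * by blast
  show "u \<in> Vloc M \<tau> \<Longrightarrow> polynomial_function u" using * by blast
  show "u \<in> Vloc M \<tau> \<Longrightarrow> divergence u \<in> Qloc M \<tau>" using * by blast
  show "q \<in> Qloc M \<tau> \<Longrightarrow> polynomial_function q" using * by blast
  show "(\<lambda>x. c) \<in> Qloc M \<tau>" using * by blast
qed

lemma perm_pos: "\<tau> \<in> fine_mesh M \<Longrightarrow> x \<in> \<tau> \<Longrightarrow> 0 < perm M x"
proof -
  have "\<forall>x\<in>closure (Dom M). perm M x > 0"
    by (insert mixed, unfold mixed_gmsfem_def, elim conjE, assumption)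
  then show "\<tau> \<in> fine_mesh M \<Longrightarrow> x \<in> \<tau> \<Longrightarrow> 0 < perm M x" using fine_cell(7) by blast
qed

lemma cell_sets: "\<tau> \<in> fine_mesh M \<Longrightarrow> \<tau> \<in> sets lebesgue"
  using fine_cell(5) lmeasurable_compact fmeasurableD by blast

lemma perm_integrable: "\<tau> \<in> fine_mesh M \<Longrightarrow> set_integrable lebesgue \<tau> (\<lambda>x. inverse (perm M x))"
proof -
  have "set_integrable lebesgue (closure (Dom M)) (\<lambda>x. inverse (perm M x))"
    by (insert mixed, unfold mixed_gmsfem_def, elim conjE, assumption)
  then show "\<tau> \<in> fine_mesh M \<Longrightarrow> set_integrable lebesgue \<tau> (\<lambda>x. inverse (perm M x))"
    using set_integrable_subset cell_sets fine_cell(7) by blast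
qed

lemma kprod_integrable:
  assumes "v \<in> poly_fields" "w \<in> poly_fields" "\<tau> \<in> fine_mesh M"
  shows "set_integrable lebesgue \<tau> (\<lambda>x. inverse (perm M x) * (v \<tau> x \<bullet> w \<tau> x))"
proof -
  have "continuous_on \<tau> (\<lambda>x. v \<tau> x \<bullet> w \<tau> x)"
    using assms by (intro continuous_intros continuous_on_polymonial_function) (auto simp: poly_fields_def)
  from set_integrable_continuous_mult[OF fine_cell(5)[OF assms(3)] this perm_integrable[OF assms(3)]]
  show ?thesis by (simp add: mult.commute)
qed

lemma cells_fine: "\<tau> \<in> cells M A \<Longrightarrow> \<tau> \<in> fine_mesh M"
  by (simp add: cells_def)

lemma cell_energy_nonneg:
  assumes "\<tau> \<in> fine_mesh M"
  shows "0 \<le> (LINT x:\<tau>|lebesgue. inverse (perm M x) * (v \<tau> x \<bullet> v \<tau> x))"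
proof -
  have "0 \<le> indicator \<tau> x *\<^sub>R (inverse (perm M x) * (v \<tau> x \<bullet> v \<tau> x))" for x
    using perm_pos[OF assms, of x] by (auto simp: indicator_def)
  then show ?thesis unfolding set_lebesgue_integral_def by (intro integral_nonneg_AE) auto
qed

lemma kprod_psd: "psd_form poly_fields (kprod M A)"
proof
  fix x y z :: "'a vfield" and c :: real
  assume x: "x \<in> poly_fields"
  show "0 \<le> kprod M A x x"
    unfolding kprod_def integ_def by (intro sum_nonneg cell_energy_nonneg cells_fine)
  assume z: "z \<in> poly_fields"
  show "kprod M A (c *\<^sub>R x) z = c * kprod M A x z"
    unfolding kprod_def integ_def
    by (simp add: scaleR_fun_def mult.left_commute[of _ c] sum_distrib_left)
  assume y: "y \<in> poly_fields"
  show "kprod M A (x + y) z = kprod M A x z + kprod M A y z"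
    unfolding kprod_def integ_def sum.distrib[symmetric]
  proof (intro sum.cong refl)
    fix \<tau> assume "\<tau> \<in> cells M A"
    then have "\<tau> \<in> fine_mesh M" by (rule cells_fine)
    then show "(LINT xa:\<tau>|lebesgue. inverse (perm M xa) * ((x + y) \<tau> xa \<bullet> z \<tau> xa)) =
         (LINT xa:\<tau>|lebesgue. inverse (perm M xa) * (x \<tau> xa \<bullet> z \<tau> xa)) +
         (LINT xa:\<tau>|lebesgue. inverse (perm M xa) * (y \<tau> xa \<bullet> z \<tau> xa))"
      by (subst set_integral_add(2)[symmetric])
        (auto intro!: kprod_integrable x y z simp: inner_add_left algebra_simps)
  qed
next
  fix x y :: "'a vfield"
  show "kprod M A x y = kprod M A y x" by (simp add: kprod_def inner_commute)
qed (rule subspace_poly_fields)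

sublocale energy: psd_form poly_fields "kprod M A" for A by (rule kprod_psd)

lemma kprod_eq_0D:
  assumes v: "v \<in> poly_fields" and 0: "kprod M A v v = 0" and \<tau>: "\<tau> \<in> cells M A" and x: "x \<in> \<tau>"
  shows "v \<tau> x = 0"
proof -
  note tf = cells_fine[OF \<tau>]
  have "(LINT x:\<tau>|lebesgue. inverse (perm M x) * (v \<tau> x \<bullet> v \<tau> x)) = 0"
    using 0 \<tau> cell_energy_nonneg[OF cells_fine] unfolding kprod_def integ_def
    by (subst (asm) sum_nonneg_eq_0_iff) auto
  then have "AE x in lebesgue. x \<in> \<tau> \<longrightarrow> inverse (perm M x) * (v \<tau> x \<bullet> v \<tau> x) = 0"
    using kprod_integrable[OF v v tf] perm_pos[OF tf]
    by (intro AE_zero_of_set_integral) (auto simp: less_imp_le)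
  then have "AE x in lebesgue. x \<in> \<tau> \<longrightarrow> v \<tau> x = 0"
  proof (rule eventually_mono)
    fix x assume "x \<in> \<tau> \<longrightarrow> inverse (perm M x) * (v \<tau> x \<bullet> v \<tau> x) = 0"
    then show "x \<in> \<tau> \<longrightarrow> v \<tau> x = 0" using perm_pos[OF tf, of x] by auto
  qed
  moreover have "continuous_on UNIV (v \<tau>)"
    using v by (intro continuous_on_polymonial_function) (auto simp: poly_fields_def)
  ultimately show ?thesis using zero_on_body_of_AE[OF fine_cell(6)[OF tf]] x by blast
qed

lemma kprod_restrict:
  assumes "B \<subseteq> A" "\<And>\<tau>. \<tau> \<notin> cells M B \<Longrightarrow> w \<tau> = 0"
  shows "kprod M A v w = kprod M B v w"
proof -
  have "cells M B \<subseteq> cells M A" using assms(1) by (auto simp: cells_def)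
  then show ?thesis unfolding kprod_def integ_def
    using assms(2) by (intro sum.mono_neutral_right) (auto simp: set_lebesgue_integral_def)
qed

lemma sprod_restrict:
  assumes "B \<subseteq> A" "\<And>\<tau>. \<tau> \<notin> cells M B \<Longrightarrow> w \<tau> = 0"
  shows "sprod M A (Div w) p = sprod M B (Div w) p"
proof -
  have "cells M B \<subseteq> cells M A" using assms(1) by (auto simp: cells_def)
  then show ?thesis unfolding sprod_def integ_def
    using assms(2) Div_zero[of w] by (intro sum.mono_neutral_right) (auto simp: set_lebesgue_integral_def)
qed

lemma kprod_cong:
  assumes "\<And>\<tau>. \<tau> \<in> cells M A \<Longrightarrow> v \<tau> = v' \<tau>" "\<And>\<tau>. \<tau> \<in> cells M A \<Longrightarrow> w \<tau> = w' \<tau>"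
  shows "kprod M A v w = kprod M A v' w'"
  using assms unfolding kprod_def integ_def by (intro sum.cong) auto

lemma sprod_div_free: "div_free M v \<Longrightarrow> sprod M A (Div v) p = 0"
  unfolding sprod_def integ_def
proof (intro sum.neutral ballI)
  fix \<tau> assume "div_free M v" "\<tau> \<in> cells M A"
  then have "indicator \<tau> x *\<^sub>R (Div v \<tau> x * p \<tau> x) = 0" for x
    using cells_fine[of \<tau> A] by (simp add: div_free_def indicator_def)
  then show "(LINT x:\<tau>|lebesgue. Div v \<tau> x * p \<tau> x) = 0"
    unfolding set_lebesgue_integral_def by (simp only: integral_zero)
qed


section \<open>Divergence of snapshots\<close>

lemma snap_cell:
  assumes E: "E \<in> coarse_faces M" "e \<in> fine_faces_in M E"
  shows "snap M E e \<tau> \<in> Vloc M \<tau> \<and> \<tau> \<in> fine_mesh M \<or> snap M E e \<tau> = 0"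
proof (cases "\<tau> \<in> cells M (nbhd M E)")
  case True
  then obtain K where K: "K \<in> nbhd_blocks M E" "\<tau> \<in> cells M K" using cells_nbhd by blast
  have "local_snapshot M E e K (snap M E e)"
    using snap_is_snapshot[OF E] K by (simp add: is_snapshot_def)
  then have "snap M E e \<in> Vfine M K" unfolding local_snapshot_def by (elim conjE)
  then show ?thesis using K cells_fine by (auto simp: Vfine_def)
next
  case False
  then show ?thesis using snap_outside[OF E] by blast
qed

lemma snap_poly:
  assumes "E \<in> coarse_faces M" "e \<in> fine_faces_in M E"
  shows "snap M E e \<in> poly_fields"
  unfolding poly_fields_def
proof (intro CollectI allI)
  fix \<tau>
  from snap_cell[OF assms, of \<tau>] show "polynomial_function (snap M E e \<tau>)"
  proof
    assume "snap M E e \<tau> = 0"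
    then show ?thesis by (simp add: zero_fun_def)
  qed (use fine_elements(2) in blast)
qed

lemma Vsnap_sum_poly: "\<E> \<subseteq> coarse_faces M \<Longrightarrow> Vsnap_sum M \<E> \<subseteq> poly_fields"
  unfolding Vsnap_sum_eq by (rule span_minimal[OF _ subspace_poly_fields]) (use snap_poly in blast)

lemma Vsnap_poly: "Vsnap M \<subseteq> poly_fields"
  unfolding Vsnap_def by (rule Vsnap_sum_poly) auto

lemma Vsnap_loc_subset: "E \<in> coarse_faces M \<Longrightarrow> Vsnap_loc M E \<subseteq> Vsnap M"
  unfolding Vsnap_def by (rule Vsnap_loc_subset_sum)

text \<open>The divergence of a snapshot lies in the local pressure space and equals a constant tested
  against that space, so it is that constant.\<close>

lemma snap_Div_const:
  assumes E: "E \<in> coarse_faces M" "e \<in> fine_faces_in M E" and K: "K \<in> coarse_mesh M"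
  shows "\<exists>c. \<forall>\<tau>\<in>cells M K. \<forall>x\<in>\<tau>. Div (snap M E e) \<tau> x = c"
proof (cases "K \<in> nbhd_blocks M E")
  case False
  have "snap M E e \<tau> = 0" if \<tau>: "\<tau> \<in> cells M K" for \<tau>
  proof (rule snap_outside[OF E], rule notI)
    assume "\<tau> \<in> cells M (nbhd M E)"
    then obtain L where L: "L \<in> nbhd_blocks M E" "\<tau> \<in> cells M L" using cells_nbhd by blast
    then have "L = K"
      using \<tau> K block_unique[OF cells_fine[OF \<tau>], of L K] nbhd_blocksD by (auto simp: cells_def)
    then show False using L False by simp
  qed
  then show ?thesis using Div_zero by (intro exI[of _ 0]) blast
next
  case True
  define v where "v = snap M E e"
  have loc: "local_snapshot M E e K v"
    using snap_is_snapshot[OF E] True by (simp add: is_snapshot_def v_def)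
  have "\<exists>p\<in>Qfine M K. \<exists>\<alpha>::real.
        \<alpha> * measure lebesgue K
          = (\<Sum>(\<tau>, e) \<in> block_bd M K. surf_integral e (\<lambda>x. v \<tau> x \<bullet> outer_normal \<tau> e)) \<and>
        (\<forall>w\<in>Vfine M K.
           (\<forall>(\<tau>, e) \<in> block_bd M K. \<forall>x\<in>e. w \<tau> x \<bullet> outer_normal \<tau> e = 0) \<longrightarrow>
           kprod M K v w - sprod M K (Div w) p = 0) \<and>
        (\<forall>q\<in>Qfine M K. sprod M K (Div v) q = sprod M K (\<lambda>\<tau> x. \<alpha>) q)"
    by (insert loc, unfold local_snapshot_def, elim conjE, assumption)
  then obtain \<alpha> where \<alpha>: "\<And>q. q \<in> Qfine M K \<Longrightarrow> sprod M K (Div v) q = sprod M K (\<lambda>\<tau> x. \<alpha>) q"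
    by (elim bexE exE conjE) blast
  have vK: "v \<tau> \<in> Vloc M \<tau>" if "\<tau> \<in> cells M K" for \<tau>
  proof -
    have "v \<in> Vfine M K" by (insert loc, unfold local_snapshot_def, elim conjE, assumption)
    then show ?thesis using that by (simp add: Vfine_def)
  qed
  define f where "f \<tau> x = Div v \<tau> x - \<alpha>" for \<tau> x
  have fQ: "f \<tau> \<in> Qloc M \<tau>" if "\<tau> \<in> cells M K" for \<tau>
  proof -
    note tf = cells_fine[OF that]
    obtain B where B: "Qloc M \<tau> = span B" using fine_elements(1)[OF tf] by blast
    have "divergence (v \<tau>) - (\<lambda>x. \<alpha>) \<in> Qloc M \<tau>"
      using fine_elements(3)[OF tf vK[OF that]] fine_elements(5)[OF tf, of \<alpha>] B span_diff by metis
    moreover have "f \<tau> = divergence (v \<tau>) - (\<lambda>x. \<alpha>)" by (simp add: f_def Div_def fun_eq_iff)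
    ultimately show ?thesis by simp
  qed
  have fc: "continuous_on S (f \<tau>)" if "\<tau> \<in> cells M K" for \<tau> S
    using fine_elements(4)[OF cells_fine[OF that] fQ[OF that]] by (rule continuous_on_polymonial_function)
  have "f \<in> Qfine M K" using fQ by (simp add: Qfine_def)
  then have eq: "sprod M K (Div v) f = sprod M K (\<lambda>\<tau> x. \<alpha>) f" by (rule \<alpha>)
  have int2: "set_integrable lebesgue \<tau> (\<lambda>x. f \<tau> x * f \<tau> x)"
    and inta: "set_integrable lebesgue \<tau> (\<lambda>x. \<alpha> * f \<tau> x)" if "\<tau> \<in> cells M K" for \<tau>
    using set_integrable_continuous[OF fine_cell(5)[OF cells_fine[OF that]]]
      continuous_on_mult[OF fc fc] continuous_on_mult_left[OF fc] that by blast+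
  have "sprod M K (Div v) f = (\<Sum>\<tau>\<in>cells M K. (LINT x:\<tau>|lebesgue. f \<tau> x * f \<tau> x))
      + sprod M K (\<lambda>\<tau> x. \<alpha>) f"
    unfolding sprod_def integ_def sum.distrib[symmetric]
  proof (intro sum.cong refl)
    fix \<tau> assume \<tau>: "\<tau> \<in> cells M K"
    have "(LINT x:\<tau>|lebesgue. Div v \<tau> x * f \<tau> x) = (LINT x:\<tau>|lebesgue. f \<tau> x * f \<tau> x + \<alpha> * f \<tau> x)"
      by (simp add: f_def algebra_simps)
    then show "(LINT x:\<tau>|lebesgue. Div v \<tau> x * f \<tau> x) =
         (LINT x:\<tau>|lebesgue. f \<tau> x * f \<tau> x) + (LINT x:\<tau>|lebesgue. \<alpha> * f \<tau> x)"
      using set_integral_add(2)[OF int2[OF \<tau>] inta[OF \<tau>]] by simp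
  qed
  then have sum0: "(\<Sum>\<tau>\<in>cells M K. (LINT x:\<tau>|lebesgue. f \<tau> x * f \<tau> x)) = 0" using eq by simp
  have nn: "0 \<le> (LINT x:\<tau>|lebesgue. f \<tau> x * f \<tau> x)" for \<tau>
    unfolding set_lebesgue_integral_def by (intro integral_nonneg_AE) (auto simp: indicator_def)
  have "Div v \<tau> x = \<alpha>" if \<tau>: "\<tau> \<in> cells M K" and x: "x \<in> \<tau>" for \<tau> x
  proof -
    have "(LINT x:\<tau>|lebesgue. f \<tau> x * f \<tau> x) = 0"
      using sum0 \<tau> nn by (subst (asm) sum_nonneg_eq_0_iff) auto
    then have "AE x in lebesgue. x \<in> \<tau> \<longrightarrow> f \<tau> x * f \<tau> x = 0"
      by (intro AE_zero_of_set_integral int2 \<tau>) auto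
    then have "AE x in lebesgue. x \<in> \<tau> \<longrightarrow> f \<tau> x = 0" by simp
    then have "f \<tau> x = 0"
      by (rule zero_on_body_of_AE[OF fine_cell(6)[OF cells_fine[OF \<tau>]] fc[OF \<tau>] _ x])
    then show ?thesis by (simp add: f_def)
  qed
  then have "\<forall>\<tau>\<in>cells M K. \<forall>x\<in>\<tau>. Div v \<tau> x = \<alpha>" by (intro ballI)
  then show ?thesis unfolding v_def by (rule exI)
qed

lemma Vsnap_Div_const:
  assumes v: "v \<in> Vsnap M" and K: "K \<in> coarse_mesh M"
  shows "\<exists>c. \<forall>\<tau>\<in>cells M K. \<forall>x\<in>\<tau>. Div v \<tau> x = c"
proof -
  define W where "W = {v \<in> poly_fields. \<exists>c. \<forall>\<tau>\<in>cells M K. \<forall>x\<in>\<tau>. Div v \<tau> x = c}"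
  have "subspace W"
    unfolding subspace_def
  proof (intro conjI ballI allI)
    show "0 \<in> W" using energy.mem(1) Div_zero[of 0] by (auto simp: W_def)
    show "x + y \<in> W" if xy: "x \<in> W" "y \<in> W" for x y
    proof -
      from xy obtain c d where "\<forall>\<tau>\<in>cells M K. \<forall>z\<in>\<tau>. Div x \<tau> z = c" "\<forall>\<tau>\<in>cells M K. \<forall>z\<in>\<tau>. Div y \<tau> z = d"
        and p: "x \<in> poly_fields" "y \<in> poly_fields" by (auto simp: W_def)
      then have "\<forall>\<tau>\<in>cells M K. \<forall>z\<in>\<tau>. Div (x + y) \<tau> z = c + d" by (simp add: Div_add)
      then show ?thesis using p energy.mem(2) by (auto simp: W_def)
    qed
    show "k *\<^sub>R x \<in> W" if x: "x \<in> W" for k x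
    proof -
      from x obtain c where "\<forall>\<tau>\<in>cells M K. \<forall>z\<in>\<tau>. Div x \<tau> z = c" and p: "x \<in> poly_fields"
        by (auto simp: W_def)
      then have "\<forall>\<tau>\<in>cells M K. \<forall>z\<in>\<tau>. Div (k *\<^sub>R x) \<tau> z = k * c" by (simp add: Div_scaleR)
      then show ?thesis using p energy.mem(4) by (auto simp: W_def)
    qed
  qed
  then have "Vsnap M \<subseteq> W"
    unfolding Vsnap_def Vsnap_sum_eq
    using snap_poly snap_Div_const[OF _ _ K] by (intro span_minimal) (auto simp: W_def)
  then show ?thesis using v by (auto simp: W_def)
qed

lemma cell_measure_pos: "\<tau> \<in> fine_mesh M \<Longrightarrow> 0 < measure lebesgue \<tau>"
proof -
  assume t: "\<tau> \<in> fine_mesh M"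
  have "\<not> negligible \<tau>"
    using fine_cell(2)[OF t] open_not_negligible[OF open_interior] negligible_subset interior_subset by blast
  then show ?thesis
    using negligible_iff_measure0[OF lmeasurable_compact[OF fine_cell(5)[OF t]]] measure_nonneg[of lebesgue \<tau>]
    by linarith
qed

text \<open>Both factors are constant on every cell, so the integral becomes a sum of point values; bilinearity
  follows without further integrability considerations.\<close>

lemma sprod_Div:
  assumes v: "v \<in> Vsnap M" and q: "q \<in> Q_space M"
  shows "sprod M A (Div v) q =
    (\<Sum>\<tau>\<in>cells M A. measure lebesgue \<tau> * (Div v \<tau> (SOME x. x \<in> \<tau>) * q \<tau> (SOME x. x \<in> \<tau>)))"
  unfolding sprod_def integ_def
proof (intro sum.cong refl)
  fix \<tau> assume "\<tau> \<in> cells M A"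
  then have tf: "\<tau> \<in> fine_mesh M" by (rule cells_fine)
  obtain K where K: "K \<in> coarse_mesh M" "\<tau> \<subseteq> K" using block_ex[OF tf] by blast
  then have \<tau>K: "\<tau> \<in> cells M K" using tf by (simp add: cells_def)
  obtain c where c: "\<And>x. x \<in> \<tau> \<Longrightarrow> Div v \<tau> x = c" using Vsnap_Div_const[OF v K(1)] \<tau>K by blast
  obtain d where d: "q \<tau> = (\<lambda>x. d)" using q K(1) \<tau>K unfolding Q_space_def by blast
  have "\<tau> \<noteq> {}" using fine_cell(2)[OF tf] by auto
  then have s: "(SOME x. x \<in> \<tau>) \<in> \<tau>" by (simp add: some_in_eq)
  have "(LINT x:\<tau>|lebesgue. Div v \<tau> x * q \<tau> x) = (LINT x:\<tau>|lebesgue. c * d)"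
    using c d by (intro set_lebesgue_integral_cong cell_sets tf) auto
  also have "\<dots> = measure lebesgue \<tau> * (c * d)"
    using lmeasurable_compact[OF fine_cell(5)[OF tf]]
    by (simp add: set_lebesgue_integral_def)
  finally show "(LINT x:\<tau>|lebesgue. Div v \<tau> x * q \<tau> x) =
      measure lebesgue \<tau> * (Div v \<tau> (SOME x. x \<in> \<tau>) * q \<tau> (SOME x. x \<in> \<tau>))"
    using c[OF s] d by simp
qed

lemma sprod_Div_add:
  assumes "v \<in> Vsnap M" "w \<in> Vsnap M" "q \<in> Q_space M"
  shows "sprod M A (Div (v + w)) q = sprod M A (Div v) q + sprod M A (Div w) q"
  unfolding sprod_Div[OF subspace_add[OF subspace_Vsnap assms(1,2)] assms(3)]
    sprod_Div[OF assms(1,3)] sprod_Div[OF assms(2,3)]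
    Div_add[OF subsetD[OF Vsnap_poly assms(1)] subsetD[OF Vsnap_poly assms(2)]]
  by (simp add: sum.distrib algebra_simps)

lemma sprod_Div_scaleR:
  assumes "v \<in> Vsnap M" "q \<in> Q_space M"
  shows "sprod M A (Div (c *\<^sub>R v)) q = c * sprod M A (Div v) q"
  unfolding sprod_Div[OF subspace_scale[OF subspace_Vsnap assms(1)] assms(2)] sprod_Div[OF assms]
    Div_scaleR[OF subsetD[OF Vsnap_poly assms(1)]]
  by (simp add: sum_distrib_left algebra_simps)

text \<open>The piecewise constants see the whole divergence of a snapshot field.\<close>

lemma div_freeI:
  assumes v: "v \<in> Vsnap M" and 0: "\<And>q. q \<in> Q_space M \<Longrightarrow> sprod M (closure (Dom M)) (Div v) q = 0"
  shows "div_free M v"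
  unfolding div_free_def
proof (intro ballI)
  fix \<tau> x assume \<tau>: "\<tau> \<in> fine_mesh M" and x: "x \<in> \<tau>"
  \<comment> \<open>the divergence itself, as a member of the space of piecewise constants\<close>
  define q where "q \<tau> = (\<lambda>_::'a. Div v \<tau> (SOME x. x \<in> \<tau>))" for \<tau>
  have some: "(SOME x. x \<in> \<sigma>) \<in> \<sigma>" if "\<sigma> \<in> fine_mesh M" for \<sigma>
  proof -
    have "\<sigma> \<noteq> {}" using fine_cell(2)[OF that] by auto
    then show ?thesis by (simp add: some_in_eq)
  qed
  have q: "q \<in> Q_space M"
    unfolding Q_space_def
  proof (intro CollectI ballI)
    fix K assume K: "K \<in> coarse_mesh M"
    obtain c where c: "\<forall>\<tau>\<in>cells M K. \<forall>x\<in>\<tau>. Div v \<tau> x = c" using Vsnap_Div_const[OF v K] by (elim exE)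
    have "q \<sigma> = (\<lambda>x. c)" if \<sigma>: "\<sigma> \<in> cells M K" for \<sigma>
      using bspec[OF bspec[OF c \<sigma>] some[OF cells_fine[OF \<sigma>]]] by (simp only: q_def)
    then have "\<forall>\<tau>\<in>cells M K. q \<tau> = (\<lambda>x. c)" by (intro ballI)
    then show "\<exists>c. \<forall>\<tau>\<in>cells M K. q \<tau> = (\<lambda>x. c)" by (rule exI)
  qed
  have "(\<Sum>\<tau>\<in>fine_mesh M. measure lebesgue \<tau> * (Div v \<tau> (SOME x. x \<in> \<tau>))\<^sup>2) = 0"
    using 0[OF q] unfolding sprod_Div[OF v q] cells_Dom by (simp only: q_def power2_eq_square)
  then have "measure lebesgue \<tau> * (Div v \<tau> (SOME x. x \<in> \<tau>))\<^sup>2 = 0"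
    using \<tau> finite_fine_mesh by (subst (asm) sum_nonneg_eq_0_iff) auto
  then have z: "Div v \<tau> (SOME x. x \<in> \<tau>) = 0" using cell_measure_pos[OF \<tau>] by simp
  obtain K where K: "K \<in> coarse_mesh M" "\<tau> \<subseteq> K" using block_ex[OF \<tau>] by blast
  then have \<tau>K: "\<tau> \<in> cells M K" using \<tau> by (simp add: cells_def)
  then obtain c where c: "\<And>x. x \<in> \<tau> \<Longrightarrow> Div v \<tau> x = c" using Vsnap_Div_const[OF v K(1)] by blast
  then show "Div v \<tau> x = 0" using z some[OF \<tau>] x by simp
qed

end

section \<open>Coordinates of snapshot fields\<close>

lemma ncomp_add: "ncomp M (v + w) n e x = ncomp M v n e x + ncomp M w n e x"
  by (simp add: ncomp_def inner_add_left)

lemma ncomp_scaleR: "ncomp M (c *\<^sub>R v) n e x = c * ncomp M v n e x"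
  by (simp add: ncomp_def scaleR_fun_def)

lemma ncomp_zero: "ncomp M 0 n e x = 0"
  by (simp add: ncomp_def)

lemma ncomp_diff: "ncomp M (v - w) n e x = ncomp M v n e x - ncomp M w n e x"
  using ncomp_add[of M "v - w" w n e x] by simp

text \<open>Normal component on a fine face; it is constant there for snapshot fields, so that it may be
  evaluated at any one point. Together these numbers are the coordinates with respect to the
  snapshots.\<close>

definition coef :: "'a::euclidean_space gmsfem \<Rightarrow> 'a set \<Rightarrow> 'a set \<Rightarrow> 'a vfield \<Rightarrow> real" where
  "coef M E e v = ncomp M v (fnormal M E) e (SOME x. x \<in> e)"

text \<open>The part of a snapshot field contributed by the snapshots of one coarse face.\<close>

definition face_part :: "'a::euclidean_space gmsfem \<Rightarrow> 'a set \<Rightarrow> 'a vfield \<Rightarrow> 'a vfield" where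
  "face_part M E v = (\<Sum>e\<in>fine_faces_in M E. coef M E e v *\<^sub>R snap M E e)"

lemma coef_add: "coef M E e (v + w) = coef M E e v + coef M E e w"
  and coef_scaleR: "coef M E e (c *\<^sub>R v) = c * coef M E e v"
  and coef_zero: "coef M E e 0 = 0"
  and coef_diff: "coef M E e (v - w) = coef M E e v - coef M E e w"
  by (simp_all add: coef_def ncomp_add ncomp_scaleR ncomp_zero ncomp_diff)

lemma coef_sum: "coef M E e (sum f I) = (\<Sum>i\<in>I. coef M E e (f i))"
proof (induction I rule: infinite_finite_induct)
  case (insert i I)
  then show ?case by (simp only: sum.insert[OF insert.hyps] coef_add)
qed (simp_all only: not_False_eq_True sum.infinite sum.empty coef_zero)

lemma face_part_add: "face_part M E (v + w) = face_part M E v + face_part M E w"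
  by (simp add: face_part_def coef_add scaleR_add_left sum.distrib)

lemma face_part_scaleR: "face_part M E (c *\<^sub>R v) = c *\<^sub>R face_part M E v"
  by (simp add: face_part_def coef_scaleR scaleR_sum_right)

lemma face_part_zero: "face_part M E 0 = 0"
  by (simp add: face_part_def coef_zero)

lemma face_part_in_loc: "face_part M E v \<in> Vsnap_loc M E"
  unfolding face_part_def by (intro subspace_sum subspace_scale subspace_Vsnap_loc snap_in_loc)

context gmsfem
begin

lemma coef_snap:
  assumes "E \<in> coarse_faces M" "e \<in> fine_faces_in M E" "E' \<in> coarse_faces M" "e' \<in> fine_faces_in M E'"
  shows "coef M E e (snap M E' e') = (if E' = E \<and> e' = e then 1 else 0)"
proof -
  have "(SOME x. x \<in> e) \<in> e" using fine_facet(3)[OF assms(2)] by (simp add: some_in_eq)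
  then show ?thesis unfolding coef_def by (rule trace_snap[OF assms])
qed

lemma Vsnap_induct:
  assumes v: "v \<in> Vsnap M" and W: "subspace W"
    and snap: "\<And>E e. E \<in> coarse_faces M \<Longrightarrow> e \<in> fine_faces_in M E \<Longrightarrow> snap M E e \<in> W"
  shows "v \<in> W"
proof -
  have "Vsnap M \<subseteq> W" unfolding Vsnap_def Vsnap_sum_eq
    by (rule span_minimal[OF _ W]) (auto intro: snap)
  then show ?thesis using v by (rule subsetD)
qed

lemma ncomp_eq_coef:
  assumes v: "v \<in> Vsnap M" and E: "E \<in> coarse_faces M" "e \<in> fine_faces_in M E" and x: "x \<in> e"
  shows "ncomp M v (fnormal M E) e x = coef M E e v"
proof -
  have "v \<in> {v. ncomp M v (fnormal M E) e x = coef M E e v}"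
    using v
  proof (rule Vsnap_induct)
    show "subspace {v. ncomp M v (fnormal M E) e x = coef M E e v}"
      by (simp add: subspace_def ncomp_add ncomp_scaleR ncomp_zero coef_add coef_scaleR coef_zero)
    show "snap M E' e' \<in> {v. ncomp M v (fnormal M E) e x = coef M E e v}"
      if "E' \<in> coarse_faces M" "e' \<in> fine_faces_in M E'" for E' e'
      using trace_snap[OF E that x] coef_snap[OF E that] by simp
  qed
  then show ?thesis by simp
qed

lemma face_part_snap:
  assumes "E \<in> coarse_faces M" "E' \<in> coarse_faces M" "e' \<in> fine_faces_in M E'"
  shows "face_part M E (snap M E' e') = (if E = E' then snap M E' e' else 0)"
proof -
  have "face_part M E (snap M E' e') =
      (\<Sum>e\<in>fine_faces_in M E. if e = e' then (if E = E' then snap M E' e' else 0) else 0)"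
    unfolding face_part_def using coef_snap[OF assms(1) _ assms(2,3)] by (intro sum.cong) auto
  then show ?thesis using assms(3) by (auto simp: sum.delta)
qed

lemma Vsnap_expansion:
  assumes "v \<in> Vsnap M" shows "v = (\<Sum>E\<in>coarse_faces M. face_part M E v)"
proof -
  have "v \<in> {v. v = (\<Sum>E\<in>coarse_faces M. face_part M E v)}"
    using assms
  proof (rule Vsnap_induct)
    show "subspace {v. v = (\<Sum>E\<in>coarse_faces M. face_part M E v)}"
      unfolding subspace_def
      by (simp add: face_part_add face_part_scaleR face_part_zero sum.distrib scaleR_sum_right[symmetric])
    show "snap M E e \<in> {v. v = (\<Sum>E\<in>coarse_faces M. face_part M E v)}"
      if "E \<in> coarse_faces M" "e \<in> fine_faces_in M E" for E e
      using that face_part_snap[OF _ that] by simp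
  qed
  then show ?thesis by simp
qed

lemma face_part_loc:
  assumes E: "E \<in> coarse_faces M" and v: "v \<in> Vsnap_loc M E" shows "face_part M E v = v"
proof -
  have "Vsnap_loc M E \<subseteq> {v. face_part M E v = v}"
    unfolding Vsnap_loc_def
  proof (rule span_minimal)
    show "subspace {v. face_part M E v = v}" by (simp add: subspace_def face_part_add face_part_scaleR face_part_zero)
    show "snap M E ` fine_faces_in M E \<subseteq> {v. face_part M E v = v}" using face_part_snap[OF E E] by auto
  qed
  then show ?thesis using v by auto
qed

lemma coef_face_part:
  assumes "E \<in> coarse_faces M" "e \<in> fine_faces_in M E" "E' \<in> coarse_faces M"
  shows "coef M E e (face_part M E' v) = (if E = E' then coef M E e v else 0)"
proof -
  have "coef M E e (face_part M E' v) =
      (\<Sum>e'\<in>fine_faces_in M E'. if e' = e then (if E = E' then coef M E e v else 0) else 0)"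
    unfolding face_part_def coef_sum coef_scaleR using coef_snap[OF assms(1,2,3)] by (intro sum.cong) auto
  then show ?thesis using assms(2) by (auto simp: sum.delta)
qed

lemma face_part_eq_0: "(\<And>e. e \<in> fine_faces_in M E \<Longrightarrow> coef M E e v = 0) \<Longrightarrow> face_part M E v = 0"
  by (simp add: face_part_def)

lemma face_part_outside:
  assumes "E \<in> coarse_faces M" "\<tau> \<notin> cells M (nbhd M E)"
  shows "face_part M E v \<tau> = 0"
proof -
  have "Vsnap_loc M E \<subseteq> {w. w \<tau> = 0}"
    unfolding Vsnap_loc_def
  proof (rule span_minimal)
    show "subspace {w. w \<tau> = 0}" by (simp add: subspace_def scaleR_fun_def zero_fun_def)
    show "snap M E ` fine_faces_in M E \<subseteq> {w. w \<tau> = 0}" using snap_outside[OF assms(1) _ assms(2)] by auto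
  qed
  then show ?thesis using face_part_in_loc[of M E v] by auto
qed

lemma loc_outside:
  assumes "E \<in> coarse_faces M" "v \<in> Vsnap_loc M E" "\<tau> \<notin> cells M (nbhd M E)"
  shows "v \<tau> = 0"
  using face_part_outside[OF assms(1,3), of v] face_part_loc[OF assms(1,2)] by simp

lemma nbhd_subset: "nbhd M E \<subseteq> closure (Dom M)"
  using coarse_cell(7) nbhd_blocksD by (force simp: nbhd_def)

text \<open>The energy on a neighborhood controls the normal components on its coarse face.\<close>

lemma coef_zero_of_energy:
  assumes v: "v \<in> poly_fields" and 0: "kprod M (nbhd M E) v v = 0"
    and E: "E \<in> coarse_faces M" and e: "e \<in> fine_faces_in M E"
  shows "coef M E e v = 0"
proof -
  have x: "(SOME x. x \<in> e) \<in> e" using fine_facet(3)[OF e] by (simp add: some_in_eq)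
  have "adj_cell M e \<in> cells M (nbhd M E)"
    using adjacent_cell_in_nbhd[OF E e fine_facet(5,6)[OF e]] cells_nbhd by simp
  moreover have "e \<subseteq> adj_cell M e" using facet_of_imp_subset[OF fine_facet(6)[OF e]] .
  ultimately have "v (adj_cell M e) (SOME x. x \<in> e) = 0" using kprod_eq_0D[OF v 0] x by blast
  then show ?thesis by (simp add: coef_def ncomp_def)
qed

lemma loc_poly: "E \<in> coarse_faces M \<Longrightarrow> v \<in> Vsnap_loc M E \<Longrightarrow> v \<in> poly_fields"
  using Vsnap_loc_subset Vsnap_poly by (meson subsetD)

lemma energy_loc_definite:
  assumes E: "E \<in> coarse_faces M" and v: "v \<in> Vsnap_loc M E" and 0: "kprod M (nbhd M E) v v = 0"
  shows "v = 0"
  using face_part_eq_0[OF coef_zero_of_energy[OF loc_poly[OF E v] 0 E]] face_part_loc[OF E v] by simp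


section \<open>Minimal extensions\<close>

text \<open>The coarse faces whose neighborhoods meet that of \<open>E\<close>; their snapshots span the space in which
  minimal extensions are sought.\<close>

definition neighbors :: "'a set \<Rightarrow> 'a set set" where
  "neighbors E = {E' \<in> coarse_faces M. nbhd M E' \<inter> nbhd M E \<noteq> {}}"

text \<open>The fields of that space without normal component on \<open>E\<close>, that is, the directions in which the
  extension is minimized.\<close>

definition fluxless :: "'a set \<Rightarrow> 'a vfield set" where
  "fluxless E = {z \<in> Vsnap_sum M (neighbors E). \<forall>e\<in>fine_faces_in M E. coef M E e z = 0}"

lemma neighbors_subset: "neighbors E \<subseteq> coarse_faces M"
  by (auto simp: neighbors_def)

lemma self_neighbor:
  assumes "E \<in> coarse_faces M" shows "E \<in> neighbors E"
proof -
  obtain K where K: "K \<in> nbhd_blocks M E" using nbhd_blocks_nonempty[OF assms] by blast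
  then have "K \<noteq> {}" using coarse_cell(2) nbhd_blocksD by fastforce
  then show ?thesis using assms K by (auto simp: neighbors_def nbhd_def)
qed

lemma neighbor_sum_in_Vsnap: "z \<in> Vsnap_sum M (neighbors E) \<Longrightarrow> z \<in> Vsnap M"
  unfolding Vsnap_def using Vsnap_sum_mono[OF neighbors_subset] by (rule subsetD)

lemma neighbor_sum_poly: "z \<in> Vsnap_sum M (neighbors E) \<Longrightarrow> z \<in> poly_fields"
  using Vsnap_sum_poly[OF neighbors_subset] by (rule subsetD)

lemma loc_neighbor_sum: "E \<in> coarse_faces M \<Longrightarrow> v \<in> Vsnap_loc M E \<Longrightarrow> v \<in> Vsnap_sum M (neighbors E)"
  using Vsnap_loc_subset_sum[OF self_neighbor] by (rule subsetD)

lemma subspace_fluxless: "subspace (fluxless E)"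
  unfolding fluxless_def
  by (auto simp: subspace_def coef_add coef_scaleR coef_zero
      intro: subspace_0 subspace_add subspace_scale subspace_Vsnap_sum)

lemma fluxless_poly: "fluxless E \<subseteq> poly_fields"
  using neighbor_sum_poly by (auto simp: fluxless_def)

lemma fluxless_finite_span: "\<exists>B. finite B \<and> B \<subseteq> fluxless E \<and> span B = fluxless E"
proof -
  obtain B where B: "B \<subseteq> fluxless E" "independent B" "fluxless E \<subseteq> span B"
    using maximal_independent_subset[of "fluxless E"] by metis
  have "B \<subseteq> span (\<Union>E\<in>neighbors E. snap M E ` fine_faces_in M E)"
    using B(1) by (auto simp: fluxless_def Vsnap_sum_eq)
  moreover have "finite (\<Union>E\<in>neighbors E. snap M E ` fine_faces_in M E)"
    using finite_subset[OF neighbors_subset finite_coarse_faces] by simp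
  ultimately have "finite B" using independent_span_bound[OF _ B(2)] by simp
  moreover have "span B = fluxless E"
    using span_minimal[OF B(1) subspace_fluxless] B(3) by (rule equalityI)
  ultimately show ?thesis using B(1) by (intro exI[of _ B] conjI)
qed

lemma is_min_ext_iff:
  assumes E: "E \<in> coarse_faces M" and v: "v \<in> Vsnap_loc M E"
  shows "is_min_ext M E v u \<longleftrightarrow>
    u \<in> Vsnap_sum M (neighbors E) \<and> (\<forall>e\<in>fine_faces_in M E. coef M E e u = coef M E e v) \<and>
    (\<forall>z\<in>Vsnap_sum M (neighbors E). (\<forall>e\<in>fine_faces_in M E. coef M E e z = coef M E e v) \<longrightarrow>
        kprod M (nbhd M E) u u \<le> kprod M (nbhd M E) z z)"
proof -
  have vV: "v \<in> Vsnap M" using Vsnap_loc_subset[OF E] v by (rule subsetD)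
  have "(\<forall>e\<in>fine_faces_in M E. \<forall>x\<in>e. ncomp M z (fnormal M E) e x = ncomp M v (fnormal M E) e x)
      \<longleftrightarrow> (\<forall>e\<in>fine_faces_in M E. coef M E e z = coef M E e v)"
    if z: "z \<in> Vsnap_sum M (neighbors E)" for z
  proof -
    have "(\<forall>x\<in>e. ncomp M z (fnormal M E) e x = ncomp M v (fnormal M E) e x)
      \<longleftrightarrow> coef M E e z = coef M E e v" if e: "e \<in> fine_faces_in M E" for e
      using ncomp_eq_coef[OF neighbor_sum_in_Vsnap[OF z] E e] ncomp_eq_coef[OF vV E e]
        fine_facet(3)[OF e] by auto
    then show ?thesis by simp
  qed
  then have "{z \<in> Vsnap_sum M (neighbors E). \<forall>e\<in>fine_faces_in M E. \<forall>x\<in>e.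
        ncomp M z (fnormal M E) e x = ncomp M v (fnormal M E) e x} =
      {z \<in> Vsnap_sum M (neighbors E). \<forall>e\<in>fine_faces_in M E. coef M E e z = coef M E e v}"
    by (intro Collect_cong conj_cong refl)
  then show ?thesis
    unfolding is_min_ext_def neighbors_def[symmetric] Let_def L2_norm_def
    by (simp add: conj_assoc Ball_def imp_conjL)
qed

lemma min_ext_exists:
  assumes E: "E \<in> coarse_faces M" and v: "v \<in> Vsnap_loc M E"
  shows "\<exists>u. is_min_ext M E v u \<and> (\<forall>z\<in>fluxless E. kprod M (nbhd M E) u z = 0)"
proof -
  obtain B where B: "finite B" "B \<subseteq> fluxless E" "span B = fluxless E"
    using fluxless_finite_span[of E] by (elim exE conjE)
  note vp = loc_poly[OF E v]
  obtain w where w: "w \<in> fluxless E" "\<And>z. z \<in> fluxless E \<Longrightarrow> kprod M (nbhd M E) (v - w) z = 0"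
    using energy.projection[OF B(1) order.trans[OF B(2) fluxless_poly] vp, of "nbhd M E"]
    unfolding B(3) by (elim bexE) simp
  define u where "u = v - w"
  have wX: "w \<in> Vsnap_sum M (neighbors E)" "\<And>e. e \<in> fine_faces_in M E \<Longrightarrow> coef M E e w = 0"
    using w(1) by (simp_all add: fluxless_def)
  have uX: "u \<in> Vsnap_sum M (neighbors E)"
    unfolding u_def using subspace_diff[OF subspace_Vsnap_sum loc_neighbor_sum[OF E v] wX(1)] .
  have uc: "coef M E e u = coef M E e v" if "e \<in> fine_faces_in M E" for e
    using wX(2)[OF that] by (simp add: u_def coef_diff)
  have orth: "kprod M (nbhd M E) u z = 0" if "z \<in> fluxless E" for z
    unfolding u_def by (rule w(2)[OF that])
  have "kprod M (nbhd M E) u u \<le> kprod M (nbhd M E) z z"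
    if z: "z \<in> Vsnap_sum M (neighbors E)" "\<forall>e\<in>fine_faces_in M E. coef M E e z = coef M E e v" for z
  proof -
    have "z - u \<in> fluxless E"
      using z uc subspace_diff[OF subspace_Vsnap_sum z(1) uX] by (simp add: fluxless_def coef_diff)
    moreover have p: "u \<in> poly_fields" "z - u \<in> poly_fields"
      using neighbor_sum_poly uX z(1) subspace_diff[OF subspace_poly_fields] by metis+
    ultimately show ?thesis
      using energy.square_add[OF p, of "nbhd M E"] orth[of "z - u"]
        energy.nonneg[OF p(2), of "nbhd M E"] by simp
  qed
  then have "is_min_ext M E v u" unfolding is_min_ext_iff[OF E v] using uX uc by simp
  then show ?thesis using orth by (intro exI[of _ u]) simp
qed

text \<open>Minimality amounts to orthogonality to the fluxless fields, for every minimizer and hence for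
  the selected one.\<close>

lemma min_ext_props:
  assumes E: "E \<in> coarse_faces M" and v: "v \<in> Vsnap_loc M E"
  shows "min_ext M E v \<in> Vsnap_sum M (neighbors E)" "min_ext M E v \<in> poly_fields"
    and "e \<in> fine_faces_in M E \<Longrightarrow> coef M E e (min_ext M E v) = coef M E e v"
    and "\<lbrakk>z \<in> Vsnap_sum M (neighbors E); \<And>e. e \<in> fine_faces_in M E \<Longrightarrow> coef M E e z = coef M E e v\<rbrakk>
      \<Longrightarrow> kprod M (nbhd M E) (min_ext M E v) (min_ext M E v) \<le> kprod M (nbhd M E) z z"
    and "z \<in> fluxless E \<Longrightarrow> kprod M (nbhd M E) (min_ext M E v) z = 0"
proof -
  define u where "u = min_ext M E v"
  obtain u0 where u0: "is_min_ext M E v u0" "\<And>z. z \<in> fluxless E \<Longrightarrow> kprod M (nbhd M E) u0 z = 0"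
    using min_ext_exists[OF E v] by (elim exE conjE) simp
  have u: "is_min_ext M E v u" unfolding u_def min_ext_def by (rule someI[of "is_min_ext M E v", OF u0(1)])
  have uX: "u \<in> Vsnap_sum M (neighbors E)" "\<And>e. e \<in> fine_faces_in M E \<Longrightarrow> coef M E e u = coef M E e v"
    and min: "\<And>z. z \<in> Vsnap_sum M (neighbors E) \<Longrightarrow>
      (\<forall>e\<in>fine_faces_in M E. coef M E e z = coef M E e v) \<Longrightarrow> kprod M (nbhd M E) u u \<le> kprod M (nbhd M E) z z"
    using u unfolding is_min_ext_iff[OF E v] by simp_all
  have u0X: "u0 \<in> Vsnap_sum M (neighbors E)" "\<And>e. e \<in> fine_faces_in M E \<Longrightarrow> coef M E e u0 = coef M E e v"
    using u0(1) unfolding is_min_ext_iff[OF E v] by simp_all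
  show "min_ext M E v \<in> Vsnap_sum M (neighbors E)"
    "e \<in> fine_faces_in M E \<Longrightarrow> coef M E e (min_ext M E v) = coef M E e v"
    "\<lbrakk>z \<in> Vsnap_sum M (neighbors E); \<And>e. e \<in> fine_faces_in M E \<Longrightarrow> coef M E e z = coef M E e v\<rbrakk>
      \<Longrightarrow> kprod M (nbhd M E) (min_ext M E v) (min_ext M E v) \<le> kprod M (nbhd M E) z z"
    using uX min by (simp_all add: u_def)
  have p: "u \<in> poly_fields" "u0 \<in> poly_fields" using uX(1) u0X(1) by (simp_all add: neighbor_sum_poly)
  then show "min_ext M E v \<in> poly_fields" by (simp add: u_def)
  define d where "d = u - u0"
  have d: "d \<in> fluxless E"
    using uX u0X subspace_diff[OF subspace_Vsnap_sum uX(1) u0X(1)] by (simp add: d_def fluxless_def coef_diff)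
  have dp: "d \<in> poly_fields" using d fluxless_poly by (rule subsetD[rotated])
  have ud: "u = u0 + d" by (simp add: d_def)
  have "kprod M (nbhd M E) u u = kprod M (nbhd M E) u0 u0 + kprod M (nbhd M E) d d"
    unfolding ud using energy.square_add[OF p(2) dp, of "nbhd M E"] u0(2)[OF d] by simp
  moreover have "kprod M (nbhd M E) u u \<le> kprod M (nbhd M E) u0 u0" using min u0X by simp
  ultimately have d0: "kprod M (nbhd M E) d d = 0"
    using energy.nonneg[OF dp, of "nbhd M E"] by linarith
  show "kprod M (nbhd M E) (min_ext M E v) z = 0" if z: "z \<in> fluxless E"
  proof -
    have zp: "z \<in> poly_fields" using z fluxless_poly by (rule subsetD[rotated])
    have "kprod M (nbhd M E) u z = kprod M (nbhd M E) u0 z + kprod M (nbhd M E) d z"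
      unfolding ud by (rule energy.add_left[OF p(2) dp zp])
    then show ?thesis using u0(2)[OF z] energy.null_left[OF dp zp d0] by (simp add: u_def)
  qed
qed

text \<open>A field orthogonal to the fluxless ones is determined by its trace on the face, up to fields
  without energy; hence the minimal extension is linear as far as the energy can see.\<close>

lemma energy_extension_unique:
  assumes u: "u \<in> Vsnap_sum M (neighbors E)" "u' \<in> Vsnap_sum M (neighbors E)"
    and c: "\<And>e. e \<in> fine_faces_in M E \<Longrightarrow> coef M E e u = coef M E e u'"
    and o: "\<And>z. z \<in> fluxless E \<Longrightarrow> kprod M (nbhd M E) u z = 0"
      "\<And>z. z \<in> fluxless E \<Longrightarrow> kprod M (nbhd M E) u' z = 0"
    and w: "w \<in> poly_fields"
  shows "kprod M (nbhd M E) u w = kprod M (nbhd M E) u' w"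
proof -
  have d: "u - u' \<in> fluxless E"
    using subspace_diff[OF subspace_Vsnap_sum u] c by (simp add: fluxless_def coef_diff)
  have p: "u \<in> poly_fields" "u' \<in> poly_fields" "u - u' \<in> poly_fields"
    using u d fluxless_poly neighbor_sum_poly by (simp_all add: subset_iff)
  have "kprod M (nbhd M E) (u - u') (u - u') = 0"
    using energy.diff_left[OF p(1,2,3)] o[OF d] by simp
  then have "kprod M (nbhd M E) (u - u') w = 0" by (rule energy.null_left[OF p(3) w])
  then show ?thesis using energy.diff_left[OF p(1,2) w] by simp
qed

lemma a_form_SP2_psd:
  assumes E: "E \<in> coarse_faces M"
  shows "psd_form (Vsnap_loc M E) (a_form SP2 M E)"
proof
  note P = min_ext_props[OF E]
  fix x y z :: "'a vfield" and c :: real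
  show "subspace (Vsnap_loc M E)" by simp
  show "a_form SP2 M E x y = a_form SP2 M E y x" by (simp add: kprod_def inner_commute)
  assume x: "x \<in> Vsnap_loc M E"
  show "0 \<le> a_form SP2 M E x x" using energy.nonneg[OF P(2)[OF x]] by simp
  assume z: "z \<in> Vsnap_loc M E"
  have cx: "c *\<^sub>R x \<in> Vsnap_loc M E" using subspace_scale[OF subspace_Vsnap_loc x] .
  have zp: "w \<in> poly_fields" if "w \<in> fluxless E" for w using that fluxless_poly by (rule subsetD[rotated])
  have "kprod M (nbhd M E) (min_ext M E (c *\<^sub>R x)) (min_ext M E z) =
      kprod M (nbhd M E) (c *\<^sub>R min_ext M E x) (min_ext M E z)"
  proof (rule energy_extension_unique)
    show "c *\<^sub>R min_ext M E x \<in> Vsnap_sum M (neighbors E)"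
      using subspace_scale[OF subspace_Vsnap_sum P(1)[OF x]] .
  qed (simp_all add: P cx x z zp coef_scaleR energy.scale_left)
  then show "a_form SP2 M E (c *\<^sub>R x) z = c * a_form SP2 M E x z"
    by (simp add: energy.scale_left P x z)
  assume y: "y \<in> Vsnap_loc M E"
  have xy: "x + y \<in> Vsnap_loc M E" using subspace_add[OF subspace_Vsnap_loc x y] .
  have "kprod M (nbhd M E) (min_ext M E (x + y)) (min_ext M E z) =
      kprod M (nbhd M E) (min_ext M E x + min_ext M E y) (min_ext M E z)"
  proof (rule energy_extension_unique)
    show "min_ext M E x + min_ext M E y \<in> Vsnap_sum M (neighbors E)"
      using subspace_add[OF subspace_Vsnap_sum P(1)[OF x] P(1)[OF y]] .
  qed (simp_all add: P xy x y z zp coef_add energy.add_left)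
  then show "a_form SP2 M E (x + y) z = a_form SP2 M E x z + a_form SP2 M E y z"
    by (simp add: energy.add_left P x y z)
qed

lemma a_form_SP2_definite:
  assumes E: "E \<in> coarse_faces M" and x: "x \<in> Vsnap_loc M E" and 0: "a_form SP2 M E x x = 0"
  shows "x = 0"
proof -
  note P = min_ext_props[OF E x]
  have "coef M E e x = 0" if e: "e \<in> fine_faces_in M E" for e
    using coef_zero_of_energy[OF P(2) _ E e] P(3)[OF e] 0 by simp
  then have "face_part M E x = 0" by (rule face_part_eq_0)
  then show ?thesis using face_part_loc[OF E x] by simp
qed

text \<open>A snapshot field itself competes in the minimal extension of its part on the face.\<close>

lemma a_form_SP2_le:
  assumes E: "E \<in> coarse_faces M" and v: "v \<in> Vsnap M"
  shows "a_form SP2 M E (face_part M E v) (face_part M E v) \<le> kprod M (nbhd M E) v v"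
proof -
  define z where "z = (\<Sum>E'\<in>neighbors E. face_part M E' v)"
  have z: "z \<in> Vsnap_sum M (neighbors E)"
    unfolding z_def
    by (intro subspace_sum subspace_Vsnap_sum subsetD[OF Vsnap_loc_subset_sum face_part_in_loc])
  have fin: "finite (neighbors E)" by (rule finite_subset[OF neighbors_subset finite_coarse_faces])
  have "coef M E e z = coef M E e (face_part M E v)" if e: "e \<in> fine_faces_in M E" for e
  proof -
    have "coef M E e z = (\<Sum>E'\<in>neighbors E. if E = E' then coef M E e v else 0)"
      unfolding z_def coef_sum
      by (intro sum.cong refl coef_face_part E e subsetD[OF neighbors_subset])
    then show ?thesis using fin self_neighbor[OF E] coef_face_part[OF E e E] by simp
  qed
  then have "a_form SP2 M E (face_part M E v) (face_part M E v) \<le> kprod M (nbhd M E) z z"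
    using min_ext_props(4)[OF E face_part_in_loc z] by simp
  also have "kprod M (nbhd M E) z z = kprod M (nbhd M E) v v"
  proof (rule kprod_cong)
    fix \<tau> assume \<tau>: "\<tau> \<in> cells M (nbhd M E)"
    have "face_part M E' v \<tau> = 0" if E': "E' \<in> coarse_faces M - neighbors E" for E'
    proof (rule face_part_outside)
      show "E' \<in> coarse_faces M" using E' by simp
      have "\<tau> \<noteq> {}" using fine_cell(2)[OF cells_fine[OF \<tau>]] by auto
      then show "\<tau> \<notin> cells M (nbhd M E')"
        using E' \<tau> by (auto simp: neighbors_def cells_def)
    qed
    then have "(\<Sum>E'\<in>neighbors E. face_part M E' v \<tau>) = (\<Sum>E'\<in>coarse_faces M. face_part M E' v \<tau>)"
      using neighbors_subset by (intro sum.mono_neutral_left) auto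
    moreover have ev: "(\<Sum>i\<in>I. f i) \<tau> = (\<Sum>i\<in>I. f i \<tau>)" for I and f :: "'a set \<Rightarrow> 'a vfield"
      by (induction I rule: infinite_finite_induct) simp_all
    ultimately show "z \<tau> = v \<tau>"
      using arg_cong[OF Vsnap_expansion[OF v], of "\<lambda>w. w \<tau>"] unfolding z_def by simp
    then show "z \<tau> = v \<tau>" .
  qed
  finally show ?thesis .
qed


section \<open>Residuals on neighborhoods\<close>

lemma residual_add:
  assumes "u \<in> poly_fields" "p \<in> Q_space M" "v \<in> Vsnap M" "w \<in> Vsnap M"
  shows "residual M u p A (v + w) = residual M u p A v + residual M u p A w"
  unfolding residual_def
  using energy.add_right[OF subsetD[OF Vsnap_poly assms(3)] subsetD[OF Vsnap_poly assms(4)] assms(1)]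
    sprod_Div_add[OF assms(3,4,2)] by simp

lemma residual_scaleR:
  assumes "u \<in> poly_fields" "p \<in> Q_space M" "v \<in> Vsnap M"
  shows "residual M u p A (c *\<^sub>R v) = c * residual M u p A v"
  unfolding residual_def
  using energy.scale_right[OF subsetD[OF Vsnap_poly assms(3)] assms(1)] sprod_Div_scaleR[OF assms(3,2)]
  by (simp add: right_diff_distrib)

lemma residual_zero:
  assumes "u \<in> poly_fields" "p \<in> Q_space M" shows "residual M u p A 0 = 0"
  using residual_scaleR[OF assms subspace_0[OF subspace_Vsnap], of A 0] by simp

lemma residual_sum:
  assumes "u \<in> poly_fields" "p \<in> Q_space M" "\<And>i. i \<in> I \<Longrightarrow> f i \<in> Vsnap M"
  shows "residual M u p A (sum f I) = (\<Sum>i\<in>I. residual M u p A (f i))"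
  using assms(3)
proof (induction I rule: infinite_finite_induct)
  case (insert i I)
  then have fI: "f i \<in> Vsnap M" "sum f I \<in> Vsnap M" by (auto intro: subspace_sum[OF subspace_Vsnap])
  have IH: "residual M u p A (sum f I) = (\<Sum>i\<in>I. residual M u p A (f i))"
    using insert.IH insert.prems by blast
  show ?case
    by (simp only: sum.insert[OF insert.hyps] residual_add[OF assms(1,2) fI] IH)
qed (simp_all only: not_False_eq_True sum.infinite sum.empty residual_zero[OF assms(1,2)])

lemma residual_restrict:
  assumes "B \<subseteq> A" "\<And>\<tau>. \<tau> \<notin> cells M B \<Longrightarrow> w \<tau> = 0"
  shows "residual M u p A w = residual M u p B w"
  unfolding residual_def using kprod_restrict[OF assms] sprod_restrict[OF assms] by simp

text \<open>The supremum in the dual norm is over a bounded set, so it is an upper bound.\<close>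

lemma nbhd_residual_bound:
  assumes u: "u \<in> poly_fields" and p: "p \<in> Q_space M"
    and E: "E \<in> coarse_faces M" and v: "v \<in> Vsnap_loc M E"
  shows "\<bar>residual M u p (nbhd M E) v\<bar> \<le> nbhd_res_norm SP2 M u p E * L2_norm M (nbhd M E) v"
proof (cases "v = 0")
  case True
  then show ?thesis
    using residual_zero[OF u p] energy.zero_left[OF energy.mem(1)] by (simp add: L2_norm_def)
next
  case False
  interpret snap: psd_form "Vsnap M" "kprod M (nbhd M E)"
    by (rule psd_form_subset[OF kprod_psd subspace_Vsnap Vsnap_poly])
  have S: "finite (snap M E ` fine_faces_in M E)" "snap M E ` fine_faces_in M E \<subseteq> Vsnap M"
    using subsetD[OF Vsnap_loc_subset[OF E] snap_in_loc] by auto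
  obtain C where C: "\<And>x. x \<in> Vsnap_loc M E \<Longrightarrow> \<bar>residual M u p (nbhd M E) x\<bar> \<le> C * L2_norm M (nbhd M E) x"
    using snap.bounded_functional[OF S, of "residual M u p (nbhd M E)"]
      energy_loc_definite[OF E] residual_add[OF u p] residual_scaleR[OF u p]
    unfolding Vsnap_loc_def[symmetric] L2_norm_def by blast
  have pos: "0 < L2_norm M (nbhd M E) x" if x: "x \<in> Vsnap_loc M E - {0}" for x
    using energy_loc_definite[OF E, of x] energy.nonneg[OF loc_poly[OF E], of x "nbhd M E"] x
    by (auto simp: L2_norm_def less_le)
  have bdd: "bdd_above ((\<lambda>x. \<bar>residual M u p (nbhd M E) x\<bar> / snap_norm SP2 M E x) ` (Vsnap_loc M E - {0}))"
  proof (rule bdd_aboveI2)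
    fix x assume x: "x \<in> Vsnap_loc M E - {0}"
    show "\<bar>residual M u p (nbhd M E) x\<bar> / snap_norm SP2 M E x \<le> C"
      using C[of x] pos[OF x] x by (simp add: divide_le_eq)
  qed
  have vin: "v \<in> Vsnap_loc M E - {0}" using v False by simp
  have "\<bar>residual M u p (nbhd M E) v\<bar> / snap_norm SP2 M E v \<le> nbhd_res_norm SP2 M u p E"
    unfolding nbhd_res_norm_def by (rule cSUP_upper[OF vin bdd])
  then show ?thesis using pos[OF vin] by (simp add: divide_le_eq)
qed

end

context gmsfem
begin

section \<open>The a posteriori bound for the second spectral problem\<close>

lemma eigensystem_truncation:
  assumes E: "E \<in> coarse_faces M" and eig: "eigensystem SP2 M E lam \<phi>"
    and x: "x \<in> Vsnap_loc M E" and l: "l \<le> num_snap M E"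
  shows "\<exists>w\<in>span (\<phi> ` {1..l}).
     kprod M (nbhd M E) (x - w) (x - w) \<le> inv_next_eigval M E lam l * a_form SP2 M E x x
     \<and> 0 \<le> inv_next_eigval M E lam l"
proof -
  let ?n = "num_snap M E"
  have 1: "\<forall>j\<in>{1..?n}. \<phi> j \<in> Vsnap_loc M E \<and>
        (\<forall>w\<in>Vsnap_loc M E. a_form SP2 M E (\<phi> j) w = lam j * s_form SP2 M E (\<phi> j) w)"
    and inj: "inj_on \<phi> {1..?n}" and ind: "independent (\<phi> ` {1..?n})"
    and mono: "mono_on {1..?n} lam"
    by (insert eig, unfold eigensystem_def, elim conjE, assumption)+
  have \<phi>: "\<phi> j \<in> Vsnap_loc M E"
    and ae: "w \<in> Vsnap_loc M E \<Longrightarrow> a_form SP2 M E (\<phi> j) w = lam j * kprod M (nbhd M E) (\<phi> j) w"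
    if "j \<in> {1..?n}" for j w
    using bspec[OF 1 that] by simp_all
  have sp: "span (\<phi> ` {1..?n}) = Vsnap_loc M E"
    unfolding Vsnap_loc_def
  proof (rule independent_card_span[OF ind])
    show "\<phi> ` {1..?n} \<subseteq> span (snap M E ` fine_faces_in M E)"
      using \<phi> unfolding Vsnap_loc_def by auto
    show "card (snap M E ` fine_faces_in M E) \<le> card (\<phi> ` {1..?n})"
      using card_image[OF inj] card_image_le[of "fine_faces_in M E" "snap M E"]
      by (simp add: num_snap_def)
  qed simp
  have nz: "\<phi> j \<noteq> 0" if "j \<in> {1..?n}" for j
  proof
    assume "\<phi> j = 0"
    then have "0 \<in> \<phi> ` {1..?n}" using that by (metis imageI)
    then show False using ind dependent_zero by metis
  qed
  have LP: "Vsnap_loc M E \<subseteq> poly_fields" using loc_poly[OF E] by (rule subsetI)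
  show ?thesis
    unfolding inv_next_eigval_def
    by (rule spectral_truncation[OF psd_form_subset[OF kprod_psd subspace_Vsnap_loc LP]
          a_form_SP2_psd[OF E] sp nz ae mono energy_loc_definite[OF E] a_form_SP2_definite[OF E] x l])
qed

text \<open>As the residual vanishes on the first \<open>l\<close> eigenfunctions, only the remainder beyond them counts.
  The absolute value around the dual norm makes its sign irrelevant.\<close>

lemma nbhd_residual_estimate:
  assumes u: "u \<in> poly_fields" and p: "p \<in> Q_space M"
    and E: "E \<in> coarse_faces M" and eig: "eigensystem SP2 M E lam \<phi>" and l: "l \<le> num_snap M E"
    and orth: "\<And>j. j \<in> {1..l} \<Longrightarrow> residual M u p (nbhd M E) (\<phi> j) = 0"
    and d: "d \<in> Vsnap M"
  shows "\<bar>residual M u p (nbhd M E) (face_part M E d)\<bar>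
      \<le> \<bar>nbhd_res_norm SP2 M u p E\<bar> * sqrt (inv_next_eigval M E lam l) * L2_norm M (nbhd M E) d"
    and "0 \<le> inv_next_eigval M E lam l"
proof -
  let ?x = "face_part M E d" and ?i = "inv_next_eigval M E lam l" and ?R = "residual M u p (nbhd M E)"
  have x: "?x \<in> Vsnap_loc M E" by (rule face_part_in_loc)
  obtain w where w: "w \<in> span (\<phi> ` {1..l})"
    and le: "kprod M (nbhd M E) (?x - w) (?x - w) \<le> ?i * a_form SP2 M E ?x ?x" and i0: "0 \<le> ?i"
    using eigensystem_truncation[OF E eig x l] by (elim bexE conjE)
  show "0 \<le> ?i" by (fact i0)
  have "\<forall>j\<in>{1..num_snap M E}. \<phi> j \<in> Vsnap_loc M E \<and>
        (\<forall>w\<in>Vsnap_loc M E. a_form SP2 M E (\<phi> j) w = lam j * s_form SP2 M E (\<phi> j) w)"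
    by (insert eig, unfold eigensystem_def, elim conjE, assumption)
  then have \<phi>: "\<phi> j \<in> Vsnap_loc M E" if "j \<in> {1..l}" for j using that l by simp
  have Vl: "v \<in> Vsnap M" if "v \<in> Vsnap_loc M E" for v using Vsnap_loc_subset[OF E] that by (rule subsetD)
  obtain c where c: "w = (\<Sum>j\<in>{1..l}. c j *\<^sub>R \<phi> j)"
    using span_image_sum[OF finite_atLeastAtMost w] by (elim exE)
  have cV: "c j *\<^sub>R \<phi> j \<in> Vsnap_loc M E" if "j \<in> {1..l}" for j
    by (rule subspace_scale[OF subspace_Vsnap_loc \<phi>[OF that]])
  have wl: "w \<in> Vsnap_loc M E" unfolding c by (rule subspace_sum[OF subspace_Vsnap_loc cV])
  have "?R w = (\<Sum>j\<in>{1..l}. ?R (c j *\<^sub>R \<phi> j))"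
    unfolding c by (rule residual_sum[OF u p Vl[OF cV]])
  also have "\<dots> = 0"
    using residual_scaleR[OF u p Vl[OF \<phi>]] orth by (intro sum.neutral) simp
  finally have Rw: "?R w = 0" .
  have y: "?x - w \<in> Vsnap_loc M E" by (rule subspace_diff[OF subspace_Vsnap_loc x wl])
  have "?R ?x = ?R ((?x - w) + w)" by simp
  also have "\<dots> = ?R (?x - w)" using residual_add[OF u p Vl[OF y] Vl[OF wl]] Rw by simp
  finally have "\<bar>?R ?x\<bar> \<le> nbhd_res_norm SP2 M u p E * L2_norm M (nbhd M E) (?x - w)"
    using nbhd_residual_bound[OF u p E y] by simp
  also have "\<dots> \<le> \<bar>nbhd_res_norm SP2 M u p E\<bar> * L2_norm M (nbhd M E) (?x - w)"
    using energy.nonneg[OF loc_poly[OF E y]] by (intro mult_right_mono) (simp_all add: L2_norm_def)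
  also have "\<dots> \<le> \<bar>nbhd_res_norm SP2 M u p E\<bar> * (sqrt ?i * L2_norm M (nbhd M E) d)"
  proof (rule mult_left_mono)
    have "?i * a_form SP2 M E ?x ?x \<le> ?i * kprod M (nbhd M E) d d"
      using a_form_SP2_le[OF E d] i0 by (rule mult_left_mono)
    then have "L2_norm M (nbhd M E) (?x - w) \<le> sqrt (?i * kprod M (nbhd M E) d d)"
      unfolding L2_norm_def using le by (intro real_sqrt_le_mono) linarith
    then show "L2_norm M (nbhd M E) (?x - w) \<le> sqrt ?i * L2_norm M (nbhd M E) d"
      by (simp add: L2_norm_def real_sqrt_mult)
  qed simp
  finally show "\<bar>?R ?x\<bar> \<le> \<bar>nbhd_res_norm SP2 M u p E\<bar> * sqrt ?i * L2_norm M (nbhd M E) d"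
    by (simp add: mult.assoc)
qed

text \<open>A fine cell lies in one coarse block, hence in the neighborhoods of at most as many faces as
  that block has.\<close>

lemma nbhd_overlap:
  "(\<Sum>E\<in>coarse_faces M. kprod M (nbhd M E) v v) \<le> real (max_faces M) * kprod M (closure (Dom M)) v v"
proof -
  define q where "q \<tau> = (LINT x:\<tau>|lebesgue. inverse (perm M x) * (v \<tau> x \<bullet> v \<tau> x))" for \<tau>
  have k: "kprod M A v v = (\<Sum>\<tau>\<in>cells M A. q \<tau>)" for A by (simp add: kprod_def integ_def q_def)
  have q0: "0 \<le> q \<tau>" if "\<tau> \<in> fine_mesh M" for \<tau> unfolding q_def by (rule cell_energy_nonneg[OF that])
  have "(\<Sum>E\<in>coarse_faces M. kprod M (nbhd M E) v v)
      = (\<Sum>E\<in>coarse_faces M. \<Sum>\<tau>\<in>{\<tau> \<in> fine_mesh M. \<tau> \<in> cells M (nbhd M E)}. q \<tau>)"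
    unfolding k by (intro sum.cong refl) (auto simp: cells_def)
  also have "\<dots> = (\<Sum>\<tau>\<in>fine_mesh M. \<Sum>E\<in>{E \<in> coarse_faces M. \<tau> \<in> cells M (nbhd M E)}. q \<tau>)"
    by (rule sum.swap_restrict[OF finite_coarse_faces finite_fine_mesh])
  also have "\<dots> \<le> (\<Sum>\<tau>\<in>fine_mesh M. real (max_faces M) * q \<tau>)"
  proof (rule sum_mono)
    fix \<tau> assume \<tau>: "\<tau> \<in> fine_mesh M"
    obtain K where K: "K \<in> coarse_mesh M" "\<tau> \<subseteq> K" by (rule block_ex[OF \<tau>])
    have "E facet_of K" if E: "\<tau> \<in> cells M (nbhd M E)" for E
    proof -
      obtain L where L: "L \<in> nbhd_blocks M E" "\<tau> \<in> cells M L" using E unfolding cells_nbhd by (elim bexE)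
      then have "L = K" using block_unique[OF \<tau> _ _ K] nbhd_blocksD[OF L(1)] by (simp add: cells_def)
      then show ?thesis using nbhd_blocksD[OF L(1)] by simp
    qed
    then have "{E \<in> coarse_faces M. \<tau> \<in> cells M (nbhd M E)} \<subseteq> {F. F facet_of K}" by blast
    then have "card {E \<in> coarse_faces M. \<tau> \<in> cells M (nbhd M E)} \<le> card {F. F facet_of K}"
      by (rule card_mono[OF finite_polytope_facets[OF coarse_cell(1)[OF K(1)]]])
    also have "\<dots> \<le> max_faces M"
      unfolding max_faces_def using finite_coarse_mesh K(1) by (intro Max_ge) auto
    finally show "(\<Sum>E\<in>{E \<in> coarse_faces M. \<tau> \<in> cells M (nbhd M E)}. q \<tau>) \<le> real (max_faces M) * q \<tau>"
      using q0[OF \<tau>] by (simp add: mult_right_mono)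
  qed
  also have "\<dots> = real (max_faces M) * kprod M (closure (Dom M)) v v"
    by (simp add: k cells_Dom sum_distrib_left)
  finally show ?thesis .
qed

lemma a_posteriori_SP2:
  assumes u: "u \<in> poly_fields" and p: "p \<in> Q_space M" and d: "d \<in> Vsnap M" and df: "div_free M d"
    and eig: "\<And>E. E \<in> coarse_faces M \<Longrightarrow> eigensystem SP2 M E (lam E) (\<phi> E)"
    and l: "\<And>E. E \<in> coarse_faces M \<Longrightarrow> l E \<le> num_snap M E"
    and bd: "\<And>E. E \<in> coarse_faces M \<Longrightarrow> card (nbhd_blocks M E) \<noteq> 2 \<Longrightarrow> face_part M E d = 0"
    and orth: "\<And>E j. E \<in> coarse_faces M \<Longrightarrow> card (nbhd_blocks M E) = 2 \<Longrightarrow> j \<in> {1..l E} \<Longrightarrow>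
        residual M u p (nbhd M E) (\<phi> E j) = 0"
    and eq: "kprod M (closure (Dom M)) d d = - kprod M (closure (Dom M)) u d"
  shows "(L2_norm M (closure (Dom M)) d)\<^sup>2 \<le> real (max_faces M) * error_indicator SP2 M lam l u p"
proof -
  let ?D = "closure (Dom M)"
  define X where "X = kprod M ?D d d"
  define \<rho> where "\<rho> E = nbhd_res_norm SP2 M u p E" for E
  define \<iota> where "\<iota> E = inv_next_eigval M E (lam E) (l E)" for E
  define N where "N = real (max_faces M)"
  note dp = subsetD[OF Vsnap_poly d]
  have pV: "face_part M E d \<in> Vsnap M" if "E \<in> coarse_faces M" for E
    using Vsnap_loc_subset[OF that] face_part_in_loc by (rule subsetD)
  have X0: "0 \<le> X" unfolding X_def by (rule energy.nonneg[OF dp])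
  have \<iota>0: "0 \<le> \<iota> E" if "E \<in> coarse_faces M" for E
    using eigensystem_truncation[OF that eig[OF that] subspace_0[OF subspace_Vsnap_loc] l[OF that]]
    unfolding \<iota>_def by (elim bexE conjE)
  have bound: "\<bar>residual M u p (nbhd M E) (face_part M E d)\<bar>
      \<le> (\<bar>\<rho> E\<bar> * sqrt (\<iota> E)) * L2_norm M (nbhd M E) d" if E: "E \<in> coarse_faces M" for E
  proof (cases "card (nbhd_blocks M E) = 2")
    case True
    show ?thesis unfolding \<rho>_def \<iota>_def
      by (rule nbhd_residual_estimate(1)[OF u p E eig[OF E] l[OF E] orth[OF E True] d])
  next
    case False
    have "0 \<le> (\<bar>\<rho> E\<bar> * sqrt (\<iota> E)) * L2_norm M (nbhd M E) d"
      using \<iota>0[OF E] energy.nonneg[OF dp] by (simp add: L2_norm_def)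
    then show ?thesis using bd[OF E False] residual_zero[OF u p] by simp
  qed
  have "X = - residual M u p ?D d"
    using eq sprod_div_free[OF df] by (simp add: X_def residual_def)
  also have "residual M u p ?D d = (\<Sum>E\<in>coarse_faces M. residual M u p ?D (face_part M E d))"
    by (subst Vsnap_expansion[OF d], rule residual_sum[OF u p pV])
  also have "\<dots> = (\<Sum>E\<in>coarse_faces M. residual M u p (nbhd M E) (face_part M E d))"
    by (intro sum.cong refl residual_restrict[OF nbhd_subset] face_part_outside)
  also have "- \<dots> \<le> (\<Sum>E\<in>coarse_faces M. \<bar>residual M u p (nbhd M E) (face_part M E d)\<bar>)"
    unfolding sum_negf[symmetric] by (intro sum_mono) simp
  also have "\<dots> \<le> (\<Sum>E\<in>coarse_faces M. (\<bar>\<rho> E\<bar> * sqrt (\<iota> E)) * L2_norm M (nbhd M E) d)"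
    by (intro sum_mono bound)
  finally have le: "X \<le> (\<Sum>E\<in>coarse_faces M. (\<bar>\<rho> E\<bar> * sqrt (\<iota> E)) * L2_norm M (nbhd M E) d)" .
  define I where "I = (\<Sum>E\<in>coarse_faces M. (\<rho> E)\<^sup>2 * \<iota> E)"
  have I0: "0 \<le> I" unfolding I_def using \<iota>0 by (intro sum_nonneg) simp
  have "X\<^sup>2 \<le> (\<Sum>E\<in>coarse_faces M. (\<bar>\<rho> E\<bar> * sqrt (\<iota> E)) * L2_norm M (nbhd M E) d)\<^sup>2"
    using le X0 by (rule power_mono)
  also have "\<dots> \<le> (\<Sum>E\<in>coarse_faces M. (\<bar>\<rho> E\<bar> * sqrt (\<iota> E))\<^sup>2)
      * (\<Sum>E\<in>coarse_faces M. (L2_norm M (nbhd M E) d)\<^sup>2)"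
    by (rule Cauchy_Schwarz_ineq_sum)
  also have "(\<Sum>E\<in>coarse_faces M. (\<bar>\<rho> E\<bar> * sqrt (\<iota> E))\<^sup>2) = I"
    unfolding I_def using \<iota>0 by (intro sum.cong refl) (simp add: power_mult_distrib)
  also have "(\<Sum>E\<in>coarse_faces M. (L2_norm M (nbhd M E) d)\<^sup>2)
      = (\<Sum>E\<in>coarse_faces M. kprod M (nbhd M E) d d)"
    using energy.nonneg[OF dp] by (intro sum.cong refl) (simp add: L2_norm_def)
  also have "I * \<dots> \<le> I * (N * X)"
    unfolding N_def X_def using nbhd_overlap I0 by (rule mult_left_mono)
  finally have sq: "X\<^sup>2 \<le> I * (N * X)" .
  have "X \<le> N * I"
  proof (cases "X = 0")
    case True
    then show ?thesis using I0 by (simp add: N_def)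
  next
    case False
    then have "0 < X" using X0 by simp
    moreover have "X * X \<le> (N * I) * X" using sq by (simp add: power2_eq_square mult.commute mult.left_commute)
    ultimately show ?thesis by (rule mult_right_le_imp_le[rotated])
  qed
  moreover have "(L2_norm M ?D d)\<^sup>2 = X" using X0 by (simp add: L2_norm_def X_def)
  ultimately show ?thesis
    by (simp add: N_def I_def \<rho>_def \<iota>_def error_indicator_def)
qed


section \<open>Enrichment by local Riesz representatives\<close>

lemma V_region_zero_flux:
  assumes v: "v \<in> V_region M A" and e: "e \<in> bd_faces M" and x: "x \<in> e"
  shows "ncomp M v (bd_normal M e) e x = 0"
proof -
  have "V_region M A \<subseteq> {v. ncomp M v (bd_normal M e) e x = 0}"
    unfolding V_region_def Vsnap_sum_eq
  proof (rule span_minimal)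
    show "subspace {v. ncomp M v (bd_normal M e) e x = 0}"
      by (simp add: subspace_def ncomp_add ncomp_scaleR ncomp_zero)
  qed (auto intro: snap_interior_zero_flux[OF _ _ _ e x])
  then show ?thesis using v by auto
qed

lemma V_region_subset: "V_region M A \<subseteq> Vsnap M"
  unfolding V_region_def Vsnap_def by (rule Vsnap_sum_mono) auto

lemma V_region_outside:
  assumes v: "v \<in> V_region M A" and \<tau>: "\<tau> \<notin> cells M A"
  shows "v \<tau> = 0"
proof -
  have "V_region M A \<subseteq> {v. v \<tau> = 0}"
    unfolding V_region_def Vsnap_sum_eq
  proof (rule span_minimal)
    show "subspace {v. v \<tau> = 0}" by (simp add: subspace_def scaleR_fun_def zero_fun_def)
    show "(\<Union>E\<in>{E \<in> coarse_faces M. card (nbhd_blocks M E) = 2 \<and> nbhd M E \<subseteq> A}.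
        snap M E ` fine_faces_in M E) \<subseteq> {v. v \<tau> = 0}"
    proof clarify
      fix E e assume E: "E \<in> coarse_faces M" "nbhd M E \<subseteq> A" "e \<in> fine_faces_in M E"
      have "\<tau> \<notin> cells M (nbhd M E)" using \<tau> E(2) by (auto simp: cells_def)
      then show "snap M E e \<tau> = 0" by (rule snap_outside[OF E(1,3)])
    qed
  qed
  then show ?thesis using v by auto
qed

lemma Vhat_regionD: "v \<in> Vhat_region M A \<Longrightarrow> v \<in> V_region M A" "v \<in> Vhat_region M A \<Longrightarrow> div_free M v"
  by (simp_all add: Vhat_region_def)

lemma Vhat_poly: "v \<in> Vhat_region M A \<Longrightarrow> v \<in> poly_fields"
  using Vhat_regionD(1) V_region_subset Vsnap_poly by (meson subsetD)

text \<open>By the Cauchy-Schwarz inequality the dual norm of the residual is at most the norm of its Riesz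
  representative.\<close>

lemma region_res_norm_le:
  assumes \<phi>: "\<phi> \<in> Vhat_region M A"
    and riesz: "\<And>v. v \<in> Vhat_region M A \<Longrightarrow> residual M u p A v = kprod M A \<phi> v"
  shows "(region_res_norm M u p A)\<^sup>2 \<le> kprod M A \<phi> \<phi>"
proof (cases "Vhat_region M A = {0}")
  case True
  then show ?thesis using energy.nonneg[OF Vhat_poly[OF \<phi>]] by (simp add: region_res_norm_def)
next
  case False
  define n where "n = L2_norm M A \<phi>"
  let ?f = "\<lambda>v. residual M u p A v / L2_norm M A v" and ?S = "Vhat_region M A - {0}"
  have n0: "0 \<le> n" using energy.nonneg[OF Vhat_poly[OF \<phi>]] by (simp add: n_def L2_norm_def)
  have f: "\<bar>?f v\<bar> \<le> n" if v: "v \<in> ?S" for v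
  proof (cases "L2_norm M A v = 0")
    case True
    then show ?thesis using n0 by simp
  next
    case False
    have vh: "v \<in> Vhat_region M A" using v by simp
    have "0 < L2_norm M A v"
      using False energy.nonneg[OF Vhat_poly[OF vh]] by (simp add: L2_norm_def less_le)
    moreover have "\<bar>residual M u p A v\<bar> \<le> n * L2_norm M A v"
      unfolding riesz[OF vh] n_def L2_norm_def
      by (rule energy.abs_le_sqrt[OF Vhat_poly[OF \<phi>] Vhat_poly[OF vh]])
    ultimately show ?thesis by (simp add: divide_le_eq)
  qed
  obtain v where v: "v \<in> ?S" using False \<phi> by blast
  have f_le: "?f w \<le> n" "- n \<le> ?f w" if "w \<in> ?S" for w using f[OF that] by linarith+
  have bdd: "bdd_above (?f ` ?S)" using f_le(1) by (rule bdd_aboveI2)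
  have "?S \<noteq> {}" using v by blast
  then have "(SUP v\<in>?S. ?f v) \<le> n" using f_le(1) by (rule cSUP_least)
  moreover have "- n \<le> (SUP v\<in>?S. ?f v)"
    using cSUP_upper[OF v bdd] f_le(2)[OF v] by linarith
  ultimately have "\<bar>region_res_norm M u p A\<bar> \<le> n"
    unfolding region_res_norm_def using False by (simp add: abs_le_iff)
  then have "\<bar>region_res_norm M u p A\<bar>\<^sup>2 \<le> n\<^sup>2" by (intro power_mono) auto
  then show ?thesis using energy.nonneg[OF Vhat_poly[OF \<phi>]] by (simp add: n_def L2_norm_def)
qed

lemma disjoint_regions:
  assumes "interior A \<inter> interior B = {}" shows "cells M A \<inter> cells M B = {}"
proof (rule ccontr)
  assume "\<not> ?thesis"
  then obtain \<tau> where \<tau>: "\<tau> \<in> cells M A" "\<tau> \<in> cells M B" by auto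
  then have "interior \<tau> \<subseteq> interior A \<inter> interior B"
    using interior_mono by (auto simp: cells_def)
  then show False using assms fine_cell(2)[OF cells_fine[OF \<tau>(1)]] by simp
qed

text \<open>Two discrete solutions differ by an admissible test field.\<close>

lemma mixed_solution_error:
  assumes s1: "mixed_solution M gH V1 v1 p1" and s2: "mixed_solution M gH V2 v2 p2"
    and V: "V1 \<subseteq> Vsnap M" "V2 \<subseteq> Vsnap M"
  shows "v1 - v2 \<in> Vsnap M" "div_free M (v1 - v2)"
    and "e \<in> bd_faces M \<Longrightarrow> x \<in> e \<Longrightarrow> ncomp M (v1 - v2) (bd_normal M e) e x = 0"
proof -
  have a: "v1 \<in> V1" "v2 \<in> V2"
    and b: "\<forall>e\<in>bd_faces M. \<forall>x\<in>e. ncomp M v1 (bd_normal M e) e x = gH e"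
      "\<forall>e\<in>bd_faces M. \<forall>x\<in>e. ncomp M v2 (bd_normal M e) e x = gH e"
    and c: "\<forall>q\<in>Q_space M. sprod M (closure (Dom M)) (Div v1) q = sprod M (closure (Dom M)) (\<lambda>\<tau>. src M) q"
      "\<forall>q\<in>Q_space M. sprod M (closure (Dom M)) (Div v2) q = sprod M (closure (Dom M)) (\<lambda>\<tau>. src M) q"
    by (insert s1 s2, unfold mixed_solution_def, elim conjE, assumption)+
  have v: "v1 \<in> Vsnap M" "v2 \<in> Vsnap M" using a V by auto
  show d: "v1 - v2 \<in> Vsnap M" by (rule subspace_diff[OF subspace_Vsnap v])
  show "div_free M (v1 - v2)"
  proof (rule div_freeI[OF d])
    fix q assume q: "q \<in> Q_space M"
    show "sprod M (closure (Dom M)) (Div (v1 - v2)) q = 0"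
      using sprod_Div_add[OF d v(2) q, of "closure (Dom M)"] bspec[OF c(1) q] bspec[OF c(2) q] by simp
  qed
  show "ncomp M (v1 - v2) (bd_normal M e) e x = 0" if "e \<in> bd_faces M" "x \<in> e"
    unfolding ncomp_diff using bspec[OF bspec[OF b(1) that(1)] that(2)] bspec[OF bspec[OF b(2) that(1)] that(2)]
    by simp
qed

lemma mixed_solution_test:
  assumes s: "mixed_solution M gH V v p" and w: "w \<in> V" "div_free M w"
    and z: "\<And>e x. e \<in> bd_faces M \<Longrightarrow> x \<in> e \<Longrightarrow> ncomp M w (bd_normal M e) e x = 0"
  shows "kprod M (closure (Dom M)) v w = 0"
proof -
  have 1: "\<forall>w\<in>zero_flux M V. kprod M (closure (Dom M)) v w - sprod M (closure (Dom M)) (Div w) p = 0"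
    by (insert s, unfold mixed_solution_def, elim conjE, assumption)
  have "w \<in> zero_flux M V" using w(1) z by (simp add: zero_flux_def)
  from bspec[OF 1 this] show ?thesis using sprod_div_free[OF w(2)] by simp
qed

end

context gmsfem
begin

lemma div_free_add: "v \<in> poly_fields \<Longrightarrow> w \<in> poly_fields \<Longrightarrow> div_free M v \<Longrightarrow> div_free M w \<Longrightarrow> div_free M (v + w)"
  by (simp add: div_free_def Div_add)

lemma div_free_zero: "div_free M 0"
  by (simp add: div_free_def Div_zero)

lemma offline_space_subset:
  assumes off: "offline_space M l \<phi> V"
    and \<phi>: "\<And>E j. E \<in> coarse_faces M \<Longrightarrow> j \<in> {1..l E} \<Longrightarrow> \<phi> E j \<in> Vsnap M"
  shows "subspace V" "V \<subseteq> Vsnap M"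
    and "E \<in> coarse_faces M \<Longrightarrow> j \<in> {1..l E} \<Longrightarrow> \<phi> E j \<in> V"
proof -
  from off obtain \<psi> where \<psi>: "\<forall>E\<in>coarse_faces M. \<psi> E \<in> Vsnap_loc M E \<and> \<not> div_free M (\<psi> E)"
    and V: "V = span (\<Union>E\<in>coarse_faces M. \<phi> E ` {1..l E} \<union>
                    (if \<forall>j\<in>{1..l E}. div_free M (\<phi> E j) then {\<psi> E} else {}))"
    unfolding offline_space_def by (elim conjE exE)
  show "subspace V" unfolding V by (rule subspace_span)
  show "V \<subseteq> Vsnap M"
    unfolding V
  proof (rule span_minimal[OF _ subspace_Vsnap], rule UN_least)
    fix E assume E: "E \<in> coarse_faces M"
    have "\<psi> E \<in> Vsnap M" using Vsnap_loc_subset[OF E] bspec[OF \<psi> E] by (simp add: subset_iff)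
    then show "\<phi> E ` {1..l E} \<union> (if \<forall>j\<in>{1..l E}. div_free M (\<phi> E j) then {\<psi> E} else {}) \<subseteq> Vsnap M"
      using \<phi>[OF E] by auto
  qed
  show "\<phi> E j \<in> V" if "E \<in> coarse_faces M" "j \<in> {1..l E}"
    unfolding V by (rule span_base, rule UN_I[OF that(1)], rule UnI1, rule imageI[OF that(2)])
qed

lemma enrichment_subset:
  assumes en: "enrichment M u p J \<Omega> V V'" and V: "V \<subseteq> Vsnap M"
  shows "subspace V'" "V' \<subseteq> Vsnap M" "V \<subseteq> V'"
proof -
  from en obtain \<phi> where \<phi>: "\<forall>j\<in>{1..J}. \<phi> j \<in> Vhat_region M (\<Omega> j) \<and>
               (\<forall>v\<in>Vhat_region M (\<Omega> j). residual M u p (\<Omega> j) v = kprod M (\<Omega> j) (\<phi> j) v)"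
    and V': "V' = span (V \<union> \<phi> ` {1..J})"
    unfolding enrichment_def by (elim conjE exE)
  show "subspace V'" unfolding V' by (rule subspace_span)
  show "V \<subseteq> V'" unfolding V' by (rule order.trans[OF _ span_superset]) auto
  have "\<phi> j \<in> Vsnap M" if "j \<in> {1..J}" for j
    using bspec[OF \<phi> that] Vhat_regionD(1) V_region_subset by (meson subsetD)
  then show "V' \<subseteq> Vsnap M"
    unfolding V' using V by (intro span_minimal subspace_Vsnap) auto
qed

text \<open>One enrichment step removes at least the squared dual norms of the regional residuals from the
  squared error.\<close>

lemma enrichment_step:
  assumes snap: "mixed_solution M gH (Vsnap M) v p\<^sub>0"
    and s: "mixed_solution M gH V u p" and s': "mixed_solution M gH V' u' p'"
    and V: "V \<subseteq> Vsnap M"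
    and adm: "admissible_regions M J \<Omega>" and en: "enrichment M u p J \<Omega> V V'"
  shows "(L2_norm M (closure (Dom M)) (v - u'))\<^sup>2 + (\<Sum>j=1..J. (region_res_norm M u p (\<Omega> j))\<^sup>2)
         \<le> (L2_norm M (closure (Dom M)) (v - u))\<^sup>2"
proof -
  let ?D = "closure (Dom M)"
  note V' = enrichment_subset[OF en V]
  from en obtain \<phi> where \<phi>: "\<forall>j\<in>{1..J}. \<phi> j \<in> Vhat_region M (\<Omega> j) \<and>
               (\<forall>v\<in>Vhat_region M (\<Omega> j). residual M u p (\<Omega> j) v = kprod M (\<Omega> j) (\<phi> j) v)"
    and V'_eq: "V' = span (V \<union> \<phi> ` {1..J})"
    unfolding enrichment_def by (elim conjE exE)
  have \<phi>h: "\<phi> j \<in> Vhat_region M (\<Omega> j)"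
    and riesz: "w \<in> Vhat_region M (\<Omega> j) \<Longrightarrow> residual M u p (\<Omega> j) w = kprod M (\<Omega> j) (\<phi> j) w"
    if "j \<in> {1..J}" for j w
    using bspec[OF \<phi> that] by simp_all
  have \<phi>V: "\<phi> j \<in> Vsnap M" and \<phi>p: "\<phi> j \<in> poly_fields" and \<phi>d: "div_free M (\<phi> j)"
    and \<phi>r: "\<phi> j \<in> V_region M (\<Omega> j)" if "j \<in> {1..J}" for j
    using Vhat_regionD[OF \<phi>h[OF that]] subsetD[OF V_region_subset] Vhat_poly[OF \<phi>h[OF that]] by simp_all
  have \<Omega>D: "\<Omega> j \<subseteq> ?D" if "j \<in> {1..J}" for j
  proof -
    have "\<forall>j\<in>{1..J}. \<exists>\<E>\<subseteq>coarse_faces M. \<Omega> j = \<Union>(nbhd M ` \<E>)"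
      by (insert adm, unfold admissible_regions_def, elim conjE, assumption)
    from bspec[OF this that] obtain \<E> where "\<Omega> j = \<Union>(nbhd M ` \<E>)" by (elim exE conjE)
    then show ?thesis using UN_least[OF nbhd_subset] by simp
  qed
  have disj: "cells M (\<Omega> i) \<inter> cells M (\<Omega> j) = {}" if "i \<in> {1..J}" "j \<in> {1..J}" "i \<noteq> j" for i j
  proof -
    have "\<forall>j\<in>{1..J}. \<forall>k\<in>{1..J}. j \<noteq> k \<longrightarrow> interior (\<Omega> j) \<inter> interior (\<Omega> k) = {}"
      by (insert adm, unfold admissible_regions_def, elim conjE, assumption)
    from bspec[OF bspec[OF this that(1)] that(2)] that(3) show ?thesis by (intro disjoint_regions) simp
  qed
  define e where "e = v - u"
  define e' where "e' = v - u'"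
  define s where "s = (\<Sum>j\<in>{1..J}. \<phi> j)"
  \<comment> \<open>the difference of \<open>e + s\<close> and \<open>e'\<close>, which is a test field at both levels\<close>
  define g where "g = (u' - u) + s"
  have vV: "v \<in> Vsnap M" and uV: "u \<in> V" and u'V: "u' \<in> V'"
    by (insert snap s s', unfold mixed_solution_def, elim conjE, assumption)+
  have p: "v \<in> poly_fields" "u \<in> poly_fields" "u' \<in> poly_fields"
    using vV uV u'V V V'(2) Vsnap_poly by (meson subsetD)+
  have "s \<in> poly_fields"
    unfolding s_def by (rule subspace_sum[OF subspace_poly_fields \<phi>p])
  then have ep: "e \<in> poly_fields" "e' \<in> poly_fields" "s \<in> poly_fields"
    unfolding e_def e'_def using energy.mem(3) p by simp_all
  note err = mixed_solution_error[OF s' s V'(2) V]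
  have sV': "s \<in> V'"
    unfolding s_def by (rule subspace_sum[OF V'(1)]) (simp add: V'_eq span_base)
  have gV': "g \<in> V'"
    unfolding g_def using subspace_add[OF V'(1) subspace_diff[OF V'(1) u'V subsetD[OF V'(3) uV]] sV'] .
  have gV: "g \<in> Vsnap M" using V'(2) gV' by (rule subsetD)
  have gp: "g \<in> poly_fields" using Vsnap_poly gV by (rule subsetD)
  have sd: "s \<in> {w \<in> poly_fields. div_free M w}"
    unfolding s_def
  proof (rule subspace_sum)
    show "subspace {w \<in> poly_fields. div_free M w}"
      unfolding subspace_def
      by (auto simp: div_free_zero div_free_add energy.mem) (simp add: div_free_def Div_scaleR)
  qed (simp add: \<phi>p \<phi>d)
  have gd: "div_free M g"
    unfolding g_def using div_free_add[OF subsetD[OF Vsnap_poly err(1)] ep(3) err(2)] sd by simp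
  have gz: "ncomp M g (bd_normal M f) f x = 0" if f: "f \<in> bd_faces M" "x \<in> f" for f x
  proof -
    have "s \<in> {w. ncomp M w (bd_normal M f) f x = 0}"
      unfolding s_def
    proof (rule subspace_sum)
      show "subspace {w. ncomp M w (bd_normal M f) f x = 0}"
        by (simp add: subspace_def ncomp_add ncomp_scaleR ncomp_zero)
    qed (simp add: V_region_zero_flux[OF \<phi>r f])
    then show ?thesis using err(3)[OF f] by (simp add: g_def ncomp_add)
  qed
  have "kprod M ?D v g = 0" by (rule mixed_solution_test[OF snap gV gd gz])
  moreover have "kprod M ?D u' g = 0" by (rule mixed_solution_test[OF s' gV' gd gz])
  ultimately have e'g: "kprod M ?D e' g = 0"
    unfolding e'_def using energy.diff_left[OF p(1,3) gp] by simp
  have "e + s = e' + g" by (simp add: e_def e'_def g_def)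
  then have "kprod M ?D e' e' \<le> kprod M ?D (e + s) (e + s)"
    using energy.square_add[OF ep(2) gp, of ?D] e'g energy.nonneg[OF gp, of ?D] by simp
  also have "\<dots> = kprod M ?D e e + 2 * kprod M ?D e s + kprod M ?D s s"
    by (rule energy.square_add[OF ep(1,3)])
  also have "kprod M ?D e s = - (\<Sum>j\<in>{1..J}. kprod M (\<Omega> j) (\<phi> j) (\<phi> j))"
  proof -
    have "kprod M ?D e (\<phi> j) = - kprod M (\<Omega> j) (\<phi> j) (\<phi> j)" if j: "j \<in> {1..J}" for j
    proof -
      have "kprod M ?D e (\<phi> j) = - kprod M ?D u (\<phi> j)"
        unfolding e_def energy.diff_left[OF p(1,2) \<phi>p[OF j]]
        using mixed_solution_test[OF snap \<phi>V[OF j] \<phi>d[OF j] V_region_zero_flux[OF \<phi>r[OF j]]] by simp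
      also have "kprod M ?D u (\<phi> j) = kprod M (\<Omega> j) u (\<phi> j)"
        by (rule kprod_restrict[OF \<Omega>D[OF j] V_region_outside[OF \<phi>r[OF j]]])
      also have "\<dots> = residual M u p (\<Omega> j) (\<phi> j)"
        using sprod_div_free[OF \<phi>d[OF j]] by (simp add: residual_def)
      also have "\<dots> = kprod M (\<Omega> j) (\<phi> j) (\<phi> j)" by (rule riesz[OF j \<phi>h[OF j]])
      finally show ?thesis .
    qed
    moreover have "kprod M ?D e s = (\<Sum>j\<in>{1..J}. kprod M ?D e (\<phi> j))"
      unfolding s_def by (rule energy.sum_right[OF \<phi>p ep(1)])
    ultimately show ?thesis by (simp add: sum_negf)
  qed
  also have "kprod M ?D s s = (\<Sum>j\<in>{1..J}. kprod M (\<Omega> j) (\<phi> j) (\<phi> j))"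
  proof -
    have "kprod M ?D s (\<phi> j) = kprod M (\<Omega> j) (\<phi> j) (\<phi> j)" if j: "j \<in> {1..J}" for j
    proof -
      have "kprod M ?D (\<phi> i) (\<phi> j) = (if i = j then kprod M (\<Omega> j) (\<phi> j) (\<phi> j) else 0)"
        if i: "i \<in> {1..J}" for i
      proof -
        have eq: "kprod M ?D (\<phi> i) (\<phi> j) = kprod M (\<Omega> j) (\<phi> i) (\<phi> j)"
          by (rule kprod_restrict[OF \<Omega>D[OF j] V_region_outside[OF \<phi>r[OF j]]])
        have "kprod M (\<Omega> j) (\<phi> i) (\<phi> j) = 0" if ij: "i \<noteq> j"
        proof -
          have "\<phi> i \<tau> = (0::'a vfield) \<tau>" if \<tau>: "\<tau> \<in> cells M (\<Omega> j)" for \<tau>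
          proof -
            have "\<tau> \<notin> cells M (\<Omega> i)" using disj[OF i j ij] \<tau> by blast
            then show ?thesis using V_region_outside[OF \<phi>r[OF i]] by simp
          qed
          then have "kprod M (\<Omega> j) (\<phi> i) (\<phi> j) = kprod M (\<Omega> j) 0 (\<phi> j)"
            by (rule kprod_cong[OF _ refl])
          then show ?thesis using energy.zero_left[OF \<phi>p[OF j]] by simp
        qed
        then show ?thesis using eq by simp
      qed
      moreover have "kprod M ?D s (\<phi> j) = (\<Sum>i\<in>{1..J}. kprod M ?D (\<phi> i) (\<phi> j))"
        unfolding s_def by (rule energy.sum_left[OF \<phi>p \<phi>p[OF j]])
      ultimately show ?thesis using j by simp
    qed
    moreover have "kprod M ?D s (\<Sum>j\<in>{1..J}. \<phi> j) = (\<Sum>j\<in>{1..J}. kprod M ?D s (\<phi> j))"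
      by (rule energy.sum_right[OF \<phi>p ep(3)])
    ultimately show ?thesis unfolding s_def[symmetric] by simp
  qed
  finally have main: "kprod M ?D e' e' + (\<Sum>j\<in>{1..J}. kprod M (\<Omega> j) (\<phi> j) (\<phi> j)) \<le> kprod M ?D e e"
    by simp
  have "(\<Sum>j\<in>{1..J}. (region_res_norm M u p (\<Omega> j))\<^sup>2) \<le> (\<Sum>j\<in>{1..J}. kprod M (\<Omega> j) (\<phi> j) (\<phi> j))"
    by (intro sum_mono region_res_norm_le \<phi>h riesz)
  moreover have "(L2_norm M ?D w)\<^sup>2 = kprod M ?D w w" if "w \<in> poly_fields" for w
    using energy.nonneg[OF that] by (simp add: L2_norm_def)
  ultimately show ?thesis
    using main ep(1,2) unfolding e_def[symmetric] e'_def[symmetric] by simp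
qed

text \<open>A field without boundary flux has no part on boundary faces, so that these do not enter the
  a posteriori bound.\<close>

lemma face_part_boundary:
  assumes v: "v \<in> Vsnap M" and E: "E \<in> coarse_faces M" "card (nbhd_blocks M E) \<noteq> 2"
    and z: "\<And>e x. e \<in> bd_faces M \<Longrightarrow> x \<in> e \<Longrightarrow> ncomp M v (bd_normal M e) e x = 0"
  shows "face_part M E v = 0"
proof (rule face_part_eq_0)
  fix e assume e: "e \<in> fine_faces_in M E"
  have "E \<subseteq> frontier (Dom M)" using coarse_face_cases[OF E(1)] E(2) by simp
  then have bd: "e \<in> bd_faces M" by (rule fine_face_boundary[OF E(1) _ e])
  have x: "(SOME x. x \<in> e) \<in> e" using fine_facet(3)[OF e] by (simp add: some_in_eq)
  have "fnormal M E = bd_normal M e \<or> fnormal M E = - bd_normal M e"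
    unfolding bd_normal_def by (rule normal_component_sign[OF E(1) e fine_facet(5,6)[OF e]])
  then show "coef M E e v = 0"
    unfolding coef_def using z[OF bd x] by (auto simp: ncomp_def)
qed

lemma residual_zero_of_solution:
  assumes s: "mixed_solution M gH V u p" and E: "E \<in> coarse_faces M" "card (nbhd_blocks M E) = 2"
    and w: "w \<in> V" "w \<in> Vsnap_loc M E"
  shows "residual M u p (nbhd M E) w = 0"
proof -
  have "w \<in> V_region M (nbhd M E)"
    unfolding V_region_def
    by (rule subsetD[OF Vsnap_loc_subset_sum w(2)]) (simp add: E)
  then have "w \<in> zero_flux M V" using w(1) V_region_zero_flux by (simp add: zero_flux_def)
  moreover have "\<forall>w\<in>zero_flux M V. kprod M (closure (Dom M)) u w - sprod M (closure (Dom M)) (Div w) p = 0"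
    by (insert s, unfold mixed_solution_def, elim conjE, assumption)
  ultimately have "residual M u p (closure (Dom M)) w = 0" unfolding residual_def by (rule bspec[rotated])
  then show ?thesis
    using residual_restrict[OF nbhd_subset loc_outside[OF E(1) w(2)]] by simp
qed

lemma a_posteriori_solution_SP2:
  assumes snap: "mixed_solution M gH (Vsnap M) v p\<^sub>0" and s: "mixed_solution M gH V u p"
    and V: "V \<subseteq> Vsnap M"
    and eig: "\<And>E. E \<in> coarse_faces M \<Longrightarrow> eigensystem SP2 M E (lam E) (\<phi> E)"
    and l: "\<And>E. E \<in> coarse_faces M \<Longrightarrow> l E \<le> num_snap M E"
    and \<phi>: "\<And>E j. E \<in> coarse_faces M \<Longrightarrow> j \<in> {1..l E} \<Longrightarrow> \<phi> E j \<in> Vsnap_loc M E \<and> \<phi> E j \<in> V"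
  shows "(L2_norm M (closure (Dom M)) (v - u))\<^sup>2 \<le> real (max_faces M) * error_indicator SP2 M lam l u p"
proof -
  note err = mixed_solution_error[OF snap s order.refl V]
  have vV: "v \<in> Vsnap M" and uV: "u \<in> V" and pQ: "p \<in> Q_space M"
    by (insert snap s, unfold mixed_solution_def, elim conjE, assumption)+
  have pf: "v \<in> poly_fields" "u \<in> poly_fields" "v - u \<in> poly_fields"
    using vV uV V err(1) Vsnap_poly by (meson subsetD)+
  show ?thesis
  proof (rule a_posteriori_SP2[OF pf(2) pQ err(1,2) eig l])
    show "face_part M E (v - u) = 0" if "E \<in> coarse_faces M" "card (nbhd_blocks M E) \<noteq> 2" for E
      by (rule face_part_boundary[OF err(1) that err(3)])
    show "residual M u p (nbhd M E) (\<phi> E j) = 0"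
      if "E \<in> coarse_faces M" "card (nbhd_blocks M E) = 2" "j \<in> {1..l E}" for E j
      using residual_zero_of_solution[OF s that(1,2)] \<phi>[OF that(1,3)] by simp
    show "kprod M (closure (Dom M)) (v - u) (v - u) = - kprod M (closure (Dom M)) u (v - u)"
      using energy.diff_left[OF pf(1,2,3)] mixed_solution_test[OF snap err(1,2,3)] by simp
  qed
qed

end

theorem theorem5:
  fixes M :: "'a::euclidean_space gmsfem"
    and sp :: spectral_problem
    and lam :: "'a set \<Rightarrow> nat \<Rightarrow> real"
    and \<phi> :: "'a set \<Rightarrow> nat \<Rightarrow> 'a vfield"
    and l :: "'a set \<Rightarrow> nat"
    and gH :: "'a set \<Rightarrow> real"
    and v_snap :: "'a vfield" and p_snap :: "'a sfield"
    and V_ms :: "nat \<Rightarrow> 'a vfield set"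
    and v_ms :: "nat \<Rightarrow> 'a vfield" and p_ms :: "nat \<Rightarrow> 'a sfield"
    and J :: "nat \<Rightarrow> nat" and \<Omega> :: "nat \<Rightarrow> nat \<Rightarrow> 'a set"
    and C\<^sub>V :: real and m :: nat
  assumes "mixed_gmsfem M"
    and "sp = SP1 \<Longrightarrow> \<forall>E\<in>coarse_faces M. \<forall>e\<in>fine_faces_in M E.
           surf_integrable e (\<lambda>x. inverse (perm M x))"
    and "\<And>E. E \<in> coarse_faces M \<Longrightarrow> eigensystem sp M E (lam E) (\<phi> E)"
    and "boundary_flux M gH"
    and "mixed_solution M gH (Vsnap M) v_snap p_snap"
    and "online_run M gH l \<phi> V_ms v_ms p_ms J \<Omega>"
    and a_posteriori: "sp = SP1 \<Longrightarrow>
           (L2_norm M (closure (Dom M)) (v_snap - v_ms m))\<^sup>2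
             \<le> C_err SP1 M C\<^sub>V * error_indicator SP1 M lam l (v_ms m) (p_ms m)"
    and "C_err sp M C\<^sub>V * error_indicator sp M lam l (v_ms m) (p_ms m) \<noteq> 0"
  shows "(L2_norm M (closure (Dom M)) (v_snap - v_ms (m + 1)))\<^sup>2
         \<le> (1 - (\<Sum>j=1..J m. (region_res_norm M (v_ms m) (p_ms m) (\<Omega> m j))\<^sup>2)
                / (C_err sp M C\<^sub>V * error_indicator sp M lam l (v_ms m) (p_ms m)))
            * (L2_norm M (closure (Dom M)) (v_snap - v_ms m))\<^sup>2"
proof -
  interpret gmsfem M by unfold_locales (fact assms(1))
  have off: "offline_space M l \<phi> (V_ms 0)"
    and run: "\<forall>k. mixed_solution M gH (V_ms k) (v_ms k) (p_ms k) \<and> admissible_regions M (J k) (\<Omega> k) \<and>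
          enrichment M (v_ms k) (p_ms k) (J k) (\<Omega> k) (V_ms k) (V_ms (Suc k))"
    by (insert assms(6), unfold online_run_def, elim conjE, assumption)+
  have sol: "mixed_solution M gH (V_ms k) (v_ms k) (p_ms k)"
    and adm: "admissible_regions M (J k) (\<Omega> k)"
    and en: "enrichment M (v_ms k) (p_ms k) (J k) (\<Omega> k) (V_ms k) (V_ms (Suc k))" for k
    using spec[OF run, of k] by simp_all
  have "\<forall>E\<in>coarse_faces M. l E \<le> num_snap M E"
    by (insert off, unfold offline_space_def, elim conjE, assumption)
  then have l: "l E \<le> num_snap M E" if "E \<in> coarse_faces M" for E using that by simp
  have \<phi>l: "\<phi> E j \<in> Vsnap_loc M E" if "E \<in> coarse_faces M" "j \<in> {1..l E}" for E j
  proof -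
    have "\<forall>j\<in>{1..num_snap M E}. \<phi> E j \<in> Vsnap_loc M E \<and>
        (\<forall>w\<in>Vsnap_loc M E. a_form sp M E (\<phi> E j) w = lam E j * s_form sp M E (\<phi> E j) w)"
      by (insert assms(3)[OF that(1)], unfold eigensystem_def, elim conjE, assumption)
    moreover have "j \<in> {1..num_snap M E}" using that(2) l[OF that(1)] by simp
    ultimately show ?thesis by simp
  qed
  have \<phi>V: "\<phi> E j \<in> Vsnap M" if "E \<in> coarse_faces M" "j \<in> {1..l E}" for E j
    using Vsnap_loc_subset[OF that(1)] \<phi>l[OF that] by (rule subsetD)
  have V: "V_ms k \<subseteq> Vsnap M \<and> V_ms 0 \<subseteq> V_ms k" for k
  proof (induction k)
    case 0
    show ?case using offline_space_subset(2)[OF off \<phi>V] by simp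
  next
    case (Suc k)
    then show ?case using enrichment_subset(2,3)[OF en[of k]] by auto
  qed
  \<comment> \<open>with \<open>X \<le> T\<close>, subtracting \<open>S\<close> is at least as good as subtracting the fraction \<open>X/T\<close> of it\<close>
  define S where "S = (\<Sum>j=1..J m. (region_res_norm M (v_ms m) (p_ms m) (\<Omega> m j))\<^sup>2)"
  define T where "T = C_err sp M C\<^sub>V * error_indicator sp M lam l (v_ms m) (p_ms m)"
  define X where "X = (L2_norm M (closure (Dom M)) (v_snap - v_ms m))\<^sup>2"
  have XT: "X \<le> T"
  proof (cases sp)
    case SP1
    then show ?thesis using a_posteriori by (simp add: X_def T_def)
  next
    case SP2
    have "\<phi> E j \<in> V_ms m" if "E \<in> coarse_faces M" "j \<in> {1..l E}" for E j
      using offline_space_subset(3)[OF off \<phi>V that] V[of m] by auto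
    then show ?thesis
      using a_posteriori_solution_SP2[OF assms(5) sol[of m] _ _ l, of lam \<phi>] V[of m] assms(3) \<phi>l SP2
      by (simp add: X_def T_def)
  qed
  have step: "(L2_norm M (closure (Dom M)) (v_snap - v_ms (m + 1)))\<^sup>2 + S \<le> X"
    using enrichment_step[OF assms(5) sol[of m] sol[of "Suc m"] _ adm en] V[of m]
    by (simp add: S_def X_def)
  have "0 \<le> X" "0 \<le> S" by (simp_all add: X_def S_def sum_nonneg)
  moreover have "0 < T" using assms(8) XT \<open>0 \<le> X\<close> by (simp add: T_def less_le)
  ultimately have "S / T * X \<le> S" using XT by (simp add: divide_le_eq mult_left_mono)
  then have "X - S \<le> (1 - S / T) * X" by (simp add: left_diff_distrib)
  with step show ?thesis unfolding S_def[symmetric] T_def[symmetric] X_def[symmetric] by linarith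
qed

end
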